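(* Let $d\ge 1$ be an integer and let $(q,r)$ be a lattice-admissible pair, i.e. $2\le q,r\le\infty$, $\frac{3}{q}+\frac{d}{r}=\frac{d}{2}$ and $(q,r,d)\ne(2,\infty,3)$. Then for any $\epsilon>0$ there exists $C>0$, independent of $h$, such that for every $h=\frac{\pi}{M}\in(0,1]$ ($M$ a positive integer) and every $u_{h,0}:\mathbb{T}_h^d\to\mathbb{C}$, $$\left\| e^{it\Delta_h}u_{h,0}\right\|_{L_t^q([0,1]; L_h^r)}\leq C \left\|\langle\nabla_h\rangle^{\frac{2}{q}+\epsilon}u_{h,0} \right\|_{L_h^2}.$$
   Context: For a positive integer $M$ and mesh size $h=\frac{\pi}{M}$, $\mathbb{T}_h^d:=h\mathbb{Z}^d/2\pi\mathbb{Z}^d$ is the periodic lattice with $(2M)^d$ points, with representatives $h(m_1,\dots,m_d)$, $m_j\in\{-M,\dots,M-1\}$. For $f:\mathbb{T}_h^d\to\mathbb{C}$, $\|f\|_{L_h^r}:=\{h^d\sum_{x\in\mathbb{T}_h^d}|f(x)|^r\}^{1/r}$ for $1\le r<\infty$ and $\|f\|_{L_h^\infty}:=\sup_{x\in\mathbb{T}_h^d}|f(x)|$. The discrete Laplacian is $(\Delta_h u)(x):=\sum_{j=1}^d\frac{u(x+he_j)+u(x-he_j)-2u(x)}{h^2}$, where $e_j$ is the $j$-th standard unit vector. The operator $e^{it\Delta_h}$ is the linear propagator: $u(t)=e^{it\Delta_h}u_{h,0}$ solves $i\partial_tu+\Delta_hu=0$ with $u(0)=u_{h,0}$. The dual lattice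 is $(\mathbb{T}_h^d)^*=\{-M,\dots,M-1\}^d$ (representatives of $\mathbb{Z}^d/\frac{2\pi}{h}\mathbb{Z}^d$), and the discrete Fourier transform is $(\mathcal{F}_hu)(k):=h^d\sum_{x\in\mathbb{T}_h^d}u(x)e^{-ik\cdot x}$ for $k\in(\mathbb{T}_h^d)^*$, with inverse $(\mathcal{F}_h^{-1}v)(x)=\frac{1}{(2\pi)^d}\sum_{k\in(\mathbb{T}_h^d)^*}v(k)e^{ik\cdot x}$. For $s\in\mathbb{R}$, $\langle\nabla_h\rangle^s$ is the Fourier multiplier with symbol $\langle k\rangle^s$, $\langle k\rangle=\sqrt{1+|k|^2}$, i.e. $\mathcal{F}_h(\langle\nabla_h\rangle^su)(k)=\langle k\rangle^s(\mathcal{F}_hu)(k)$ for $k\in\{-M,\dots,M-1\}^d$. *)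

theory Defs
  imports "HOL-Probability.Essential_Supremum"
begin

section \<open>The periodic lattice\<close>

text \<open>
  A point \<open>x = h (m\<^sub>1, \<dots>, m\<^sub>d)\<close> of \<open>h \<int>\<^sup>d\<close> is addressed by its integer coordinates
  \<open>m :: int ^ 'd\<close>. A function on the quotient \<open>h \<int>\<^sup>d / 2\<pi> \<int>\<^sup>d\<close> is a function of \<open>m\<close> with
  period \<open>2\<pi> / h = 2 M\<close> in every coordinate.
\<close>

definition mesh :: "nat \<Rightarrow> real" where
  "mesh M = pi / real M"

definition real_vec :: "int ^ 'd \<Rightarrow> real ^ 'd" where
  "real_vec m = (\<chi> j. real_of_int (m $ j))"

definition lattice_point :: "nat \<Rightarrow> int ^ 'd \<Rightarrow> real ^ 'd" where
  "lattice_point M m = mesh M *\<^sub>R real_vec m"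

text \<open>
  The representatives \<open>{-M, \<dots>, M-1}\<^sup>d\<close>, used both for the lattice (scaled by \<open>h\<close>) and for its
  dual.
\<close>

definition representatives :: "nat \<Rightarrow> (int ^ 'd) set" where
  "representatives M = {m. \<forall>j. m $ j \<in> {- int M .. int M - 1}}"

definition lattice_fun :: "nat \<Rightarrow> (int ^ 'd \<Rightarrow> complex) \<Rightarrow> bool" where
  "lattice_fun M u \<longleftrightarrow> (\<forall>m j. u (m + axis j (2 * int M)) = u m)"

definition lattice_norm :: "nat \<Rightarrow> ereal \<Rightarrow> (int ^ 'd \<Rightarrow> complex) \<Rightarrow> real" where
  "lattice_norm M r f =
    (if r = \<infinity> then SUP m\<in>representatives M. cmod (f m)
     else (mesh M ^ CARD('d) * (\<Sum>m\<in>representatives M. cmod (f m) powr real_of_ereal r))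
            powr (1 / real_of_ereal r))"

section \<open>The discrete Laplacian and its Schroedinger propagator\<close>

definition lattice_laplacian ::
  "nat \<Rightarrow> (int ^ 'd \<Rightarrow> complex) \<Rightarrow> int ^ 'd \<Rightarrow> complex" where
  "lattice_laplacian M u m =
    (\<Sum>j\<in>UNIV. (u (m + axis j 1) + u (m - axis j 1) - 2 * u m) / of_real ((mesh M)\<^sup>2))"

definition lattice_schroedinger ::
  "nat \<Rightarrow> (int ^ 'd \<Rightarrow> complex) \<Rightarrow> (real \<Rightarrow> int ^ 'd \<Rightarrow> complex) \<Rightarrow> bool" where
  "lattice_schroedinger M u0 u \<longleftrightarrow>
    (\<forall>t. lattice_fun M (u t)) \<and> u 0 = u0 \<and>
    (\<forall>t m. \<exists>D. ((\<lambda>s. u s m) has_vector_derivative D) (at t) \<and>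
       \<i> * D + lattice_laplacian M (u t) m = 0)"

text \<open>
  \<open>lattice_propagator M t u0\<close> is \<open>e\<^sup>i\<^sup>t\<^sup>\<Delta> u0\<close>; the solution is unique and exists for every lattice
  function \<open>u0\<close>, see \<open>lattice_schroedinger_ex1\<close> below.
\<close>

definition lattice_propagator ::
  "nat \<Rightarrow> real \<Rightarrow> (int ^ 'd \<Rightarrow> complex) \<Rightarrow> int ^ 'd \<Rightarrow> complex" where
  "lattice_propagator M t u0 = (THE u. lattice_schroedinger M u0 u) t"

section \<open>Fourier multipliers\<close>

definition lattice_dft :: "nat \<Rightarrow> (int ^ 'd \<Rightarrow> complex) \<Rightarrow> int ^ 'd \<Rightarrow> complex" where
  "lattice_dft M u k = of_real (mesh M ^ CARD('d)) *
    (\<Sum>m\<in>representatives M. u m * exp (- \<i> * of_real (real_vec k \<bullet> lattice_point M m)))"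

definition lattice_idft :: "nat \<Rightarrow> (int ^ 'd \<Rightarrow> complex) \<Rightarrow> int ^ 'd \<Rightarrow> complex" where
  "lattice_idft M v m = of_real (1 / (2 * pi) ^ CARD('d)) *
    (\<Sum>k\<in>representatives M. v k * exp (\<i> * of_real (real_vec k \<bullet> lattice_point M m)))"

definition japanese_bracket :: "'a::real_normed_vector \<Rightarrow> real" where
  "japanese_bracket x = sqrt (1 + (norm x)\<^sup>2)"

definition lattice_bessel ::
  "nat \<Rightarrow> real \<Rightarrow> (int ^ 'd \<Rightarrow> complex) \<Rightarrow> int ^ 'd \<Rightarrow> complex" where
  "lattice_bessel M s u =
    lattice_idft M (\<lambda>k. of_real (japanese_bracket (real_vec k) powr s) * lattice_dft M u k)"

section \<open>Mixed norms and admissible exponents\<close>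

text \<open>
  The values are extended reals, so that the norm of a function outside \<open>L\<^sup>q\<close> is infinite.
\<close>

definition unit_interval_norm :: "ereal \<Rightarrow> (real \<Rightarrow> real) \<Rightarrow> ennreal" where
  "unit_interval_norm q g =
    (if q = \<infinity> then esssup (lebesgue_on {0..1}) (\<lambda>t. ennreal \<bar>g t\<bar>)
     else let I = (\<integral>\<^sup>+ t. ennreal (\<bar>g t\<bar> powr real_of_ereal q) \<partial>lebesgue_on {0..1})
          in if I = \<infinity> then \<infinity> else ennreal (enn2real I powr (1 / real_of_ereal q)))"

definition mixed_norm ::
  "nat \<Rightarrow> ereal \<Rightarrow> ereal \<Rightarrow> (real \<Rightarrow> int ^ 'd \<Rightarrow> complex) \<Rightarrow> ennreal" where
  "mixed_norm M q r u = unit_interval_norm q (\<lambda>t. lattice_norm M r (u t))"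

text \<open>In \<^typ>\<open>ereal\<close>, division of a real number by \<open>\<infinity>\<close> gives \<open>0\<close>.\<close>

definition lattice_admissible :: "nat \<Rightarrow> ereal \<Rightarrow> ereal \<Rightarrow> bool" where
  "lattice_admissible d q r \<longleftrightarrow>
    2 \<le> q \<and> q \<le> \<infinity> \<and> 2 \<le> r \<and> r \<le> \<infinity> \<and>
    3 / q + ereal (real d) / r = ereal (real d / 2) \<and> (q, r, d) \<noteq> (2, \<infinity>, 3)"

section \<open>Well-posedness of the linear equation\<close>

lemma lattice_fun_shift_int:
  assumes "lattice_fun M u"
  shows "u (m + axis j (2 * int M * n)) = u m"
proof (induction n rule: int_induct[where k = 0])
  case base
  have "m + axis j (2 * int M * 0) = m" by (simp add: vec_eq_iff axis_def)
  then show ?case by (simp only:)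
next
  case (step1 i)
  have "m + axis j (2 * int M * (i + 1)) = (m + axis j (2 * int M * i)) + axis j (2 * int M)"
    by (simp add: vec_eq_iff axis_def algebra_simps)
  with step1 assms show ?case by (metis lattice_fun_def)
next
  case (step2 i)
  have "m + axis j (2 * int M * i) = (m + axis j (2 * int M * (i - 1))) + axis j (2 * int M)"
    by (simp add: vec_eq_iff axis_def algebra_simps)
  with step2 assms show ?case by (metis lattice_fun_def)
qed

lemma lattice_fun_representative:
  fixes m :: "int ^ 'd"
  assumes "M > 0"
  obtains m' where "m' \<in> representatives M" "\<And>u. lattice_fun M u \<Longrightarrow> u m = u m'"
proof -
  define m' :: "int ^ 'd" where "m' = (\<chi> j. (m $ j + int M) mod (2 * int M) - int M)"
  define n where "n j = (m $ j + int M) div (2 * int M)" for j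
  have "m' \<in> representatives M"
  proof -
    have "m' $ j \<in> {- int M .. int M - 1}" for j
      using pos_mod_bound[of "2 * int M" "m $ j + int M"]
        pos_mod_sign[of "2 * int M" "m $ j + int M"] assms
      by (simp add: m'_def)
    then show ?thesis by (simp add: representatives_def)
  qed
  moreover have "u m = u m'" if u: "lattice_fun M u" for u
  proof -
    have *: "u (m' + (\<Sum>j\<in>J. axis j (2 * int M * n j))) = u m'" if "finite J" for J
      using that
    proof induction
      case (insert j J)
      have "m' + (\<Sum>j\<in>insert j J. axis j (2 * int M * n j)) =
          (m' + (\<Sum>j\<in>J. axis j (2 * int M * n j))) + axis j (2 * int M * n j)"
        using insert by (simp add: ac_simps)
      then show ?case using insert lattice_fun_shift_int[OF u] by metis
    qed simp
    have sum_axis: "(\<Sum>j\<in>UNIV. axis j (f j)) = (\<chi> i. f i)" for f :: "'d \<Rightarrow> int"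
      by (simp add: vec_eq_iff axis_def)
    have "m $ i = m' $ i + 2 * int M * n i" for i
      using mult_div_mod_eq[of "2 * int M" "m $ i + int M"]
      unfolding m'_def n_def vec_lambda_beta by linarith
    then have "m = m' + (\<Sum>j\<in>UNIV. axis j (2 * int M * n j))"
      unfolding sum_axis by (simp add: vec_eq_iff)
    with *[of UNIV] show ?thesis by simp
  qed
  ultimately show ?thesis using that by blast
qed

lemma finite_representatives [simp]: "finite (representatives M :: (int ^ 'd) set)"
proof -
  have "(representatives M :: (int ^ 'd) set)
      \<subseteq> vec_lambda ` (UNIV \<rightarrow>\<^sub>E {- int M .. int M - 1})"
  proof
    fix m :: "int ^ 'd" assume "m \<in> representatives M"
    then have "vec_nth m \<in> UNIV \<rightarrow>\<^sub>E {- int M .. int M - 1}"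
      by (auto simp: representatives_def)
    then show "m \<in> vec_lambda ` (UNIV \<rightarrow>\<^sub>E {- int M .. int M - 1})"
      by (metis image_eqI vec_nth_inverse)
  qed
  then show ?thesis by (rule finite_subset) (intro finite_imageI finite_PiE; simp)
qed

lemma lattice_fun_bounded:
  fixes u :: "int ^ 'd \<Rightarrow> complex"
  assumes "M > 0" "lattice_fun M u"
  obtains B where "B \<ge> 0" "\<And>m. cmod (u m) \<le> B"
proof -
  have "cmod (u m) \<le> (\<Sum>m\<in>representatives M. cmod (u m))" for m
  proof -
    obtain m' where "m' \<in> representatives M" "u m = u m'"
      using lattice_fun_representative[OF assms(1), of m] assms(2) by metis
    then show ?thesis
      using member_le_sum[of m' "representatives M" "\<lambda>m. cmod (u m)"] by simp
  qed
  then show ?thesis using that by (meson norm_ge_zero sum_nonneg)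
qed

lemma lattice_fun_translate:
  assumes "lattice_fun M u"
  shows "u (m + axis j (2 * int M) + v) = u (m + v)"
    and "u (m + axis j (2 * int M) - v) = u (m - v)"
proof -
  have "m + axis j (2 * int M) + v = (m + v) + axis j (2 * int M)"
    "m + axis j (2 * int M) - v = (m - v) + axis j (2 * int M)"
    by (simp_all add: vec_eq_iff)
  with assms show "u (m + axis j (2 * int M) + v) = u (m + v)"
    "u (m + axis j (2 * int M) - v) = u (m - v)"
    by (simp_all only: lattice_fun_def)
qed

lemma lattice_fun_laplacian:
  assumes "lattice_fun M u"
  shows "lattice_fun M (lattice_laplacian M u)"
  using assms lattice_fun_translate[OF assms]
  by (simp add: lattice_fun_def lattice_laplacian_def)

lemma lattice_fun_sum_shift:
  fixes f :: "int ^ 'd \<Rightarrow> complex"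
  assumes "M > 0" "lattice_fun M f"
  shows "(\<Sum>m\<in>representatives M. f (m + axis j 1)) = (\<Sum>m\<in>representatives M. f m)"
proof -
  define S where "S m = (if m $ j = int M - 1 then m + axis j (1 - 2 * int M) else m + axis j 1)"
    for m :: "int ^ 'd"
  define T where "T m = (if m $ j = - int M then m + axis j (2 * int M - 1) else m - axis j 1)"
    for m :: "int ^ 'd"
  have fS: "f (m + axis j 1) = f (S m)" for m
  proof (cases "m $ j = int M - 1")
    case True
    have "m + axis j 1 = S m + axis j (2 * int M)"
      using True by (simp add: S_def vec_eq_iff axis_def)
    then show ?thesis using assms(2) by (simp add: lattice_fun_def)
  qed (simp add: S_def)
  have rep: "(m \<in> representatives M) \<longleftrightarrow> (\<forall>i. - int M \<le> m $ i \<and> m $ i \<le> int M - 1)"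
    for m :: "int ^ 'd" by (simp add: representatives_def)
  show ?thesis
  proof (rule sum.reindex_bij_witness[of _ T S])
    fix m :: "int ^ 'd" assume m: "m \<in> representatives M"
    show "T (S m) = m" "S (T m) = m"
      using m[unfolded rep, rule_format, of j] assms(1)
      by (auto simp: S_def T_def vec_eq_iff axis_def)
    show "S m \<in> representatives M"
      unfolding rep
    proof
      fix i show "- int M \<le> S m $ i \<and> S m $ i \<le> int M - 1"
        using m[unfolded rep, rule_format, of i] assms(1)
        by (auto simp: S_def axis_def)
    qed
    show "T m \<in> representatives M"
      unfolding rep
    proof
      fix i show "- int M \<le> T m $ i \<and> T m $ i \<le> int M - 1"
        using m[unfolded rep, rule_format, of i] assms(1)
        by (auto simp: T_def axis_def)
    qed
    show "f (S m) = f (m + axis j 1)" by (simp add: fS)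
  qed
qed

lemma Im_inner_laplacian:
  fixes w :: "int ^ 'd \<Rightarrow> complex"
  assumes "M > 0" "lattice_fun M w"
  shows "Im (\<Sum>m\<in>representatives M. cnj (w m) * lattice_laplacian M w m) = 0"
proof -
  have "Im (\<Sum>m\<in>representatives M.
      cnj (w m) * (w (m + axis j 1) + w (m - axis j 1) - 2 * w m)) = 0" for j
  proof -
    have "lattice_fun M (\<lambda>m. cnj (w m) * w (m - axis j 1))"
      using assms(2) lattice_fun_translate(2)[OF assms(2)] by (simp add: lattice_fun_def)
    from lattice_fun_sum_shift[OF assms(1) this, of j]
    have 1: "(\<Sum>m\<in>representatives M. cnj (w m) * w (m - axis j 1)) =
        cnj (\<Sum>m\<in>representatives M. cnj (w m) * w (m + axis j 1))"
      by (simp add: mult.commute)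
    have 2: "(\<Sum>m\<in>representatives M. cnj (w m) * (w (m + axis j 1) + w (m - axis j 1) - 2 * w m)) =
        (\<Sum>m\<in>representatives M. cnj (w m) * w (m + axis j 1)) +
        (\<Sum>m\<in>representatives M. cnj (w m) * w (m - axis j 1)) -
        (\<Sum>m\<in>representatives M. 2 * (cnj (w m) * w m))"
      by (simp add: algebra_simps sum.distrib sum_subtractf)
    have 3: "Im (\<Sum>m\<in>representatives M. 2 * (cnj (w m) * w m)) = 0"
      by (simp add: Im_sum)
    show ?thesis
      unfolding 2 1 minus_complex.simps plus_complex.simps cnj.simps 3 by linarith
  qed
  note j = this
  have "(\<Sum>m\<in>representatives M. cnj (w m) * lattice_laplacian M w m) =
      (\<Sum>j\<in>UNIV. (\<Sum>m\<in>representatives M.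
        cnj (w m) * (w (m + axis j 1) + w (m - axis j 1) - 2 * w m)) / of_real ((mesh M)\<^sup>2))"
    unfolding lattice_laplacian_def sum_distrib_left sum_divide_distrib
    by (subst sum.swap) simp
  also have "Im \<dots> = 0"
    by (subst Im_sum) (use j in \<open>simp add: Im_divide_of_real del: of_real_power\<close>)
  finally show ?thesis .
qed

lemma lattice_schroedinger_unique:
  fixes u v :: "real \<Rightarrow> int ^ 'd \<Rightarrow> complex"
  assumes M: "M > 0" and u: "lattice_schroedinger M u0 u" and v: "lattice_schroedinger M u0 v"
  shows "u = v"
proof -
  define w where "w t m = u t m - v t m" for t m
  have wf: "lattice_fun M (w t)" for t
    using u v by (auto simp: lattice_schroedinger_def lattice_fun_def w_def)
  have lap: "lattice_laplacian M (w t) m =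
      lattice_laplacian M (u t) m - lattice_laplacian M (v t) m" for t m
    unfolding lattice_laplacian_def w_def sum_subtractf[symmetric] diff_divide_distrib[symmetric]
    by (rule sum.cong) (simp_all add: algebra_simps)
  have *: "D = \<i> * L" if "\<i> * D + L = 0" for D L :: complex
  proof -
    have "\<i> * (\<i> * D + L) = 0" using that by simp
    then show ?thesis by (simp add: distrib_left mult.assoc[symmetric])
  qed
  have dw: "((\<lambda>s. w s m) has_vector_derivative \<i> * lattice_laplacian M (w t) m) (at t)" for t m
  proof -
    obtain D E where "((\<lambda>s. u s m) has_vector_derivative D) (at t)"
      "\<i> * D + lattice_laplacian M (u t) m = 0"
      "((\<lambda>s. v s m) has_vector_derivative E) (at t)"
      "\<i> * E + lattice_laplacian M (v t) m = 0"
      using u v unfolding lattice_schroedinger_def by meson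
    then show ?thesis
      unfolding w_def[abs_def] using lap[of t m]
      by (auto dest!: * simp: w_def[abs_def] right_diff_distrib
          intro!: has_vector_derivative_diff)
  qed
  define E where "E t = (\<Sum>m\<in>representatives M. (w t m) * cnj (w t m))" for t
  have dE: "(E has_vector_derivative 0) (at t)" for t
  proof -
    have "(E has_vector_derivative (\<Sum>m\<in>representatives M.
        w t m * cnj (\<i> * lattice_laplacian M (w t) m) +
        \<i> * lattice_laplacian M (w t) m * cnj (w t m))) (at t)"
      unfolding E_def[abs_def]
      by (intro has_vector_derivative_sum has_vector_derivative_mult has_vector_derivative_cnj dw)
    also have "(\<Sum>m\<in>representatives M.
        w t m * cnj (\<i> * lattice_laplacian M (w t) m) +
        \<i> * lattice_laplacian M (w t) m * cnj (w t m)) =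
        \<i> * ((\<Sum>m\<in>representatives M. cnj (w t m) * lattice_laplacian M (w t) m)
          - cnj (\<Sum>m\<in>representatives M. cnj (w t m) * lattice_laplacian M (w t) m))"
      by (simp add: sum.distrib sum_subtractf right_diff_distrib sum_distrib_left sum_negf
          algebra_simps)
    also have "\<dots> = 0"
      unfolding complex_diff_cnj Im_inner_laplacian[OF M wf] by simp
    finally show ?thesis .
  qed
  have "E t = E 0" for t
  proof -
    obtain c where "\<And>x. E x = c"
      using has_vector_derivative_zero_constant[of UNIV E] dE by auto
    then show ?thesis by simp
  qed
  moreover have "E 0 = 0"
    using u v by (simp add: E_def w_def lattice_schroedinger_def)
  ultimately have E0: "E t = 0" for t by simp
  have "w t m = 0" for t m
  proof -
    obtain m' where m': "m' \<in> representatives M" "w t m = w t m'"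
      using lattice_fun_representative[OF M, of m] wf by metis
    have "of_real (\<Sum>m\<in>representatives M. (cmod (w t m))\<^sup>2) = E t"
      by (simp add: E_def complex_norm_square[symmetric] del: of_real_sum of_real_power) (simp add: complex_norm_square)
    then have "(\<Sum>m\<in>representatives M. (cmod (w t m))\<^sup>2) = 0"
      using E0 by (metis of_real_eq_0_iff)
    then show ?thesis using m' by (simp add: sum_nonneg_eq_0_iff)
  qed
  then show ?thesis by (auto simp: w_def fun_eq_iff)
qed

lemma lattice_schroedinger_exists:
  fixes u0 :: "int ^ 'd \<Rightarrow> complex"
  assumes M: "M > 0" and u0: "lattice_fun M u0"
  shows "\<exists>u. lattice_schroedinger M u0 u"
proof -
  define L where "L n = (lattice_laplacian M ^^ n) u0" for n
  have Lf: "lattice_fun M (L n)" for n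
    by (induction n) (auto simp: L_def u0 intro: lattice_fun_laplacian)
  obtain B where B: "B \<ge> 0" "\<And>m. cmod (u0 m) \<le> B"
    using lattice_fun_bounded[OF M u0] by blast
  define K where "K = real CARD('d) * (4 / (mesh M)\<^sup>2)"
  have K: "K \<ge> 0" by (simp add: K_def)
  have lapb: "cmod (lattice_laplacian M f m) \<le> K * A" if f: "\<And>m. cmod (f m) \<le> A"
    for f :: "int ^ 'd \<Rightarrow> complex" and A m
  proof -
    have "cmod (lattice_laplacian M f m) \<le> (\<Sum>j\<in>(UNIV::'d set). 4 * A / (mesh M)\<^sup>2)"
      unfolding lattice_laplacian_def
    proof (rule sum_norm_le)
      fix j :: 'd
      have "cmod (f (m + axis j 1) + f (m - axis j 1) - 2 * f m) \<le>
          cmod (f (m + axis j 1)) + cmod (f (m - axis j 1)) + cmod (2 * f m)"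
        by (meson norm_triangle_ineq norm_triangle_ineq4 order_trans add_right_mono)
      also have "\<dots> \<le> 4 * A"
        using f[of "m + axis j 1"] f[of "m - axis j 1"] f[of m] by (simp add: norm_mult)
      finally show "cmod ((f (m + axis j 1) + f (m - axis j 1) - 2 * f m) / of_real ((mesh M)\<^sup>2))
          \<le> 4 * A / (mesh M)\<^sup>2"
        by (simp add: norm_divide norm_power divide_right_mono)
    qed
    then show ?thesis by (simp add: K_def)
  qed
  have Lb: "cmod (L n m) \<le> K ^ n * B" for n m
  proof (induction n arbitrary: m)
    case (Suc n)
    then show ?case using lapb[of "L n" "K ^ n * B" m] by (simp add: L_def mult.assoc)
  qed (simp add: L_def B)
  define c where "c m n = \<i> ^ n * L n m / fact n" for m n
  have summ: "summable (\<lambda>n. c m n * y ^ n)" for m and y :: complex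
  proof (rule summable_comparison_test)
    show "\<exists>N. \<forall>n\<ge>N. norm (c m n * y ^ n) \<le> B * ((K * cmod y) ^ n / fact n)"
    proof (intro exI allI impI)
      fix n
      have "norm (c m n * y ^ n) = cmod (L n m) * (cmod y ^ n / fact n)"
        by (simp add: c_def norm_mult norm_divide norm_power)
      also have "\<dots> \<le> (K ^ n * B) * (cmod y ^ n / fact n)"
        by (intro mult_right_mono Lb) simp
      finally show "norm (c m n * y ^ n) \<le> B * ((K * cmod y) ^ n / fact n)"
        by (simp add: power_mult_distrib ac_simps)
    qed
    show "summable (\<lambda>n. B * ((K * cmod y) ^ n / fact n))"
      using summable_mult[OF summable_exp[of "K * cmod y"], of B]
      by (simp add: field_simps)
  qed
  define u where "u t m = (\<Sum>n. c m n * of_real t ^ n)" for t :: real and m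
  have cper: "c (m + axis j (2 * int M)) n = c m n" for m j n
    using Lf by (simp add: c_def lattice_fun_def)
  have "lattice_fun M (u t)" for t
    by (simp add: lattice_fun_def u_def cper)
  moreover have "u 0 = u0"
  proof
    fix m
    have "u 0 m = c m 0" by (simp add: u_def powser_zero)
    then show "u 0 m = u0 m" by (simp add: c_def L_def)
  qed
  moreover have "((\<lambda>s. u s m) has_vector_derivative \<i> * lattice_laplacian M (u t) m) (at t)" for t m
  proof -
    have "((\<lambda>s. u s m) has_vector_derivative (\<Sum>n. diffs (c m) n * of_real t ^ n)) (at t)"
      unfolding u_def
      by (rule has_vector_derivative_real_field)
        (rule termdiffs_strong_converges_everywhere[OF summ])
    moreover have "diffs (c m) n = \<i> * (\<Sum>j\<in>UNIV. (c (m + axis j 1) n + c (m - axis j 1) n - 2 * c m n)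
        / of_real ((mesh M)\<^sup>2))" for n
    proof -
      have "diffs (c m) n = \<i> * (\<i> ^ n / fact n) * L (Suc n) m"
        by (simp add: diffs_def c_def field_simps del: of_nat_Suc)
      also have "L (Suc n) m = lattice_laplacian M (L n) m" by (simp add: L_def)
      finally have "diffs (c m) n = \<i> * ((\<i> ^ n / fact n) * lattice_laplacian M (L n) m)"
        by (simp only: mult.assoc)
      also have "(\<i> ^ n / fact n) * lattice_laplacian M (L n) m = (\<Sum>j\<in>UNIV.
          (c (m + axis j 1) n + c (m - axis j 1) n - 2 * c m n) / of_real ((mesh M)\<^sup>2))"
        unfolding lattice_laplacian_def sum_distrib_left
        by (rule sum.cong)
          (simp_all add: c_def algebra_simps add_divide_distrib diff_divide_distrib)
      finally show ?thesis .
    qed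
    then have "(\<lambda>n. diffs (c m) n * of_real t ^ n) =
        (\<lambda>n. \<i> * (\<Sum>j\<in>UNIV. (c (m + axis j 1) n * of_real t ^ n + c (m - axis j 1) n * of_real t ^ n
          - 2 * (c m n * of_real t ^ n)) / of_real ((mesh M)\<^sup>2)))"
      by (simp add: fun_eq_iff sum_distrib_left sum_distrib_right algebra_simps)
    moreover have "\<dots> sums (\<i> * lattice_laplacian M (u t) m)"
      unfolding lattice_laplacian_def u_def
      by (intro sums_mult sums_sum sums_divide sums_diff sums_add summable_sums summ)
    ultimately show ?thesis by (metis sums_unique)
  qed
  moreover have "\<i> * (\<i> * z) + z = 0" for z :: complex
    by (simp add: mult.assoc[symmetric])
  ultimately have "lattice_schroedinger M u0 u"
    unfolding lattice_schroedinger_def by blast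
  then show ?thesis by blast
qed

lemma lattice_schroedinger_ex1:
  assumes "M > 0" "lattice_fun M u0"
  shows "\<exists>!u. lattice_schroedinger M u0 u"
  using lattice_schroedinger_exists[OF assms] lattice_schroedinger_unique[OF assms(1)] by blast

lemma lattice_propagator_solves:
  assumes "M > 0" "lattice_fun M u0"
  shows "lattice_schroedinger M u0 (\<lambda>t. lattice_propagator M t u0)"
  unfolding lattice_propagator_def using theI'[OF lattice_schroedinger_ex1[OF assms]] by simp

end

theory Submission
  imports Defs
begin

text \<open>
  On the Fourier side the propagator is \<open>\<Sum>\<^sub>k c\<^sub>k e\<^sup>i\<^sup>k\<^sup>x e\<^sup>-\<^sup>i\<^sup>t\<^sup>\<omega>\<^sup>(\<^sup>k\<^sup>)\<close> with
  \<open>\<omega> k = \<Sum>\<^sub>j (2 - 2 cos (h k\<^sub>j)) / h\<^sup>2\<close>. The second derivative of \<open>\<omega>\<close> in one variable is \<open>2 cos (h k)\<close>,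
  which vanishes at \<open>h k = \<pi> / 2\<close>; this degeneracy replaces the decay \<open>t\<^sup>-\<^sup>d\<^sup>/\<^sup>2\<close> of the continuous
  equation by \<open>t\<^sup>-\<^sup>d\<^sup>/\<^sup>3\<close>, hence the admissibility relation \<open>3 / q + d / r = d / 2\<close>.

  The proof follows Burq, Gerard and Tzvetkov. For frequencies of size at most \<open>N\<close> the wave
  packets have speed at most \<open>2 N\<close>, so that for \<open>\<bar>t\<bar> \<le> 1 / N\<close> they do not wrap around the torus and
  disperse as on the whole lattice: the kernel of the propagator is
  \<open>O(N\<^sup>d (1 + N\<^sup>2 \<bar>t\<bar>)\<^sup>-\<^sup>d\<^sup>/\<^sup>3)\<close>. For a box of frequencies the kernel is a product of one-dimensional
  exponential sums. Sharp frequency cutoffs are harmless because these sums are estimated over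
  arbitrary intervals of integers, by the Kusmin-Landau inequality and the second derivative
  test of van der Corput (\<open>dispersive_estimate_1d\<close>). Away from the two degenerate frequencies the
  second differences of the phase are at least of order \<open>\<bar>t\<bar> \<delta>\<close>, where \<open>\<delta>\<close> is a lower bound of
  \<open>\<bar>cos (h k)\<bar>\<close>; the \<open>O(\<delta> N)\<close> remaining frequencies are counted.

  Interpolation with the conservation of the \<open>L\<^sup>2\<close> norm (\<open>real_interpolation\<close>) and duality in
  space-time (\<open>TT_star\<close>) turn the kernel bound into a Strichartz estimate for one frequency shell
  on a time interval of length \<open>1 / N\<close>. At exactly admissible exponents the kernel is only in weak
  \<open>L\<^sup>q\<^sup>/\<^sup>2\<close> as a function of time; as it is truncated between \<open>N\<^sup>-\<^sup>2\<close> and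
  \<open>N\<^sup>-\<^sup>1\<close>, its strong norm exceeds the weak one by a power of \<open>ln N\<close> only, and Young's inequality (\<open>young_convolution\<close>) suffices at the
  endpoint as well. Adding up \<open>N\<close> time intervals gives the loss \<open>N\<^sup>2\<^sup>/\<^sup>q\<close>
  (\<open>shell_strichartz\<close>); the factor \<open>N\<^sup>-\<^sup>\<epsilon>\<close> coming from the data absorbs the logarithm and makes the
  sum over dyadic shells converge (\<open>strichartz_with_loss\<close>).

  The estimates hold for all pairs with \<open>3 / q + d / r \<ge> d / 2\<close> and \<open>2 < r < \<infinity>\<close>, with constants that
  stay bounded as \<open>r\<close> grows.
  The case \<open>r = \<infinity>\<close> is therefore obtained by fixing \<open>q\<close>, letting \<open>r\<close> tend to infinity and using
  that on a fixed lattice the maximum is at most \<open>h\<^sup>-\<^sup>d\<^sup>/\<^sup>r\<close> times the \<open>L\<^sup>r\<close> norm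
  (\<open>strichartz_sup_norm\<close>). The pair \<open>(\<infinity>, 2)\<close> is the conservation law (\<open>strichartz_energy\<close>).
\<close>

section \<open>Exponential sums: Kusmin-Landau and the second derivative test\<close>

definition forward_diff :: "(nat \<Rightarrow> real) \<Rightarrow> nat \<Rightarrow> real" where
  "forward_diff \<theta> k = \<theta> (Suc k) - \<theta> k"

lemma half_le_sin:
  assumes "0 \<le> x" "x \<le> pi / 2"
  shows "x / 2 \<le> sin x"
proof (cases "x \<le> pi / 3")
  case True
  have "(\<lambda>y. sin y - y / 2) 0 \<le> (\<lambda>y. sin y - y / 2) x"
  proof (rule DERIV_nonneg_imp_nondecreasing[OF assms(1)])
    fix y assume y: "0 \<le> y" "y \<le> x"
    have "cos (pi / 3) \<le> cos y"
      using y True by (intro cos_monotone_0_pi_le) auto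
    then have "0 \<le> cos y - 1 / 2" by (simp add: cos_60)
    then show "\<exists>D. ((\<lambda>y. sin y - y / 2) has_real_derivative D) (at y) \<and> 0 \<le> D"
      by (intro exI[of _ "cos y - 1 / 2"]) (auto intro!: derivative_eq_intros)
  qed
  then show ?thesis by simp
next
  case False
  have "sin (pi / 3) \<le> sin x"
    using False assms by (intro sin_monotone_2pi_le) auto
  moreover have "8 / 5 \<le> sqrt 3" by (rule real_le_rsqrt) (simp add: power2_eq_square)
  moreover have "x / 2 \<le> 4 / 5"
    using assms pi_less_4 pi_approx by simp
  ultimately show ?thesis by (simp add: sin_60)
qed

lemma half_abs_le_abs_sin:
  assumes "\<bar>x\<bar> \<le> pi / 2"
  shows "\<bar>x\<bar> / 2 \<le> \<bar>sin x\<bar>"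
  using half_le_sin[of "\<bar>x\<bar>"] assms by (cases "0 \<le> x") auto

lemma sin_ge_on_symmetric_interval:
  assumes "0 \<le> \<beta>" "\<beta> \<le> x" "x \<le> pi - \<beta>"
  shows "sin \<beta> \<le> sin x"
proof (cases "x \<le> pi / 2")
  case True
  then show ?thesis using assms by (intro sin_monotone_2pi_le) auto
next
  case False
  have "sin \<beta> \<le> sin (pi - x)" using False assms by (intro sin_monotone_2pi_le) auto
  then show ?thesis by simp
qed

text \<open>
  This is \<open>1 / (cis x - 1)\<close>, split into real and imaginary part. The real part is constant, so the
  total variation of the weights along a monotone sequence is that of the cotangent.
\<close>

definition KL_weight :: "real \<Rightarrow> complex" where
  "KL_weight x = Complex (- 1 / 2) (- cot (x / 2) / 2)"

lemma KL_weight_mult: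
  assumes "sin (x / 2) \<noteq> 0"
  shows "KL_weight x * (cis x - 1) = 1"
proof -
  define s c where "s = sin (x / 2)" and "c = cos (x / 2)"
  have sx: "sin x = 2 * s * c" "cos x = 1 - 2 * s\<^sup>2"
    using sin_double[of "x / 2"] cos_double_sin[of "x / 2"] by (auto simp: s_def c_def)
  have s0: "s \<noteq> 0" using assms by (simp add: s_def)
  have sc: "s\<^sup>2 + c\<^sup>2 = 1" by (simp add: s_def c_def)
  show ?thesis
    using s0 sc
    by (auto simp: complex_eq_iff KL_weight_def cot_def sx s_def[symmetric] c_def[symmetric]
        field_simps power2_eq_square)
qed

lemma norm_KL_weight:
  assumes "0 < \<alpha>" "\<alpha> \<le> x" "x \<le> 2 * pi - \<alpha>"
  shows "cmod (KL_weight x) \<le> 2 / \<alpha>"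
proof -
  have s: "\<alpha> / 4 \<le> sin (x / 2)"
    using half_le_sin[of "\<alpha> / 2"] sin_ge_on_symmetric_interval[of "\<alpha> / 2" "x / 2"] assms by simp
  have "(cmod (cis x - 1))\<^sup>2 = (2 * sin (x / 2))\<^sup>2"
  proof -
    have "(cmod (cis x - 1))\<^sup>2 = 2 - 2 * cos x"
      unfolding cmod_power2 using sin_cos_squared_add3[of x]
      by (simp add: power2_eq_square algebra_simps)
    then show ?thesis using cos_double_sin[of "x / 2"] by (simp add: power2_eq_square)
  qed
  then have n: "cmod (cis x - 1) = 2 * sin (x / 2)"
    by (rule power2_eq_imp_eq) (use s assms in auto)
  have "cmod (KL_weight x) * (2 * sin (x / 2)) = 1"
    using arg_cong[OF KL_weight_mult[of x], of cmod] s assms n by (simp add: norm_mult)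
  then have "cmod (KL_weight x) = 1 / (2 * sin (x / 2))"
    using s assms by (auto simp: field_simps)
  also have "\<dots> \<le> 1 / (2 * (\<alpha> / 4))"
    using s assms by (intro divide_left_mono) auto
  finally show ?thesis by simp
qed

lemma cot_half_antimono:
  assumes "0 < x" "x \<le> y" "y < 2 * pi"
  shows "cot (y / 2) \<le> cot (x / 2)"
proof -
  have "cot u - cot v = sin (v - u) / (sin u * sin v)" if "sin u > 0" "sin v > 0" for u v :: real
    using that by (simp add: cot_def sin_diff field_simps)
  then have "cot (x / 2) - cot (y / 2) = sin (y / 2 - x / 2) / (sin (x / 2) * sin (y / 2))"
    using assms sin_gt_zero[of "x / 2"] sin_gt_zero[of "y / 2"] by simp
  moreover have "\<dots> \<ge> 0"
    using assms sin_gt_zero[of "x / 2"] sin_gt_zero[of "y / 2"] sin_ge_zero[of "y / 2 - x / 2"]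
    by simp
  ultimately show ?thesis by simp
qed

lemma abs_cot_half_le:
  assumes "0 < \<alpha>" "\<alpha> \<le> x" "x \<le> 2 * pi - \<alpha>"
  shows "\<bar>cot (x / 2)\<bar> \<le> 4 / \<alpha>"
proof -
  have "\<bar>Im (KL_weight x)\<bar> \<le> 2 / \<alpha>"
    using norm_KL_weight[OF assms] abs_Im_le_cmod order_trans by blast
  then show ?thesis by (simp add: KL_weight_def)
qed

text \<open>
  Each term is a difference, \<open>cis (\<theta> k) = c\<^sub>k (cis (\<theta> (k + 1)) - cis (\<theta> k))\<close> with
  \<open>c\<^sub>k = KL_weight (\<theta> (k + 1) - \<theta> k)\<close>. Summation by parts leaves two boundary terms and
  \<open>\<Sum> \<bar>c\<^sub>k\<^sub>+\<^sub>1 - c\<^sub>k\<bar>\<close>; since the differences of \<open>\<theta>\<close> are monotone, the last sum telescopes to a difference of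
  two cotangents.
\<close>

lemma Kusmin_Landau:
  fixes \<theta> :: "nat \<Rightarrow> real"
  assumes \<alpha>: "0 < \<alpha>"
    and gap: "\<And>k. k \<in> {a..<b} \<Longrightarrow> forward_diff \<theta> k \<in> {\<alpha>..2 * pi - \<alpha>}"
    and mono: "\<And>k. k \<in> {a..<b} \<Longrightarrow> Suc k < b \<Longrightarrow> forward_diff \<theta> k \<le> forward_diff \<theta> (Suc k)"
  shows "cmod (\<Sum>k=a..<b. cis (\<theta> k)) \<le> 8 / \<alpha>"
proof (cases "a < b")
  case True
  define c where "c k = KL_weight (forward_diff \<theta> k)" for k
  have cb: "cmod (c k) \<le> 2 / \<alpha>" if "k \<in> {a..<b}" for k
    unfolding c_def using gap[OF that] by (intro norm_KL_weight \<alpha>) auto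
  have step: "c k * cis (\<theta> (Suc k)) = cis (\<theta> k) + c k * cis (\<theta> k)" if "k \<in> {a..<b}" for k
  proof -
    have "sin (forward_diff \<theta> k / 2) > 0" using gap[OF that] \<alpha> by (intro sin_gt_zero) auto
    then have 1: "c k * (cis (forward_diff \<theta> k) - 1) = 1" by (simp add: c_def KL_weight_mult)
    have "cis (\<theta> (Suc k)) = cis (\<theta> k) * cis (forward_diff \<theta> k)"
      by (simp add: cis_mult forward_diff_def)
    then have "c k * cis (\<theta> (Suc k)) - c k * cis (\<theta> k) =
        c k * (cis (forward_diff \<theta> k) - 1) * cis (\<theta> k)"
      by (simp add: algebra_simps)
    then show ?thesis unfolding 1 by (simp add: algebra_simps)
  qed
  \<comment> \<open>the remainder after removal of the boundary terms of the summation by parts\<close>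
  let ?R = "\<lambda>n. (\<Sum>k=a..<a + Suc n. cis (\<theta> k)) - c (a + n) * cis (\<theta> (a + Suc n))
      + c a * cis (\<theta> a)"
  have "cmod (?R n) \<le> (cot (forward_diff \<theta> a / 2) - cot (forward_diff \<theta> (a + n) / 2)) / 2"
    if "a + Suc n \<le> b" for n
    using that
  proof (induction n)
    case 0
    show ?case using step[of a] 0 by simp
  next
    case (Suc n)
    let ?d = "forward_diff \<theta>"
    have d: "?d (a + n) \<in> {\<alpha>..2 * pi - \<alpha>}" "?d (a + Suc n) \<in> {\<alpha>..2 * pi - \<alpha>}"
      "?d (a + n) \<le> ?d (a + Suc n)"
      using gap[of "a + n"] gap[of "a + Suc n"] mono[of "a + n"] Suc.prems by auto
    have "?R (Suc n) = ?R n - (c (a + Suc n) - c (a + n)) * cis (\<theta> (a + Suc n))"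
      using step[of "a + Suc n"] Suc.prems by (simp add: algebra_simps)
    then have "cmod (?R (Suc n)) \<le> cmod (?R n) + cmod (c (a + Suc n) - c (a + n))"
      by (metis norm_triangle_ineq4 norm_mult norm_cis mult_1_right)
    also have "cmod (c (a + Suc n) - c (a + n)) = (cot (?d (a + n) / 2) - cot (?d (a + Suc n) / 2)) / 2"
    proof -
      have "c (a + Suc n) - c (a + n) = Complex 0 ((cot (?d (a + n) / 2) - cot (?d (a + Suc n) / 2)) / 2)"
        by (simp add: c_def KL_weight_def complex_eq_iff field_simps)
      moreover have "cot (?d (a + Suc n) / 2) \<le> cot (?d (a + n) / 2)"
        using d \<alpha> by (intro cot_half_antimono) auto
      ultimately show ?thesis by (simp add: cmod_def)
    qed
    finally show ?case using Suc by (simp add: field_simps)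
  qed
  from this[of "b - a - 1"] True
  have R: "cmod ((\<Sum>k=a..<b. cis (\<theta> k)) - c (b - 1) * cis (\<theta> b) + c a * cis (\<theta> a))
      \<le> (cot (forward_diff \<theta> a / 2) - cot (forward_diff \<theta> (b - 1) / 2)) / 2"
    by simp
  also have "\<dots> \<le> (4 / \<alpha> + 4 / \<alpha>) / 2"
    using abs_cot_half_le[OF \<alpha>, of "forward_diff \<theta> a"] gap[of a]
      abs_cot_half_le[OF \<alpha>, of "forward_diff \<theta> (b - 1)"] gap[of "b - 1"] True by auto
  finally have "cmod ((\<Sum>k=a..<b. cis (\<theta> k)) - c (b - 1) * cis (\<theta> b) + c a * cis (\<theta> a)) \<le> 4 / \<alpha>"
    by simp
  moreover have "cmod (c (b - 1) * cis (\<theta> b)) \<le> 2 / \<alpha>" "cmod (c a * cis (\<theta> a)) \<le> 2 / \<alpha>"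
    using cb[of a] cb[of "b - 1"] True by (auto simp: norm_mult)
  moreover have "cmod z \<le> cmod (z - x + y) + cmod x + cmod y" for x y z :: complex
    using norm_triangle_ineq[of "z - x + y" "x - y"] norm_triangle_ineq4[of x y]
    by (simp add: algebra_simps)
  ultimately have "cmod (\<Sum>k=a..<b. cis (\<theta> k)) \<le> 4 / \<alpha> + 2 / \<alpha> + 2 / \<alpha>"
    by (meson add_mono order_trans)
  then show ?thesis by simp
qed (use \<alpha> in simp)

lemma convex_nat_set_interval:
  fixes T :: "nat set"
  assumes "finite T" "\<And>i j k. i \<in> T \<Longrightarrow> k \<in> T \<Longrightarrow> i \<le> j \<Longrightarrow> j \<le> k \<Longrightarrow> j \<in> T"
  obtains a b where "T = {a..<b}"
proof (cases "T = {}")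
  case True
  then have "T = {0..<0}" by simp
  then show ?thesis using that by blast
next
  case False
  have "T = {Min T..<Suc (Max T)}"
  proof
    show "T \<subseteq> {Min T..<Suc (Max T)}" using assms(1) by (auto simp: less_Suc_eq_le)
    have "Min T \<in> T" "Max T \<in> T" using assms(1) False by auto
    then show "{Min T..<Suc (Max T)} \<subseteq> T"
      using assms(2)[of "Min T" "Max T"] by (auto simp: less_Suc_eq_le)
  qed
  then show ?thesis using that by blast
qed

lemma card_separated_le:
  fixes f :: "nat \<Rightarrow> real"
  assumes fin: "finite T" and \<mu>: "0 < \<mu>" and W: "0 \<le> W"
    and sep: "\<And>i j. i \<in> T \<Longrightarrow> j \<in> T \<Longrightarrow> i \<le> j \<Longrightarrow> \<mu> * real (j - i) \<le> f j - f i"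
    and rng: "\<And>i. i \<in> T \<Longrightarrow> f i \<in> {y..y + W}"
  shows "real (card T) \<le> W / \<mu> + 1"
proof (cases "T = {}")
  case False
  have "T \<subseteq> {Min T..Max T}" using fin False by auto
  from card_mono[OF _ this] have "card T \<le> Suc (Max T) - Min T" by simp
  moreover have "Min T \<le> Max T" using fin False by simp
  ultimately have c: "real (card T) \<le> real (Max T - Min T) + 1" by linarith
  have "\<mu> * real (Max T - Min T) \<le> W"
    using sep[of "Min T" "Max T"] rng[of "Min T"] rng[of "Max T"] fin False by auto
  then have "real (Max T - Min T) \<le> W / \<mu>" using \<mu> by (simp add: field_simps)
  with c show ?thesis by linarith
qed (use \<mu> W in simp)

lemma second_difference_iterate:
  assumes "\<And>k. a \<le> k \<Longrightarrow> Suc k < b \<Longrightarrow> \<mu> \<le> forward_diff \<theta> (Suc k) - forward_diff \<theta> k"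
    and "a \<le> i" "i \<le> j" "j < b"
  shows "\<mu> * real (j - i) \<le> forward_diff \<theta> j - forward_diff \<theta> i"
  using assms(3,4)
proof (induction j rule: dec_induct)
  case (step n)
  then show ?case using assms(1)[of n] assms(2) by (simp add: Suc_diff_le algebra_simps)
qed simp

lemma norm_cis_sum_le_card: "cmod (\<Sum>k\<in>T. cis (f k)) \<le> real (card T)"
  using norm_sum[of "\<lambda>k. cis (f k)" T] by simp

text \<open>
  The frequencies whose phase increment is within \<open>\<alpha> = sqrt \<mu>\<close> of a multiple of \<open>2 \<pi>\<close> are counted,
  using that the increments are \<open>\<mu>\<close>-separated; the others form an interval to which the
  Kusmin-Landau inequality applies. The choice of \<open>\<alpha>\<close> balances \<open>\<alpha> / \<mu>\<close> against \<open>1 / \<alpha>\<close>.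
\<close>

lemma exp_sum_one_period:
  fixes \<theta> :: "nat \<Rightarrow> real" and n :: int
  assumes \<mu>: "0 < \<mu>" "\<mu> \<le> 4"
    and conv: "\<And>k. a \<le> k \<Longrightarrow> Suc k < b \<Longrightarrow> \<mu> \<le> forward_diff \<theta> (Suc k) - forward_diff \<theta> k"
    and rng: "\<And>k. k \<in> {a..<b} \<Longrightarrow> forward_diff \<theta> k \<in> {2 * pi * n..2 * pi * (n + 1)}"
  shows "cmod (\<Sum>k=a..<b. cis (\<theta> k)) \<le> 10 / sqrt \<mu> + 2"
proof -
  define \<phi> where "\<phi> k = \<theta> k - 2 * pi * n * real k" for k
  define \<alpha> where "\<alpha> = sqrt \<mu>"
  have \<alpha>: "0 < \<alpha>" "\<alpha> \<le> 2" "\<alpha> * \<alpha> = \<mu>"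
    using \<mu> real_sqrt_le_mono[of \<mu> 4] by (auto simp: \<alpha>_def)
  have d\<phi>: "forward_diff \<phi> k = forward_diff \<theta> k - 2 * pi * n" for k
    by (simp add: forward_diff_def \<phi>_def algebra_simps)
  have cis: "cis (\<theta> k) = cis (\<phi> k)" for k
  proof -
    have "cis (\<theta> k) = cis (\<phi> k) * cis (2 * pi * of_int (n * int k))"
      by (simp add: cis_mult \<phi>_def algebra_simps)
    also have "cis (2 * pi * of_int (n * int k)) = 1" by (rule cis_multiple_2pi) simp
    finally show ?thesis by simp
  qed
  have sep: "\<mu> * real (j - i) \<le> forward_diff \<phi> j - forward_diff \<phi> i"
    if "i \<in> {a..<b}" "j \<in> {a..<b}" "i \<le> j" for i j
    using second_difference_iterate[of a b \<mu> \<theta> i j] conv that by (auto simp: d\<phi>)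
  have mono: "forward_diff \<phi> i \<le> forward_diff \<phi> j"
    if "i \<in> {a..<b}" "j \<in> {a..<b}" "i \<le> j" for i j
    using sep[OF that] \<mu> by (smt (verit) mult_nonneg_nonneg of_nat_0_le_iff)
  have r\<phi>: "forward_diff \<phi> k \<in> {0..2 * pi}" if "k \<in> {a..<b}" for k
    using rng[OF that] by (auto simp: d\<phi> algebra_simps)
  define L where "L = {k \<in> {a..<b}. forward_diff \<phi> k < \<alpha>}"
  define G where "G = {k \<in> {a..<b}. forward_diff \<phi> k \<in> {\<alpha>..2 * pi - \<alpha>}}"
  define H where "H = {k \<in> {a..<b}. forward_diff \<phi> k > 2 * pi - \<alpha>}"
  have un: "{a..<b} = L \<union> G \<union> H" and dj: "L \<inter> G = {}" "(L \<union> G) \<inter> H = {}"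
    using \<alpha> pi_gt3 by (auto simp: L_def G_def H_def)
  have fin: "finite L" "finite G" "finite H" by (auto simp: L_def G_def H_def)
  have "real (card L) \<le> \<alpha> / \<mu> + 1"
    by (rule card_separated_le[where f = "forward_diff \<phi>" and y = 0])
      (use \<mu> \<alpha> sep r\<phi> in \<open>auto simp: L_def\<close>)
  moreover have "real (card H) \<le> \<alpha> / \<mu> + 1"
    by (rule card_separated_le[where f = "forward_diff \<phi>" and y = "2 * pi - \<alpha>"])
      (use \<mu> \<alpha> sep r\<phi> in \<open>auto simp: H_def\<close>)
  moreover have "cmod (\<Sum>k\<in>G. cis (\<phi> k)) \<le> 8 / \<alpha>"
  proof -
    have cv: "j \<in> G" if "i \<in> G" "k \<in> G" "i \<le> j" "j \<le> k" for i j k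
      using mono[of i j] mono[of j k] that by (auto simp: G_def)
    obtain c d where G: "G = {c..<d}" by (rule convex_nat_set_interval[OF fin(2) cv])
    have "G \<subseteq> {a..<b}" by (auto simp: G_def)
    then have sub: "{c..<d} \<subseteq> {a..<b}" by (simp only: G)
    show ?thesis
      unfolding G
    proof (rule Kusmin_Landau[OF \<alpha>(1)])
      fix k assume k: "k \<in> {c..<d}"
      then have "k \<in> G" by (simp only: G)
      then show "forward_diff \<phi> k \<in> {\<alpha>..2 * pi - \<alpha>}" by (simp add: G_def)
      assume "Suc k < d"
      then have "k \<in> {a..<b}" "Suc k \<in> {a..<b}" using sub k by auto
      then show "forward_diff \<phi> k \<le> forward_diff \<phi> (Suc k)" by (intro mono) auto
    qed
  qed
  moreover have "(\<Sum>k=a..<b. cis (\<theta> k)) = (\<Sum>k\<in>L. cis (\<phi> k)) + (\<Sum>k\<in>G. cis (\<phi> k)) + (\<Sum>k\<in>H. cis (\<phi> k))"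
    unfolding un cis using fin dj by (simp add: sum.union_disjoint)
  then have "cmod (\<Sum>k=a..<b. cis (\<theta> k)) \<le>
      cmod (\<Sum>k\<in>L. cis (\<phi> k)) + cmod (\<Sum>k\<in>G. cis (\<phi> k)) + cmod (\<Sum>k\<in>H. cis (\<phi> k))"
    by (simp add: norm_triangle_mono norm_triangle_ineq)
  ultimately have "cmod (\<Sum>k=a..<b. cis (\<theta> k)) \<le> (\<alpha> / \<mu> + 1) + 8 / \<alpha> + (\<alpha> / \<mu> + 1)"
    using norm_cis_sum_le_card[of \<phi> L] norm_cis_sum_le_card[of \<phi> H] by linarith
  also have "\<alpha> / \<mu> = 1 / \<alpha>" using \<alpha>(1) by (simp add: \<alpha>(3)[symmetric])
  finally show ?thesis by (simp add: \<alpha>_def)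
qed

text \<open>
  As the phase increments vary by less than one period, they cross at most one multiple of
  \<open>2 \<pi>\<close> between the first and the last frequency, and the sum is cut there.
\<close>

lemma second_derivative_test_increasing:
  fixes \<theta> :: "nat \<Rightarrow> real"
  assumes \<mu>: "0 < \<mu>" "\<mu> \<le> 4"
    and conv: "\<And>k. a \<le> k \<Longrightarrow> Suc k < b \<Longrightarrow> \<mu> \<le> forward_diff \<theta> (Suc k) - forward_diff \<theta> k"
    and rng: "\<And>i j. i \<in> {a..<b} \<Longrightarrow> j \<in> {a..<b} \<Longrightarrow> \<bar>forward_diff \<theta> i - forward_diff \<theta> j\<bar> \<le> 2"
  shows "cmod (\<Sum>k=a..<b. cis (\<theta> k)) \<le> 28 / sqrt \<mu>"
proof (cases "a < b")
  case True
  let ?d = "forward_diff \<theta>"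
  define n where "n = \<lfloor>?d a / (2 * pi)\<rfloor>"
  \<comment> \<open>the first multiple of \<open>2 \<pi>\<close> above the initial increment\<close>
  define y where "y = 2 * pi * real_of_int (n + 1)"
  have mono: "?d i \<le> ?d j" if "a \<le> i" "i \<le> j" "j < b" for i j
    using second_difference_iterate[of a b \<mu> \<theta> i j] conv that \<mu>
    by (smt (verit) mult_nonneg_nonneg of_nat_0_le_iff)
  have n: "2 * pi * n \<le> ?d a" "?d a < y"
  proof -
    have "n \<le> ?d a / (2 * pi)" "?d a / (2 * pi) < real_of_int n + 1" by (auto simp: n_def)
    then show "2 * pi * n \<le> ?d a" "?d a < y" by (simp_all add: y_def field_simps)
  qed
  define T where "T = {k \<in> {a..<b}. ?d k < y}"
  have cv: "j \<in> T" if "i \<in> T" "k \<in> T" "i \<le> j" "j \<le> k" for i j k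
    using mono[of i j] mono[of j k] that by (auto simp: T_def)
  have "finite T" by (simp add: T_def)
  then obtain c d where "T = {c..<d}" by (rule convex_nat_set_interval[OF _ cv])
  moreover have "a \<in> T" using True n by (simp add: T_def)
  moreover have "T \<subseteq> {a..<b}" by (auto simp: T_def)
  ultimately have T: "T = {a..<d}" "a < d" "d \<le> b" by auto
  have "cmod (\<Sum>k=a..<d. cis (\<theta> k)) \<le> 10 / sqrt \<mu> + 2"
  proof (rule exp_sum_one_period[OF \<mu>])
    fix k assume "k \<in> {a..<d}"
    then have "k \<in> T" by (simp add: T)
    then show "?d k \<in> {2 * pi * n..2 * pi * (n + 1)}"
      using mono[of a k] n by (auto simp: T_def y_def)
  qed (use conv T in auto)
  moreover have "cmod (\<Sum>k=d..<b. cis (\<theta> k)) \<le> 10 / sqrt \<mu> + 2"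
  proof (rule exp_sum_one_period[OF \<mu>])
    fix k assume k: "k \<in> {d..<b}"
    then have "k \<notin> T" by (simp add: T)
    then have "y \<le> ?d k" using k T by (auto simp: T_def)
    moreover have "?d k \<le> ?d a + 2" using rng[of a k] k T by auto
    moreover have "2 \<le> 2 * pi" using pi_gt3 by simp
    ultimately show "?d k \<in> {2 * pi * (n + 1)..2 * pi * ((n + 1) + 1)}"
      using n by (auto simp: y_def algebra_simps)
  qed (use conv T in auto)
  moreover have "(\<Sum>k=a..<b. cis (\<theta> k)) = (\<Sum>k=a..<d. cis (\<theta> k)) + (\<Sum>k=d..<b. cis (\<theta> k))"
    using T by (simp add: sum.atLeastLessThan_concat)
  ultimately have "cmod (\<Sum>k=a..<b. cis (\<theta> k)) \<le> (10 / sqrt \<mu> + 2) + (10 / sqrt \<mu> + 2)"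
    by (metis norm_triangle_mono)
  moreover have "1 \<le> 2 / sqrt \<mu>"
    using \<mu> real_sqrt_le_mono[of \<mu> 4] by (simp add: field_simps)
  ultimately show ?thesis by (simp add: field_simps)
qed (use \<mu> in simp)

text \<open>
  The sign \<open>s\<close> allows both convex and concave phases; they are exchanged by complex conjugation.
\<close>

lemma second_derivative_test:
  fixes \<theta> :: "nat \<Rightarrow> real" and s :: real
  assumes \<mu>: "0 < \<mu>" "\<mu> \<le> 4" and s: "\<bar>s\<bar> = 1"
    and conv: "\<And>k. a \<le> k \<Longrightarrow> Suc k < b \<Longrightarrow> \<mu> \<le> s * (forward_diff \<theta> (Suc k) - forward_diff \<theta> k)"
    and rng: "\<And>i j. i \<in> {a..<b} \<Longrightarrow> j \<in> {a..<b} \<Longrightarrow> \<bar>forward_diff \<theta> i - forward_diff \<theta> j\<bar> \<le> 2"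
  shows "cmod (\<Sum>k=a..<b. cis (\<theta> k)) \<le> 28 / sqrt \<mu>"
proof (cases "s = 1")
  case True
  then show ?thesis using second_derivative_test_increasing[OF \<mu>, of a b \<theta>] conv rng by simp
next
  case False
  then have s: "s = - 1" using s by linarith
  have d: "forward_diff (\<lambda>k. - \<theta> k) k = - forward_diff \<theta> k" for k by (simp add: forward_diff_def)
  have "cmod (\<Sum>k=a..<b. cis (- \<theta> k)) \<le> 28 / sqrt \<mu>"
    using conv rng s by (intro second_derivative_test_increasing[OF \<mu>]) (auto simp: d)
  moreover have "(\<Sum>k=a..<b. cis (- \<theta> k)) = cnj (\<Sum>k=a..<b. cis (\<theta> k))"
    by (simp add: cis_cnj)
  ultimately show ?thesis by (metis complex_mod_cnj)
qed

section \<open>The one-dimensional dispersive estimate\<close>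

text \<open>
  The phase of a one-dimensional plane wave with real frequency \<open>k\<close> at position \<open>x\<close> and time \<open>\<tau>\<close>.
\<close>

definition lattice_phase :: "real \<Rightarrow> real \<Rightarrow> real \<Rightarrow> real \<Rightarrow> real" where
  "lattice_phase h \<tau> x k = k * x - \<tau> * ((2 - 2 * cos (h * k)) / h\<^sup>2)"

lemma forward_diff_lattice_phase:
  assumes "h > 0"
  shows "forward_diff (\<lambda>k. lattice_phase h \<tau> x (real k)) k =
      x - \<tau> * (4 / h\<^sup>2) * sin (h / 2) * sin (h * (real k + 1 / 2))"
proof -
  have "cos (h * real k) - cos (h * (real k + 1)) = 2 * sin (h * (real k + 1 / 2)) * sin (h / 2)"
    unfolding cos_diff_cos by (simp add: algebra_simps add_divide_distrib)
  moreover have "forward_diff (\<lambda>k. lattice_phase h \<tau> x (real k)) k =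
      x - \<tau> * (2 * (cos (h * real k) - cos (h * (real k + 1))) / h\<^sup>2)"
    by (simp add: forward_diff_def lattice_phase_def algebra_simps diff_divide_distrib
        add_divide_distrib)
  ultimately show ?thesis by simp
qed

lemma second_diff_lattice_phase:
  assumes "h > 0"
  shows "forward_diff (\<lambda>k. lattice_phase h \<tau> x (real k)) (Suc k) -
      forward_diff (\<lambda>k. lattice_phase h \<tau> x (real k)) k =
      - (\<tau> * (8 * (sin (h / 2))\<^sup>2 / h\<^sup>2) * cos (h * real (Suc k)))"
proof -
  have "sin (h * (real (Suc k) + 1 / 2)) - sin (h * (real k + 1 / 2)) =
      2 * sin (h / 2) * cos (h * real (Suc k))"
    unfolding sin_diff_sin by (simp add: algebra_simps add_divide_distrib)
  then have "sin (h * (real (Suc k) + 1 / 2)) =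
      sin (h * (real k + 1 / 2)) + 2 * sin (h / 2) * cos (h * real (Suc k))"
    by simp
  then show ?thesis
    unfolding forward_diff_lattice_phase[OF assms]
    by (simp add: power2_eq_square algebra_simps)
qed

lemma abs_sin_diff_le: "\<bar>sin a - sin b\<bar> \<le> \<bar>a - b\<bar>" for a b :: real
proof -
  have "\<bar>sin a - sin b\<bar> = 2 * \<bar>sin ((a - b) / 2)\<bar> * \<bar>cos ((a + b) / 2)\<bar>"
    unfolding sin_diff_sin by (simp add: abs_mult)
  also have "\<dots> \<le> 2 * \<bar>(a - b) / 2\<bar> * 1"
    by (intro mult_mono abs_sin_x_le_abs_x abs_cos_le_one) auto
  finally show ?thesis by simp
qed

text \<open>
  The group velocity of the frequencies up to \<open>N\<close> is at most \<open>2 N\<close>. In the time \<open>1 / N\<close> the stationary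
  points therefore stay within one period, which is what the second derivative test asks for.
\<close>

lemma lattice_phase_first_diff_range:
  assumes h: "h > 0" and \<tau>: "0 \<le> \<tau>" "\<tau> * N \<le> 1" and ij: "real i \<le> N" "real j \<le> N"
  shows "\<bar>forward_diff (\<lambda>k. lattice_phase h \<tau> x (real k)) i -
      forward_diff (\<lambda>k. lattice_phase h \<tau> x (real k)) j\<bar> \<le> 2"
proof -
  have "\<bar>forward_diff (\<lambda>k. lattice_phase h \<tau> x (real k)) i -
      forward_diff (\<lambda>k. lattice_phase h \<tau> x (real k)) j\<bar> =
      \<bar>\<tau> * (4 / h\<^sup>2) * sin (h / 2) * (sin (h * (real j + 1 / 2)) - sin (h * (real i + 1 / 2)))\<bar>"
    unfolding forward_diff_lattice_phase[OF h] by (simp add: algebra_simps)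
  also have "\<dots> = \<tau> * (4 / h\<^sup>2) * \<bar>sin (h / 2)\<bar> * \<bar>sin (h * (real j + 1 / 2)) - sin (h * (real i + 1 / 2))\<bar>"
    using h \<tau> by (simp add: abs_mult)
  also have "\<dots> \<le> \<tau> * (4 / h\<^sup>2) * \<bar>h / 2\<bar> * \<bar>h * (real j + 1 / 2) - h * (real i + 1 / 2)\<bar>"
    using \<tau> by (intro mult_mono abs_sin_x_le_abs_x abs_sin_diff_le) auto
  also have "\<bar>h * (real j + 1 / 2) - h * (real i + 1 / 2)\<bar> = h * \<bar>real j - real i\<bar>"
    using h by (simp add: abs_mult flip: right_diff_distrib)
  also have "\<tau> * (4 / h\<^sup>2) * \<bar>h / 2\<bar> * (h * \<bar>real j - real i\<bar>) = 2 * (\<tau> * \<bar>real j - real i\<bar>)"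
    using h by (simp add: power2_eq_square)
  also have "\<dots> \<le> 2 * (\<tau> * N)"
    using \<tau> ij by (intro mult_left_mono) auto
  finally show ?thesis using \<tau> by simp
qed

text \<open>
  On \<open>0 \<le> h k \<le> \<pi>\<close> the cosine decreases, so the frequencies with \<open>cos (h k) \<ge> \<delta>\<close>, with
  \<open>\<bar>cos (h k)\<bar> < \<delta>\<close> and with \<open>cos (h k) \<le> - \<delta>\<close> form three intervals. The outer two contribute
  \<open>O((\<tau> \<delta>)\<^sup>-\<^sup>1\<^sup>/\<^sup>2)\<close> by the second derivative test. The middle one has \<open>O(\<delta> / h + 1)\<close> elements, and if it
  is not empty then \<open>1 / h = O(N)\<close>. Both bounds are \<open>O(N \<delta>)\<close> for \<open>\<delta> = (N\<^sup>2 \<tau>)\<^sup>-\<^sup>1\<^sup>/\<^sup>3\<close>. For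
  \<open>N\<^sup>2 \<tau> < 8\<close> the number of terms is a sufficient bound.
\<close>

lemma dispersive_estimate_half_line:
  fixes a b :: nat and h \<tau> N x :: real
  assumes h: "0 < h" "h \<le> pi" and N: "1 \<le> N" and \<tau>: "0 \<le> \<tau>" "\<tau> * N \<le> 1"
    and freq: "\<And>k. k \<in> {a..<b} \<Longrightarrow> h * real k \<le> pi \<and> real k \<le> N"
  shows "cmod (\<Sum>k=a..<b. cis (lattice_phase h \<tau> x (real k))) \<le>
    180 * N * (1 + N\<^sup>2 * \<tau>) powr (- 1 / 3)"
proof (cases "N\<^sup>2 * \<tau> < 8")
  case True
  have "3 powr (- 1) \<le> (1 + N\<^sup>2 * \<tau>) powr (- 1 / 3)"
  proof -
    have "(3::real) powr (- 1) = (3 powr 3) powr (- 1 / 3)"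
      unfolding powr_powr by simp
    also have "\<dots> \<le> (1 + N\<^sup>2 * \<tau>) powr (- 1 / 3)"
      using True \<tau> by (intro powr_mono2') (auto simp: powr_numeral add_pos_nonneg)
    finally show ?thesis .
  qed
  then have p: "1 / 3 \<le> (1 + N\<^sup>2 * \<tau>) powr (- 1 / 3)" by (simp add: powr_minus_divide)
  have "real (card {a..<b}) \<le> N + 1"
  proof (cases "a < b")
    case True
    then have "b - 1 \<in> {a..<b}" by auto
    from freq[OF this] True show ?thesis by (auto simp: of_nat_diff)
  qed (use N in simp)
  then have "cmod (\<Sum>k=a..<b. cis (lattice_phase h \<tau> x (real k))) \<le> 2 * N"
    using norm_cis_sum_le_card[of "\<lambda>k. lattice_phase h \<tau> x (real k)" "{a..<b}"] N by linarith
  also have "\<dots> \<le> 180 * N * (1 / 3)" using N by simp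
  also have "\<dots> \<le> 180 * N * (1 + N\<^sup>2 * \<tau>) powr (- 1 / 3)"
    using N p by (intro mult_left_mono) auto
  finally show ?thesis .
next
  case False
  let ?y = "N\<^sup>2 * \<tau>" and ?\<theta> = "\<lambda>k. lattice_phase h \<tau> x (real k)"
  have y: "8 \<le> ?y" using False by simp
  have \<tau>0: "\<tau> > 0" using y \<tau> by (cases "\<tau> = 0") auto
  define \<delta> where "\<delta> = ?y powr (- 1 / 3)"
  have \<delta>0: "\<delta> > 0" using \<tau>0 N by (simp add: \<delta>_def)
  have \<delta>3: "\<delta> ^ 3 * ?y = 1"
  proof -
    have "\<delta> ^ 3 = \<delta> powr 3" using \<delta>0 by (simp add: powr_numeral)
    also have "\<dots> = ?y powr (- 1)" unfolding \<delta>_def powr_powr by simp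
    finally have "\<delta> ^ 3 = ?y powr (- 1)" .
    then show ?thesis using y \<tau>0 N by (simp add: powr_minus_divide)
  qed
  have \<delta>h: "\<delta> \<le> 1 / 2"
  proof (rule ccontr)
    assume "\<not> ?thesis"
    then have "(1 / 2) ^ 3 < \<delta> ^ 3" by (intro power_strict_mono) auto
    then have "(1 / 2) ^ 3 * ?y < \<delta> ^ 3 * ?y" using y by (intro mult_strict_right_mono) auto
    then show False using \<delta>3 y by (simp add: power3_eq_cube)
  qed
  have \<tau>1: "\<tau> \<le> 1" using \<tau> N mult_left_mono[of 1 N \<tau>] by simp
  have N\<delta>: "1 \<le> N * \<delta>"
  proof -
    have "(N * \<delta>) ^ 3 * \<tau> = N" using \<delta>3 by (simp add: power3_eq_cube power2_eq_square algebra_simps)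
    then have "\<tau> * 1 \<le> \<tau> * (N * \<delta>) ^ 3" using \<tau>1 N by (simp add: mult.commute)
    then have "1 ^ 3 \<le> (N * \<delta>) ^ 3" using \<tau>0 by simp
    then have "1 ^ Suc 2 \<le> (N * \<delta>) ^ Suc 2" by (simp only: numeral_3_eq_3 numeral_2_eq_2)
    then show ?thesis by (rule power_le_imp_le_base) (use N \<delta>0 in auto)
  qed
  \<comment> \<open>here \<open>(\<tau> \<delta>) (N \<delta>)\<^sup>2 = N\<^sup>2 \<tau> \<delta>\<^sup>3 = 1\<close>\<close>
  have root: "28 / sqrt (\<tau> * \<delta> / 2) \<le> 40 * (N * \<delta>)"
  proof -
    have "(\<tau> * \<delta>) * (N * \<delta>)\<^sup>2 = 1"
      using \<delta>3 by (simp add: power3_eq_cube power2_eq_square algebra_simps)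
    then have "(28 / sqrt (\<tau> * \<delta> / 2))\<^sup>2 = 28\<^sup>2 * 2 * (N * \<delta>)\<^sup>2"
      using \<tau>0 \<delta>0 by (simp add: power_divide field_simps)
    also have "\<dots> \<le> (40 * (N * \<delta>))\<^sup>2" using N \<delta>0 by (simp add: power2_eq_square)
    finally show ?thesis by (rule power2_le_imp_le) (use N \<delta>0 in simp)
  qed
  have mu: "0 < \<tau> * \<delta> / 2" "\<tau> * \<delta> / 2 \<le> 4"
  proof -
    show "\<tau> * \<delta> / 2 \<le> 4" using \<tau>1 \<delta>h \<delta>0 \<tau> mult_mono[of \<tau> 1 \<delta> 1] by simp
  qed (use \<tau>0 \<delta>0 in simp)
  have w: "1 / 2 \<le> 8 * (sin (h / 2))\<^sup>2 / h\<^sup>2"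
  proof -
    have "(h / 4)\<^sup>2 \<le> (sin (h / 2))\<^sup>2"
      using half_le_sin[of "h / 2"] h by (intro power_mono) auto
    then show ?thesis using h by (simp add: field_simps power2_eq_square)
  qed
  have anti: "cos (h * real j) \<le> cos (h * real i)" if "i \<le> j" "j \<in> {a..<b}" for i j
    using freq[of j] that h by (intro cos_monotone_0_pi_le) auto
  define P where "P = {k \<in> {a..<b}. \<delta> \<le> cos (h * real k)}"
  define Z where "Z = {k \<in> {a..<b}. \<bar>cos (h * real k)\<bar> < \<delta>}"
  define Q where "Q = {k \<in> {a..<b}. cos (h * real k) \<le> - \<delta>}"
  have block: "cmod (\<Sum>k\<in>T. cis (?\<theta> k)) \<le> 40 * (N * \<delta>)"
    if T: "T \<subseteq> {a..<b}" and s: "\<bar>s\<bar> = 1" "\<And>k. k \<in> T \<Longrightarrow> \<delta> \<le> s * cos (h * real k)"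
      and cv: "\<And>i j k. i \<in> T \<Longrightarrow> k \<in> T \<Longrightarrow> i \<le> j \<Longrightarrow> j \<le> k \<Longrightarrow> j \<in> T" for T s
  proof -
    have "finite T" using T finite_subset by blast
    then obtain c d where cd: "T = {c..<d}" by (rule convex_nat_set_interval[OF _ cv])
    have "cmod (\<Sum>k=c..<d. cis (?\<theta> k)) \<le> 28 / sqrt (\<tau> * \<delta> / 2)"
    proof (rule second_derivative_test[OF mu, where s = "- s"])
      show "\<bar>- s\<bar> = 1" using s by simp
      fix k assume k: "c \<le> k" "Suc k < d"
      have "\<delta> \<le> s * cos (h * real (Suc k))" using s(2)[of "Suc k"] k cd by simp
      then have "\<tau> * (1 / 2) * \<delta> \<le> \<tau> * (8 * (sin (h / 2))\<^sup>2 / h\<^sup>2) * (s * cos (h * real (Suc k)))"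
        using w \<tau>0 \<delta>0 by (intro mult_mono) auto
      then show "\<tau> * \<delta> / 2 \<le> - s * (forward_diff ?\<theta> (Suc k) - forward_diff ?\<theta> k)"
        unfolding second_diff_lattice_phase[OF h(1)] by (simp add: algebra_simps)
    next
      fix i j assume "i \<in> {c..<d}" "j \<in> {c..<d}"
      then have "real i \<le> N" "real j \<le> N" using freq T cd by blast+
      then show "\<bar>forward_diff ?\<theta> i - forward_diff ?\<theta> j\<bar> \<le> 2"
        by (rule lattice_phase_first_diff_range[OF h(1) \<tau>])
    qed
    then show ?thesis using root cd by simp
  qed
  have "cmod (\<Sum>k\<in>P. cis (?\<theta> k)) \<le> 40 * (N * \<delta>)"
  proof (rule block[where s = 1])
    show "j \<in> P" if "i \<in> P" "k \<in> P" "i \<le> j" "j \<le> k" for i j k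
      using that anti[of j k] by (auto simp: P_def)
  qed (auto simp: P_def)
  moreover have "cmod (\<Sum>k\<in>Q. cis (?\<theta> k)) \<le> 40 * (N * \<delta>)"
  proof (rule block[where s = "- 1"])
    show "j \<in> Q" if "i \<in> Q" "k \<in> Q" "i \<le> j" "j \<le> k" for i j k
      using that anti[of i j] by (auto simp: Q_def)
  qed (auto simp: Q_def)
  moreover have "cmod (\<Sum>k\<in>Z. cis (?\<theta> k)) \<le> 8 * (N * \<delta>) + 1"
  proof -
    have near: "h * real k \<in> {pi / 2 - 2 * \<delta>..pi / 2 + 2 * \<delta>}" if "k \<in> Z" for k
    proof -
      have "0 \<le> h * real k" "h * real k \<le> pi" using freq[of k] that h by (auto simp: Z_def)
      then have "\<bar>pi / 2 - h * real k\<bar> \<le> pi / 2" by linarith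
      then have "\<bar>pi / 2 - h * real k\<bar> / 2 \<le> \<bar>sin (pi / 2 - h * real k)\<bar>"
        by (rule half_abs_le_abs_sin)
      also have "\<dots> < \<delta>" using that by (simp add: Z_def sin_diff)
      finally show ?thesis by auto
    qed
    have card: "real (card Z) \<le> 4 * \<delta> / h + 1"
      using h \<delta>0 near
      by (intro card_separated_le[where f = "\<lambda>k. h * real k" and y = "pi / 2 - 2 * \<delta>"])
        (auto simp: Z_def of_nat_diff algebra_simps)
    have "4 * \<delta> / h \<le> 8 * (N * \<delta>)" if ne: "Z \<noteq> {}"
    proof -
      obtain k where k: "k \<in> Z" using ne by auto
      then have "1 / 2 \<le> h * real k" using near[OF k] \<delta>h pi_gt3 by auto
      also have "\<dots> \<le> h * N" using freq[of k] k h by (intro mult_left_mono) (auto simp: Z_def)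
      finally have "1 / h \<le> 2 * N" using h by (simp add: field_simps)
      then have "4 * \<delta> * (1 / h) \<le> 4 * \<delta> * (2 * N)" using \<delta>0 by (intro mult_left_mono) auto
      then show ?thesis by (simp add: algebra_simps)
    qed
    then have "real (card Z) \<le> 8 * (N * \<delta>) + 1"
      using card N \<delta>0 by (cases "Z = {}") auto
    then show ?thesis using norm_cis_sum_le_card[of ?\<theta> Z] by linarith
  qed
  moreover have "(\<Sum>k=a..<b. cis (?\<theta> k)) = (\<Sum>k\<in>P. cis (?\<theta> k)) + (\<Sum>k\<in>Q. cis (?\<theta> k)) + (\<Sum>k\<in>Z. cis (?\<theta> k))"
  proof -
    have "{a..<b} = P \<union> Q \<union> Z" "P \<inter> Q = {}" "(P \<union> Q) \<inter> Z = {}" "finite P" "finite Q" "finite Z"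
      using \<delta>0 by (auto simp: P_def Q_def Z_def)
    then show ?thesis by (simp add: sum.union_disjoint)
  qed
  then have "cmod (\<Sum>k=a..<b. cis (?\<theta> k)) \<le>
      cmod (\<Sum>k\<in>P. cis (?\<theta> k)) + cmod (\<Sum>k\<in>Q. cis (?\<theta> k)) + cmod (\<Sum>k\<in>Z. cis (?\<theta> k))"
    by (simp add: norm_triangle_mono norm_triangle_ineq)
  ultimately have "cmod (\<Sum>k=a..<b. cis (?\<theta> k)) \<le> 90 * (N * \<delta>)" using N\<delta> by linarith
  also have "\<delta> \<le> 2 * (1 + ?y) powr (- 1 / 3)"
  proof -
    have "0 < (1 + z) / 8 \<and> (1 + z) / 8 \<le> z" if "8 \<le> z" for z :: real using that by auto
    from this[OF y] have "\<delta> \<le> ((1 + ?y) / 8) powr (- 1 / 3)"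
      unfolding \<delta>_def by (intro powr_mono2') auto
    also have "\<dots> = (1 + ?y) powr (- 1 / 3) / (2 powr 3) powr (- 1 / 3)"
      using y by (subst powr_divide) (auto simp: powr_numeral)
    also have "(2 powr 3) powr (- 1 / 3) = (1 / 2 :: real)"
      unfolding powr_powr by (simp add: powr_minus_divide)
    finally show ?thesis by simp
  qed
  then have "90 * (N * \<delta>) \<le> 90 * (N * (2 * (1 + ?y) powr (- 1 / 3)))"
    using N by (intro mult_left_mono) auto
  finally show ?thesis by simp
qed

lemma dispersive_estimate_1d:
  fixes p b :: nat and h \<tau> N x :: real
  assumes h: "0 < h" "h \<le> pi" and N: "1 \<le> N" and \<tau>: "\<bar>\<tau>\<bar> * N \<le> 1"
    and freq: "\<And>k. k \<in> {- int p..<int b} \<Longrightarrow> h * \<bar>real_of_int k\<bar> \<le> pi \<and> \<bar>real_of_int k\<bar> \<le> N"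
  shows "cmod (\<Sum>k\<in>{- int p..<int b}. cis (lattice_phase h \<tau> x (real_of_int k))) \<le>
    360 * N * (1 + N\<^sup>2 * \<bar>\<tau>\<bar>) powr (- 1 / 3)"
proof -
  have half: "cmod (\<Sum>k=l..<u. cis (lattice_phase h \<tau> z (real k))) \<le>
      180 * N * (1 + N\<^sup>2 * \<bar>\<tau>\<bar>) powr (- 1 / 3)"
    if f: "\<And>k. k \<in> {l..<u} \<Longrightarrow> h * real k \<le> pi \<and> real k \<le> N" for l u z
  proof (cases "\<tau> \<ge> 0")
    case True
    then show ?thesis using dispersive_estimate_half_line[OF h N, of \<tau> l u z] \<tau> f by simp
  next
    case False
    have neg: "lattice_phase h \<tau> z k = - lattice_phase h (- \<tau>) (- z) k" for k
      by (simp add: lattice_phase_def)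
    have "(\<Sum>k=l..<u. cis (lattice_phase h \<tau> z (real k))) =
        cnj (\<Sum>k=l..<u. cis (lattice_phase h (- \<tau>) (- z) (real k)))"
      unfolding neg cis_cnj[symmetric] by simp
    then have "cmod (\<Sum>k=l..<u. cis (lattice_phase h \<tau> z (real k))) =
        cmod (\<Sum>k=l..<u. cis (lattice_phase h (- \<tau>) (- z) (real k)))"
      by (simp only: complex_mod_cnj)
    then show ?thesis
      using dispersive_estimate_half_line[OF h N, of "- \<tau>" l u "- z"] \<tau> f False by simp
  qed
  let ?f = "\<lambda>k. cis (lattice_phase h \<tau> x (real_of_int k))"
  have "(\<Sum>k\<in>{- int p..<int b}. ?f k) = (\<Sum>k\<in>{0..<int b}. ?f k) + (\<Sum>k\<in>{- int p..<0}. ?f k)"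
    by (subst sum.union_disjoint[symmetric]) (auto intro: sum.cong)
  also have "(\<Sum>k\<in>{0..<int b}. ?f k) = (\<Sum>k=0..<b. cis (lattice_phase h \<tau> x (real k)))"
    by (rule sum.reindex_bij_witness[of _ int nat]) auto
  also have "(\<Sum>k\<in>{- int p..<0}. ?f k) = (\<Sum>k=1..<Suc p. cis (lattice_phase h \<tau> (- x) (real k)))"
    by (rule sum.reindex_bij_witness[of _ "\<lambda>k. - int k" "\<lambda>k. nat (- k)"])
      (auto simp: lattice_phase_def)
  finally have "cmod (\<Sum>k\<in>{- int p..<int b}. ?f k) \<le>
      cmod (\<Sum>k=0..<b. cis (lattice_phase h \<tau> x (real k))) +
      cmod (\<Sum>k=1..<Suc p. cis (lattice_phase h \<tau> (- x) (real k)))"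
    by (simp only: norm_triangle_ineq)
  moreover have "cmod (\<Sum>k=0..<b. cis (lattice_phase h \<tau> x (real k))) \<le>
      180 * N * (1 + N\<^sup>2 * \<bar>\<tau>\<bar>) powr (- 1 / 3)"
  proof (rule half)
    fix k assume "k \<in> {0..<b}"
    then show "h * real k \<le> pi \<and> real k \<le> N" using freq[of "int k"] by auto
  qed
  moreover have "cmod (\<Sum>k=1..<Suc p. cis (lattice_phase h \<tau> (- x) (real k))) \<le>
      180 * N * (1 + N\<^sup>2 * \<bar>\<tau>\<bar>) powr (- 1 / 3)"
  proof (rule half)
    fix k assume "k \<in> {1..<Suc p}"
    then show "h * real k \<le> pi \<and> real k \<le> N" using freq[of "- int k"] by auto
  qed
  ultimately show ?thesis by linarith
qed

section \<open>Interpolation between two operator bounds\<close>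

text \<open>
  The norm of \<open>L\<^sup>r\<close> over a finite set in which every point has mass \<open>w\<close>.
\<close>

definition Lp_norm :: "'a set \<Rightarrow> real \<Rightarrow> real \<Rightarrow> ('a \<Rightarrow> complex) \<Rightarrow> real" where
  "Lp_norm X w r f = (w * (\<Sum>x\<in>X. cmod (f x) powr r)) powr (1 / r)"

lemma Lp_norm_nonneg: "0 \<le> Lp_norm X w r f"
  by (simp add: Lp_norm_def)

lemma Lp_norm_powr:
  assumes "0 \<le> w" "r \<noteq> 0"
  shows "Lp_norm X w r f powr r = w * (\<Sum>x\<in>X. cmod (f x) powr r)"
  using assms by (simp add: Lp_norm_def powr_powr sum_nonneg)

lemma Lp_norm_eq_0_iff:
  assumes "finite X" "0 < w" "r \<noteq> 0"
  shows "Lp_norm X w r f = 0 \<longleftrightarrow> (\<forall>x\<in>X. f x = 0)"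
  using assms by (auto simp: Lp_norm_def sum_nonneg_eq_0_iff)

text \<open>
  After normalisation this is Young's inequality, summed over the points.
\<close>

lemma Holder_inequality:
  fixes f g :: "'a \<Rightarrow> complex"
  assumes X: "finite X" and w: "0 < w" and pr: "1 < p" "1 < r" "1 / p + 1 / r = 1"
  shows "cmod (w * (\<Sum>x\<in>X. f x * g x)) \<le> Lp_norm X w p f * Lp_norm X w r g"
proof -
  define a b where "a = Lp_norm X w p f" and "b = Lp_norm X w r g"
  have nn: "a \<ge> 0" "b \<ge> 0" by (simp_all add: a_def b_def Lp_norm_nonneg)
  show ?thesis
  proof (cases "a = 0 \<or> b = 0")
    case True
    then have "\<forall>x\<in>X. f x * g x = 0"
      using Lp_norm_eq_0_iff[OF X w] pr by (auto simp: a_def b_def)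
    then have "(\<Sum>x\<in>X. f x * g x) = 0" by (intro sum.neutral) auto
    then show ?thesis by (simp add: Lp_norm_nonneg)
  next
    case False
    then have ab: "a > 0" "b > 0" using nn by auto
    have "w * (\<Sum>x\<in>X. cmod (f x) / a * (cmod (g x) / b)) \<le>
        w * (\<Sum>x\<in>X. (cmod (f x) / a) powr p / p + (cmod (g x) / b) powr r / r)"
      using pr ab w by (intro mult_left_mono sum_mono Youngs_inequality) auto
    also have "\<dots> = (w * (\<Sum>x\<in>X. cmod (f x) powr p)) / a powr p / p +
        (w * (\<Sum>x\<in>X. cmod (g x) powr r)) / b powr r / r"
      using ab by (simp add: powr_divide sum.distrib sum_distrib_left sum_divide_distrib distrib_left)
    also have "\<dots> = a powr p / a powr p / p + b powr r / b powr r / r"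
      using pr w Lp_norm_powr[of w p X f] Lp_norm_powr[of w r X g] by (simp flip: a_def b_def)
    also have "\<dots> = 1" using ab pr by simp
    finally have 1: "w * (\<Sum>x\<in>X. cmod (f x) / a * (cmod (g x) / b)) \<le> 1" .
    have "cmod (w * (\<Sum>x\<in>X. f x * g x)) \<le> w * (\<Sum>x\<in>X. cmod (f x) * cmod (g x))"
      using w norm_sum[of "\<lambda>x. f x * g x" X] by (simp add: norm_mult)
    also have "\<dots> = a * b * (w * (\<Sum>x\<in>X. cmod (f x) / a * (cmod (g x) / b)))"
      using ab by (simp add: sum_distrib_left field_simps)
    also have "\<dots> \<le> a * b * 1" using ab 1 by (intro mult_left_mono) auto
    finally show ?thesis by (simp add: a_def b_def)
  qed
qed

lemma powr_indicator_has_integral: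
  assumes "a > (-1::real)" "c \<ge> 0"
  shows "((\<lambda>s. if s \<in> {0..c} then s powr a else 0) has_integral c powr (a + 1) / (a + 1)) UNIV"
  using has_integral_powr_from_0[OF assms] by (simp only: has_integral_restrict_UNIV)

text \<open>
  The function is cut at a height that depends on the level \<open>s\<close>: the high part is so small in \<open>L\<^sup>1\<close>
  that its image stays below \<open>s / 2\<close> everywhere. On the level set the image of the low part thus
  exceeds \<open>s / 2\<close>, and Chebyshev's inequality applies.
\<close>

lemma real_interpolation_level_estimate:
  fixes T :: "('a \<Rightarrow> complex) \<Rightarrow> 'a \<Rightarrow> complex" and f :: "'a \<Rightarrow> complex"
  assumes X: "finite X" and w: "0 < w" and A: "0 < A"
    and add: "\<And>f g m. T (\<lambda>x. f x + g x) m = T f m + T g m"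
    and sup: "\<And>f m. m \<in> X \<Longrightarrow> cmod (T f m) \<le> A * (w * (\<Sum>x\<in>X. cmod (f x)))"
    and L2: "\<And>f. w * (\<Sum>m\<in>X. (cmod (T f m))\<^sup>2) \<le> B * (w * (\<Sum>x\<in>X. (cmod (f x))\<^sup>2))"
    and S: "S = w * (\<Sum>x\<in>X. cmod (f x) powr p)" "0 < S"
    and s: "0 < s"
  shows "w * card {m \<in> X. s \<le> cmod (T f m)} \<le>
    4 * B / s\<^sup>2 * (w * (\<Sum>x\<in>{x \<in> X. s \<le> 2 * A * S * cmod (f x) powr (1 - p)}. (cmod (f x))\<^sup>2))"
proof -
  \<comment> \<open>for \<open>p > 1\<close> and \<open>f x \<noteq> 0\<close> this bounds \<open>\<bar>f x\<bar>\<close> by a power of \<open>1 / s\<close>\<close>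
  define P where "P x \<longleftrightarrow> s \<le> 2 * A * S * cmod (f x) powr (1 - p)" for x
  define lo where "lo x = (if P x then f x else 0)" for x
  define hi where "hi x = (if P x then 0 else f x)" for x
  have hi: "cmod (T hi m) \<le> s / 2" if "m \<in> X" for m
  proof -
    have "cmod (hi x) \<le> s / (2 * A * S) * cmod (f x) powr p" for x
    proof (cases "P x \<or> f x = 0")
      case True
      then show ?thesis using s A S by (auto simp: hi_def)
    next
      case False
      then have "cmod (f x) powr (1 - p) \<le> s / (2 * A * S)"
        using A S(2) by (simp add: P_def field_simps)
      then have "cmod (f x) powr (1 - p) * cmod (f x) powr p \<le> s / (2 * A * S) * cmod (f x) powr p"
        by (intro mult_right_mono) auto
      moreover have "cmod (f x) powr (1 - p) * cmod (f x) powr p = cmod (f x)"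
        using False by (simp flip: powr_add)
      ultimately show ?thesis using False by (simp add: hi_def)
    qed
    then have "A * (w * (\<Sum>x\<in>X. cmod (hi x))) \<le> A * (w * (\<Sum>x\<in>X. s / (2 * A * S) * cmod (f x) powr p))"
      using A w by (intro mult_left_mono sum_mono) auto
    also have "\<dots> = A * (s / (2 * A * S) * S)"
      unfolding S(1) sum_distrib_left[symmetric] by simp
    also have "\<dots> = s / 2" using A S(2) by simp
    finally show ?thesis using sup[OF that, of hi] by linarith
  qed
  have lo: "1 \<le> 4 / s\<^sup>2 * (cmod (T lo m))\<^sup>2" if m: "m \<in> X" "s \<le> cmod (T f m)" for m
  proof -
    have "f = (\<lambda>x. lo x + hi x)" by (auto simp: lo_def hi_def)
    then have "T f m = T lo m + T hi m" using add by metis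
    then have "s / 2 \<le> cmod (T lo m)"
      using hi[OF m(1)] m(2) norm_triangle_ineq[of "T lo m" "T hi m"] by simp
    then have "(s / 2)\<^sup>2 \<le> (cmod (T lo m))\<^sup>2" using s by (intro power_mono) auto
    then show ?thesis using s by (simp add: field_simps)
  qed
  have "w * card {m \<in> X. s \<le> cmod (T f m)} = w * (\<Sum>m\<in>{m \<in> X. s \<le> cmod (T f m)}. 1)" by simp
  also have "\<dots> \<le> w * (\<Sum>m\<in>{m \<in> X. s \<le> cmod (T f m)}. 4 / s\<^sup>2 * (cmod (T lo m))\<^sup>2)"
    using w lo by (intro mult_left_mono sum_mono) auto
  also have "\<dots> \<le> w * (\<Sum>m\<in>X. 4 / s\<^sup>2 * (cmod (T lo m))\<^sup>2)"
    using w X by (intro mult_left_mono sum_mono2) auto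
  also have "\<dots> = 4 / s\<^sup>2 * (w * (\<Sum>m\<in>X. (cmod (T lo m))\<^sup>2))"
    by (simp add: sum_distrib_left mult.left_commute)
  also have "\<dots> \<le> 4 / s\<^sup>2 * (B * (w * (\<Sum>x\<in>X. (cmod (lo x))\<^sup>2)))"
    by (intro mult_left_mono L2) auto
  also have "(\<Sum>x\<in>X. (cmod (lo x))\<^sup>2) = (\<Sum>x\<in>{x \<in> X. P x}. (cmod (f x))\<^sup>2)"
    unfolding sum.inter_filter[OF X] by (rule sum.cong) (auto simp: lo_def)
  finally show ?thesis by (simp add: P_def)
qed

text \<open>
  Marcinkiewicz interpolation between \<open>L\<^sup>1 \<rightarrow> L\<^sup>\<infinity>\<close> with bound \<open>A\<close> and \<open>L\<^sup>2 \<rightarrow> L\<^sup>2\<close> with bound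
  \<open>sqrt B\<close>, on the line of dual exponents. The level estimate is multiplied by
  \<open>r s\<^sup>r\<^sup>-\<^sup>1\<close> and integrated over \<open>s\<close>; the right-hand side is integrable at \<open>s = 0\<close> because \<open>r > 2\<close>.
  The constant stays bounded as \<open>r\<close> tends to infinity.
\<close>

lemma real_interpolation:
  fixes T :: "('a \<Rightarrow> complex) \<Rightarrow> 'a \<Rightarrow> complex" and f :: "'a \<Rightarrow> complex"
  assumes X: "finite X" and w: "0 < w" and A: "0 < A" and B: "0 \<le> B" and r: "2 < r"
    and add: "\<And>f g m. T (\<lambda>x. f x + g x) m = T f m + T g m"
    and sup: "\<And>f m. m \<in> X \<Longrightarrow> cmod (T f m) \<le> A * (w * (\<Sum>x\<in>X. cmod (f x)))"
    and L2: "\<And>f. w * (\<Sum>m\<in>X. (cmod (T f m))\<^sup>2) \<le> B * (w * (\<Sum>x\<in>X. (cmod (f x))\<^sup>2))"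
  shows "Lp_norm X w r (T f) \<le>
    (4 * r / (r - 2) * B * (2 * A) powr (r - 2)) powr (1 / r) * Lp_norm X w (r / (r - 1)) f"
proof -
  define p where "p = r / (r - 1)"
  define S where "S = w * (\<Sum>x\<in>X. cmod (f x) powr p)"
  have p: "p > 1" using r by (simp add: p_def)
  show ?thesis
  proof (cases "S = 0")
    case True
    then have "\<forall>x\<in>X. f x = 0" using X w by (simp add: S_def sum_nonneg_eq_0_iff)
    then have "\<forall>m\<in>X. T f m = 0" using sup[of _ f] by simp
    then show ?thesis using r B A by (simp add: Lp_norm_def)
  next
    case False
    then have S0: "S > 0" using w by (simp add: S_def sum_nonneg less_le)
    define c where "c x = 2 * A * S * cmod (f x) powr (1 - p)" for x
    have c0: "c x \<ge> 0" for x using A S0 by (simp add: c_def)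
    let ?l = "\<lambda>s. \<Sum>m\<in>X. w * r * (if s \<in> {0..cmod (T f m)} then s powr (r - 1) else 0)"
    let ?u = "\<lambda>s. \<Sum>x\<in>X. 4 * B * r * w * (cmod (f x))\<^sup>2 * (if s \<in> {0..c x} then s powr (r - 3) else 0)"
    have "(?l has_integral (\<Sum>m\<in>X. w * r * (cmod (T f m) powr (r - 1 + 1) / (r - 1 + 1)))) UNIV"
      using r X by (intro has_integral_sum has_integral_mult_right powr_indicator_has_integral) auto
    moreover have "(?u has_integral (\<Sum>x\<in>X. 4 * B * r * w * (cmod (f x))\<^sup>2 * (c x powr (r - 3 + 1) / (r - 3 + 1)))) UNIV"
      using r X c0 by (intro has_integral_sum has_integral_mult_right powr_indicator_has_integral) auto
    moreover have "?l s \<le> ?u s" for s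
    proof (cases "s > 0")
      case True
      have sr: "s powr (r - 1) = s powr (r - 3) * s\<^sup>2"
        using True by (simp flip: powr_numeral powr_add)
      have "?l s = r * s powr (r - 1) * (w * card {m \<in> X. s \<le> cmod (T f m)})"
      proof -
        have "?l s = (\<Sum>m\<in>X. if s \<le> cmod (T f m) then w * r * s powr (r - 1) else 0)"
          using True by (intro sum.cong) auto
        also have "\<dots> = (\<Sum>m\<in>{m \<in> X. s \<le> cmod (T f m)}. w * r * s powr (r - 1))"
          by (rule sum.inter_filter[OF X, symmetric])
        finally show ?thesis by simp
      qed
      also have "\<dots> \<le> r * s powr (r - 1) * (4 * B / s\<^sup>2 * (w * (\<Sum>x\<in>{x \<in> X. s \<le> c x}. (cmod (f x))\<^sup>2)))"
        unfolding c_def using r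
        by (intro mult_left_mono real_interpolation_level_estimate[OF X w A add sup L2 S_def S0 True]) auto
      also have "r * s powr (r - 1) * (4 * B / s\<^sup>2 * (w * (\<Sum>x\<in>{x \<in> X. s \<le> c x}. (cmod (f x))\<^sup>2))) =
          (\<Sum>x\<in>{x \<in> X. s \<le> c x}. 4 * B * r * w * (cmod (f x))\<^sup>2 * s powr (r - 3))"
        using True sr by (simp add: sum_distrib_left sum_distrib_right algebra_simps)
      also have "\<dots> = (\<Sum>x\<in>X. if s \<le> c x then 4 * B * r * w * (cmod (f x))\<^sup>2 * s powr (r - 3) else 0)"
        by (rule sum.inter_filter[OF X])
      also have "\<dots> = ?u s" using True by (intro sum.cong) auto
      finally show ?thesis .
    next
      case False
      then have "?l s = 0" using r by (intro sum.neutral) auto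
      then show ?thesis using B r w by (simp add: sum_nonneg)
    qed
    ultimately have "(\<Sum>m\<in>X. w * r * (cmod (T f m) powr (r - 1 + 1) / (r - 1 + 1))) \<le>
        (\<Sum>x\<in>X. 4 * B * r * w * (cmod (f x))\<^sup>2 * (c x powr (r - 3 + 1) / (r - 3 + 1)))"
      using has_integral_le by blast
    also have "(\<Sum>m\<in>X. w * r * (cmod (T f m) powr (r - 1 + 1) / (r - 1 + 1))) =
        w * (\<Sum>m\<in>X. cmod (T f m) powr r)"
      using r by (simp add: sum_distrib_left)
    also have "(\<Sum>x\<in>X. 4 * B * r * w * (cmod (f x))\<^sup>2 * (c x powr (r - 3 + 1) / (r - 3 + 1))) =
        4 * r / (r - 2) * B * (2 * A) powr (r - 2) * S powr (r - 1)"
    proof -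
      have "(cmod (f x))\<^sup>2 * c x powr (r - 2) = (2 * A * S) powr (r - 2) * cmod (f x) powr p" for x
      proof (cases "f x = 0")
        case False
        have "2 + (1 - p) * (r - 2) = p" using r by (simp add: p_def field_simps)
        then have "(cmod (f x))\<^sup>2 * (cmod (f x) powr (1 - p)) powr (r - 2) = cmod (f x) powr p"
          using False by (simp add: powr_powr flip: powr_numeral powr_add)
        then show ?thesis using A S0 by (simp add: c_def powr_mult algebra_simps)
      qed simp
      then have "(\<Sum>x\<in>X. 4 * B * r * w * (cmod (f x))\<^sup>2 * (c x powr (r - 3 + 1) / (r - 3 + 1))) =
          (\<Sum>x\<in>X. 4 * B * r / (r - 2) * w * ((2 * A * S) powr (r - 2) * cmod (f x) powr p))"
        by (simp add: algebra_simps)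
      also have "\<dots> = 4 * B * r / (r - 2) * (2 * A * S) powr (r - 2) * S"
      proof -
        have "(\<Sum>x\<in>X. a * w * (b * cmod (f x) powr p)) = a * b * S" for a b
          by (simp add: S_def sum_distrib_left algebra_simps)
        then show ?thesis .
      qed
      also have "(2 * A * S) powr (r - 2) = (2 * A) powr (r - 2) * S powr (r - 2)"
        by (simp add: powr_mult)
      also have "4 * B * r / (r - 2) * ((2 * A) powr (r - 2) * S powr (r - 2)) * S =
          4 * r / (r - 2) * B * (2 * A) powr (r - 2) * (S powr (r - 2) * S powr 1)"
        using S0 by simp
      also have "S powr (r - 2) * S powr 1 = S powr (r - 1)" unfolding powr_add[symmetric] by simp
      finally show ?thesis .
    qed
    finally have "Lp_norm X w r (T f) \<le> (4 * r / (r - 2) * B * (2 * A) powr (r - 2) * S powr (r - 1)) powr (1 / r)"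
      unfolding Lp_norm_def using r w by (intro powr_mono2) (auto intro!: mult_nonneg_nonneg sum_nonneg)
    also have "\<dots> = (4 * r / (r - 2) * B * (2 * A) powr (r - 2)) powr (1 / r) * (S powr (r - 1)) powr (1 / r)"
      by (rule powr_mult)
    also have "(S powr (r - 1)) powr (1 / r) = Lp_norm X w p f"
      using r by (simp add: powr_powr Lp_norm_def S_def p_def)
    finally show ?thesis by (simp only: p_def)
  qed
qed

section \<open>Minkowski inequalities\<close>

lemma powr_ge_tangent:
  fixes y q :: real
  assumes "0 \<le> y" "1 \<le> q"
  shows "1 + q * (y - 1) \<le> y powr q"
proof (cases "y = 0")
  case False
  have "(y powr q) powr (1 / q) * 1 powr (1 - 1 / q) \<le> 1 / q * y powr q + (1 - 1 / q) * 1"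
    using False assms by (intro Youngs_inequality_0) auto
  then have "y \<le> 1 / q * y powr q + (1 - 1 / q)" using assms by (simp add: powr_powr)
  then have "q * y \<le> q * (1 / q * y powr q + (1 - 1 / q))" using assms by (intro mult_left_mono) auto
  then show ?thesis using assms by (simp add: algebra_simps)
qed (use assms in simp)

text \<open>
  This is Jensen's inequality for the weights \<open>b j / \<Sum> b\<close>, obtained from the tangent of the power
  function at the mean so that vanishing terms \<open>x j\<close> are covered.
\<close>

lemma powr_sum_convex:
  fixes x b :: "'j \<Rightarrow> real"
  assumes J: "finite J" "J \<noteq> {}" and b: "\<And>j. j \<in> J \<Longrightarrow> 0 < b j" and x: "\<And>j. j \<in> J \<Longrightarrow> 0 \<le> x j"
    and q: "1 \<le> q"
  shows "(\<Sum>j\<in>J. x j) powr q \<le> (\<Sum>j\<in>J. b j) powr q * (\<Sum>j\<in>J. b j / (\<Sum>j\<in>J. b j) * (x j / b j) powr q)"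
proof -
  define B where "B = (\<Sum>j\<in>J. b j)"
  define m where "m = (\<Sum>j\<in>J. x j) / B"
  have B: "B > 0" using J b by (simp add: B_def sum_pos)
  have m: "m \<ge> 0" using B x by (simp add: m_def sum_nonneg)
  have "m powr q \<le> (\<Sum>j\<in>J. b j / B * (x j / b j) powr q)"
  proof (cases "m = 0")
    case True
    then show ?thesis using b B by (auto intro!: sum_nonneg divide_nonneg_pos mult_nonneg_nonneg simp: less_imp_le)
  next
    case False
    then have m0: "m > 0" using m by simp
    have "m powr q = m powr q * (\<Sum>j\<in>J. b j / B * (1 + q * (x j / b j / m - 1)))"
    proof -
      have "b j / B * (1 + q * (x j / b j / m - 1)) = (1 - q) * (b j / B) + q / m * (x j / B)" if "j \<in> J" for j
        using b[OF that] m0 B by (simp add: field_simps)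
      then have "(\<Sum>j\<in>J. b j / B * (1 + q * (x j / b j / m - 1))) =
          (1 - q) * (\<Sum>j\<in>J. b j / B) + q / m * (\<Sum>j\<in>J. x j / B)"
        by (simp add: sum.distrib sum_distrib_left)
      also have "(\<Sum>j\<in>J. b j / B) = 1"
        using B by (simp add: sum_divide_distrib[symmetric] B_def[symmetric])
      also have "(\<Sum>j\<in>J. x j / B) = m" by (simp add: m_def sum_divide_distrib)
      also have "(1 - q) * 1 + q / m * m = 1" using m0 by simp
      finally show ?thesis by simp
    qed
    also have "\<dots> \<le> m powr q * (\<Sum>j\<in>J. b j / B * (x j / b j / m) powr q)"
      using b B x m0 q
      by (intro mult_left_mono sum_mono powr_ge_tangent) (auto simp: less_imp_le)
    also have "\<dots> = (\<Sum>j\<in>J. b j / B * (x j / b j) powr q)"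
    proof -
      have e: "m powr q * (b j / B * (x j / b j / m) powr q) = b j / B * (x j / b j) powr q" for j
        unfolding powr_divide[of "x j / b j" m q] using m0 by simp
      show ?thesis unfolding sum_distrib_left e ..
    qed
    finally show ?thesis .
  qed
  then have "B powr q * m powr q \<le> B powr q * (\<Sum>j\<in>J. b j / B * (x j / b j) powr q)"
    by (intro mult_left_mono) auto
  moreover have "B powr q * m powr q = (\<Sum>j\<in>J. x j) powr q"
    unfolding powr_mult[symmetric] using B by (simp add: m_def)
  ultimately show ?thesis by (simp add: B_def)
qed

text \<open>
  Convexity is applied with the norms of the summands as weights; the summands of norm zero vanish
  on \<open>X\<close> and are discarded first.
\<close>

lemma Lp_norm_sum_le:
  fixes f :: "'j \<Rightarrow> 'a \<Rightarrow> complex"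
  assumes X: "finite X" and w: "0 < w" and r: "1 \<le> r" and J: "finite J"
  shows "Lp_norm X w r (\<lambda>x. \<Sum>j\<in>J. f j x) \<le> (\<Sum>j\<in>J. Lp_norm X w r (f j))"
proof -
  define a where "a j = Lp_norm X w r (f j)" for j
  define I where "I = {j \<in> J. 0 < a j}"
  have I: "finite I" "I \<subseteq> J" using J by (auto simp: I_def)
  have fI: "(\<Sum>j\<in>J. f j x) = (\<Sum>j\<in>I. f j x)" if "x \<in> X" for x
  proof (rule sum.mono_neutral_right[OF J I(2)])
    have "f j x = 0" if "j \<in> J - I" for j
    proof -
      have "Lp_norm X w r (f j) = 0" using that Lp_norm_nonneg[of X w r "f j"] by (auto simp: I_def a_def)
      then show ?thesis using Lp_norm_eq_0_iff[OF X w] r \<open>x \<in> X\<close> by auto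
    qed
    then show "\<forall>j\<in>J - I. f j x = 0" by blast
  qed
  have sI: "(\<Sum>j\<in>I. a j) \<le> (\<Sum>j\<in>J. a j)"
    using J I by (intro sum_mono2) (auto simp: a_def Lp_norm_nonneg)
  show ?thesis
  proof (cases "I = {}")
    case True
    then have "Lp_norm X w r (\<lambda>x. \<Sum>j\<in>J. f j x) = 0" using fI Lp_norm_eq_0_iff[OF X w] r by auto
    then show ?thesis by (simp add: sum_nonneg Lp_norm_nonneg)
  next
    case False
    define B where "B = (\<Sum>j\<in>I. a j)"
    have aI: "0 < a j" if "j \<in> I" for j using that by (simp add: I_def)
    have B: "B > 0" unfolding B_def using I False aI by (intro sum_pos) auto
    have "w * (\<Sum>x\<in>X. cmod (\<Sum>j\<in>J. f j x) powr r) \<le>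
        w * (\<Sum>x\<in>X. B powr r * (\<Sum>j\<in>I. a j / B * (cmod (f j x) / a j) powr r))"
    proof (intro mult_left_mono sum_mono)
      fix x assume "x \<in> X"
      then have "cmod (\<Sum>j\<in>J. f j x) powr r \<le> (\<Sum>j\<in>I. cmod (f j x)) powr r"
        using r fI by (intro powr_mono2) (auto intro: norm_sum)
      also have "\<dots> \<le> B powr r * (\<Sum>j\<in>I. a j / B * (cmod (f j x) / a j) powr r)"
        unfolding B_def by (rule powr_sum_convex[OF I(1) False aI _ r]) auto
      finally show "cmod (\<Sum>j\<in>J. f j x) powr r \<le> B powr r * (\<Sum>j\<in>I. a j / B * (cmod (f j x) / a j) powr r)" .
    qed (use w in simp)
    also have "\<dots> = B powr r * (\<Sum>j\<in>I. a j / B * ((w * (\<Sum>x\<in>X. cmod (f j x) powr r)) / a j powr r))"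
    proof -
      have "w * (\<Sum>x\<in>X. B powr r * (\<Sum>j\<in>I. a j / B * (cmod (f j x) / a j) powr r)) =
          (\<Sum>x\<in>X. \<Sum>j\<in>I. B powr r * (a j / B * (w * cmod (f j x) powr r / a j powr r)))"
        by (simp add: sum_distrib_left powr_divide mult_ac)
      also have "\<dots> = (\<Sum>j\<in>I. \<Sum>x\<in>X. B powr r * (a j / B * (w * cmod (f j x) powr r / a j powr r)))"
        by (rule sum.swap)
      finally show ?thesis by (simp add: sum_distrib_left sum_divide_distrib)
    qed
    also have "\<dots> = B powr r * (\<Sum>j\<in>I. a j / B)"
    proof -
      have "w * (\<Sum>x\<in>X. cmod (f j x) powr r) = a j powr r" for j
        unfolding a_def using w r by (subst Lp_norm_powr) auto
      moreover have "a j powr r / a j powr r = 1" if "j \<in> I" for j using aI[OF that] by simp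
      ultimately show ?thesis by simp
    qed
    also have "(\<Sum>j\<in>I. a j / B) = 1" using B by (simp add: sum_divide_distrib[symmetric] B_def[symmetric])
    finally have "Lp_norm X w r (\<lambda>x. \<Sum>j\<in>J. f j x) \<le> (B powr r) powr (1 / r)"
      unfolding Lp_norm_def using w r by (intro powr_mono2) (auto intro!: mult_nonneg_nonneg sum_nonneg)
    also have "\<dots> = B" using B r by (simp add: powr_powr)
    finally show ?thesis using sI by (simp add: B_def a_def)
  qed
qed

text \<open>
  The positive bounds \<open>b j\<close> serve as the weights in the convexity inequality, so no case of a
  vanishing norm arises.
\<close>

lemma integral_Minkowski:
  fixes g :: "'j \<Rightarrow> real \<Rightarrow> real"
  assumes J: "finite J" "J \<noteq> {}" and q: "1 \<le> q" and b: "\<And>j. j \<in> J \<Longrightarrow> 0 < b j"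
    and g: "\<And>j. j \<in> J \<Longrightarrow> continuous_on {c..d} (g j)" "\<And>j t. j \<in> J \<Longrightarrow> t \<in> {c..d} \<Longrightarrow> 0 \<le> g j t"
    and gb: "\<And>j. j \<in> J \<Longrightarrow> integral {c..d} (\<lambda>t. g j t powr q) \<le> b j powr q"
    and G: "continuous_on {c..d} G" "\<And>t. t \<in> {c..d} \<Longrightarrow> 0 \<le> G t \<and> G t \<le> (\<Sum>j\<in>J. g j t)"
  shows "integral {c..d} (\<lambda>t. G t powr q) \<le> (\<Sum>j\<in>J. b j) powr q"
proof -
  define B where "B = (\<Sum>j\<in>J. b j)"
  have B: "B > 0" using J b by (simp add: B_def sum_pos)
  have cont: "continuous_on {c..d} (\<lambda>t. u t powr q)" if "continuous_on {c..d} u" "\<And>t. t \<in> {c..d} \<Longrightarrow> 0 \<le> u t" for u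
    using that q by (intro continuous_on_powr' continuous_intros) auto
  have "integral {c..d} (\<lambda>t. G t powr q) \<le> integral {c..d} (\<lambda>t. B powr q * (\<Sum>j\<in>J. b j / B * (g j t powr q / b j powr q)))"
  proof (intro integral_le integrable_continuous_real)
    show "continuous_on {c..d} (\<lambda>t. G t powr q)" using G by (intro cont) auto
    show "continuous_on {c..d} (\<lambda>t. B powr q * (\<Sum>j\<in>J. b j / B * (g j t powr q / b j powr q)))"
      using g b by (intro continuous_intros cont) (auto simp: less_imp_neq[symmetric])
    fix t assume t: "t \<in> {c..d}"
    have "G t powr q \<le> (\<Sum>j\<in>J. g j t) powr q" using G(2)[OF t] q by (intro powr_mono2) auto
    also have "\<dots> \<le> B powr q * (\<Sum>j\<in>J. b j / B * (g j t / b j) powr q)"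
      unfolding B_def using t g(2) by (intro powr_sum_convex J b q) auto
    finally show "G t powr q \<le> B powr q * (\<Sum>j\<in>J. b j / B * (g j t powr q / b j powr q))"
      by (simp add: powr_divide)
  qed
  also have "\<dots> = B powr q * (\<Sum>j\<in>J. b j / B * (integral {c..d} (\<lambda>t. g j t powr q) / b j powr q))"
    by (intro integral_unique has_integral_mult_right has_integral_sum has_integral_divide J
        integrable_integral integrable_continuous_real cont g) auto
  also have "\<dots> \<le> B powr q * (\<Sum>j\<in>J. b j / B * 1)"
  proof (intro mult_left_mono sum_mono)
    fix j assume j: "j \<in> J"
    show "integral {c..d} (\<lambda>t. g j t powr q) / b j powr q \<le> 1"
      using gb[OF j] b[OF j] by (simp add: divide_le_eq_1)
    show "0 \<le> b j / B" using b[OF j] B by simp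
  qed simp
  also have "(\<Sum>j\<in>J. b j / B * 1) = 1" using B by (simp add: sum_divide_distrib[symmetric] B_def[symmetric])
  finally show ?thesis by (simp add: B_def)
qed

text \<open>
  Dispersion is available for times up to \<open>1 / N\<close> only; this lemma passes to the unit interval at
  the cost of a factor \<open>N\<close>.
\<close>

lemma integral_unit_interval_pieces:
  fixes f :: "real \<Rightarrow> real" and N :: nat
  assumes f: "continuous_on {0..1} f" and N: "1 \<le> N"
    and piece: "\<And>a b. 0 \<le> a \<Longrightarrow> a < b \<Longrightarrow> b \<le> 1 \<Longrightarrow> (b - a) * real N \<le> 1 \<Longrightarrow> integral {a..b} f \<le> B"
  shows "integral {0..1} f \<le> real N * B"
proof -
  have "integral {0..real i / real N} f \<le> real i * B" if "i \<le> N" for i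
    using that
  proof (induction i)
    case (Suc i)
    let ?a = "real i / real N" and ?b = "real (Suc i) / real N"
    have ab: "0 \<le> ?a" "?a < ?b" "?b \<le> 1" "(?b - ?a) * real N \<le> 1"
      using Suc.prems N by (auto simp: field_simps)
    have "f integrable_on {0..?b}"
      using ab by (intro integrable_continuous_real continuous_on_subset[OF f]) auto
    then have "integral {0..?a} f + integral {?a..?b} f = integral {0..?b} f"
      using ab by (intro Henstock_Kurzweil_Integration.integral_combine) auto
    moreover have "integral {?a..?b} f \<le> B" by (rule piece[OF ab])
    ultimately show ?case using Suc by (simp add: distrib_right)
  qed simp
  from this[of N] show ?thesis using N by simp
qed

section \<open>Duality in space-time\<close>

text \<open>
  The weights \<open>1 / q\<close>, \<open>1 / q\<close>, \<open>1 - 2 / q\<close> are those of the three-function Hoelder inequality behind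
  Young's convolution inequality.
\<close>

lemma am_gm_three:
  fixes x y z q :: real
  assumes "0 < x" "0 < y" "0 < z" "2 \<le> q"
  shows "x powr (1 / q) * y powr (1 / q) * z powr (1 - 2 / q) \<le> x / q + y / q + (1 - 2 / q) * z"
proof -
  have "x powr (1 / q) * y powr (1 / q) = sqrt (x * y) powr (2 / q)"
    using assms by (simp add: powr_half_sqrt[symmetric] powr_powr powr_mult)
  moreover have "sqrt (x * y) powr (2 / q) * z powr (1 - 2 / q) \<le> 2 / q * sqrt (x * y) + (1 - 2 / q) * z"
    using assms by (intro Youngs_inequality_0) auto
  moreover have "2 / q * sqrt (x * y) \<le> 2 / q * ((x + y) / 2)"
    using assms arith_geo_mean_sqrt[of x y] by (intro mult_left_mono) auto
  ultimately show ?thesis by (simp add: add_divide_distrib)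
qed

text \<open>
  Young's inequality bounds the bilinear form with kernel \<open>\<kappa>\<^sup>2\<^sup>/\<^sup>q\<close> by the norm of the kernel in
  \<open>L\<^sup>q\<^sup>/\<^sup>2\<close>. The integrand is, up to the constant on the right-hand side, the product
  \<open>x\<^sup>1\<^sup>/\<^sup>q y\<^sup>1\<^sup>/\<^sup>q z\<^sup>1\<^sup>-\<^sup>2\<^sup>/\<^sup>q\<close> of three normalised quantities, each of which has double
  integral at most one; so the arithmetic-geometric mean inequality gives the claim.
\<close>

lemma young_convolution:
  fixes n \<kappa> :: "real \<Rightarrow> real"
  assumes ab: "a < b" and q: "2 \<le> q"
    and n: "continuous_on {a..b} n" "\<And>t. t \<in> {a..b} \<Longrightarrow> 0 < n t"
    and \<kappa>: "continuous_on UNIV \<kappa>" "\<And>\<tau>. 0 < \<kappa> \<tau>" "\<And>\<tau>. \<kappa> (- \<tau>) = \<kappa> \<tau>"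
    and K: "\<And>t. t \<in> {a..b} \<Longrightarrow> integral {a..b} (\<lambda>s. \<kappa> (t - s)) \<le> K"
  shows "integral {a..b} (\<lambda>t. integral {a..b}
      (\<lambda>s. \<kappa> (t - s) powr (2 / q) * (n t powr (q - 1) * n s powr (q - 1))))
    \<le> K powr (2 / q) * integral {a..b} (\<lambda>t. n t powr q) powr (2 - 2 / q)"
proof -
  define I where "I = integral {a..b} (\<lambda>t. n t powr q)"
  have q0: "q > 0" using q by simp
  have nq: "continuous_on {a..b} (\<lambda>t. n t powr q)" for q
    using n by (intro continuous_on_powr' continuous_intros) force+
  have \<kappa>2: "continuous_on A (\<lambda>x. \<kappa> (f x))" if "continuous_on A f" for f and A :: "'z::topological_space set"
    using continuous_on_compose2[OF \<kappa>(1) that] by auto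
  have int: "f integrable_on {a..b}" if "continuous_on {a..b} f" for f :: "real \<Rightarrow> real"
    using that by (rule integrable_continuous_real)
  have I0: "I > 0"
  proof -
    have "I \<ge> 0" unfolding I_def by (intro integral_nonneg int nq) auto
    moreover have "I \<noteq> 0"
    proof
      assume "I = 0"
      then have "n a powr q = 0"
        using integral_eq_0_iff[of a b "\<lambda>t. n t powr q"] nq ab unfolding I_def by auto
      then show False using n(2)[of a] ab by simp
    qed
    ultimately show ?thesis by simp
  qed
  have K0: "K > 0"
  proof -
    have c: "continuous_on {a..b} (\<lambda>s. \<kappa> (a - s))" by (intro \<kappa>2 continuous_intros)
    have "integral {a..b} (\<lambda>s. \<kappa> (a - s)) \<ge> 0"
      using \<kappa>(2) by (intro integral_nonneg int c) (auto intro: less_imp_le)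
    moreover have "integral {a..b} (\<lambda>s. \<kappa> (a - s)) \<noteq> 0"
      using integral_eq_0_iff[OF c ab] \<kappa>(2)[of "a - a"] \<kappa>(2) ab
      by (auto intro: less_imp_le simp: less_le)
    ultimately show ?thesis using K[of a] ab by simp
  qed
  \<comment> \<open>the claimed bound; it restores the normalisation of the three factors in \<open>H\<close>\<close>
  define D where "D = K powr (2 / q) * I powr (2 - 2 / q)"
  have D0: "D > 0" using K0 I0 by (simp add: D_def)
  define H where "H t s = \<kappa> (t - s) * n t powr q / (K * I) / q + \<kappa> (t - s) * n s powr q / (K * I) / q +
      (1 - 2 / q) * (n t powr q * n s powr q / I\<^sup>2)" for t s
  have point: "\<kappa> (t - s) powr (2 / q) * (n t powr (q - 1) * n s powr (q - 1)) \<le> D * H t s"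
    if t: "t \<in> {a..b}" and s: "s \<in> {a..b}" for t s
  proof -
    have pos: "0 < n t" "0 < n s" "0 < \<kappa> (t - s)" using n(2) t s \<kappa>(2) by auto
    let ?x = "\<kappa> (t - s) * n t powr q / (K * I)" and ?y = "\<kappa> (t - s) * n s powr q / (K * I)"
      and ?z = "n t powr q * n s powr q / I\<^sup>2"
    have "D * (?x powr (1 / q) * ?y powr (1 / q) * ?z powr (1 - 2 / q)) =
        \<kappa> (t - s) powr (2 / q) * (n t powr (q - 1) * n s powr (q - 1))"
    proof -
      have "ln (D * (?x powr (1 / q) * ?y powr (1 / q) * ?z powr (1 - 2 / q))) =
          ln (\<kappa> (t - s) powr (2 / q) * (n t powr (q - 1) * n s powr (q - 1)))"
        using pos K0 I0 D0 q0
        by (simp add: D_def ln_mult ln_div ln_powr ln_realpow field_simps)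
      then show ?thesis using pos K0 I0 D0 by (subst (asm) ln_inj_iff) auto
    qed
    moreover have "D * (?x powr (1 / q) * ?y powr (1 / q) * ?z powr (1 - 2 / q)) \<le> D * H t s"
      unfolding H_def using D0 pos K0 I0 q by (intro mult_left_mono am_gm_three) auto
    ultimately show ?thesis by simp
  qed
  define m where "m t = integral {a..b} (\<lambda>s. \<kappa> (t - s) * n s powr q)" for t
  have c\<kappa>: "continuous_on {a..b} (\<lambda>s. \<kappa> (t - s))" for t by (intro \<kappa>2 continuous_intros)
  have nq2: "continuous_on ({a..b} \<times> {a..b}) (\<lambda>x. n (fst x) powr q)"
    "continuous_on ({a..b} \<times> {a..b}) (\<lambda>x. n (snd x) powr q)" for q
    by (rule continuous_on_compose2[OF nq[of q]]; auto intro!: continuous_intros)+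
  have c2: "continuous_on ({a..b} \<times> {a..b}) (\<lambda>(t, s). \<kappa> (t - s) * n s powr q)"
    unfolding case_prod_beta by (intro continuous_intros \<kappa>2 nq2)
  have mc: "continuous_on {a..b} m"
    unfolding m_def using integral_continuous_on_param[of "{a..b}" a b "\<lambda>t s. \<kappa> (t - s) * n s powr q"] c2
    by simp
  have mI: "integral {a..b} m \<le> K * I"
  proof -
    have "integral {a..b} m = integral {a..b} (\<lambda>s. integral {a..b} (\<lambda>t. \<kappa> (t - s) * n s powr q))"
      unfolding m_def
      using integral_swap_continuous[of a a b b "\<lambda>t s. \<kappa> (t - s) * n s powr q"] c2
      by (simp add: cbox_Pair_eq)
    also have "\<dots> = integral {a..b} (\<lambda>s. integral {a..b} (\<lambda>t. \<kappa> (s - t)) * n s powr q)"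
    proof (intro integral_cong)
      fix s
      have "\<kappa> (t - s) = \<kappa> (s - t)" for t using \<kappa>(3)[of "s - t"] by simp
      then show "integral {a..b} (\<lambda>t. \<kappa> (t - s) * n s powr q) = integral {a..b} (\<lambda>t. \<kappa> (s - t)) * n s powr q"
        by simp
    qed
    also have "\<dots> \<le> integral {a..b} (\<lambda>s. K * n s powr q)"
    proof (intro integral_le int)
      have "continuous_on ({a..b} \<times> cbox a b) (\<lambda>(s, t). \<kappa> (s - t))"
        unfolding case_prod_beta by (intro \<kappa>2 continuous_intros)
      from integral_continuous_on_param[OF this]
      show "continuous_on {a..b} (\<lambda>s. integral {a..b} (\<lambda>t. \<kappa> (s - t)) * n s powr q)"
        by (intro continuous_intros nq) simp
      show "continuous_on {a..b} (\<lambda>s. K * n s powr q)" by (intro continuous_intros nq)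
    qed (use K in \<open>auto intro: mult_right_mono\<close>)
    also have "\<dots> = K * I" by (simp add: I_def)
    finally show ?thesis .
  qed
  have inner: "integral {a..b} (\<lambda>s. \<kappa> (t - s) powr (2 / q) * (n t powr (q - 1) * n s powr (q - 1)))
      \<le> D * (n t powr q / I / q + m t / (K * I) / q + (1 - 2 / q) * (n t powr q / I))"
    if t: "t \<in> {a..b}" for t
  proof -
    have "integral {a..b} (\<lambda>s. \<kappa> (t - s) powr (2 / q) * (n t powr (q - 1) * n s powr (q - 1)))
        \<le> integral {a..b} (\<lambda>s. D * H t s)"
    proof (intro integral_le int point t)
      show "continuous_on {a..b} (\<lambda>s. \<kappa> (t - s) powr (2 / q) * (n t powr (q - 1) * n s powr (q - 1)))"
        using \<kappa>(2) by (intro continuous_intros nq continuous_on_powr' c\<kappa>) (auto intro: less_imp_le simp: less_imp_neq[symmetric])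
      show "continuous_on {a..b} (\<lambda>s. D * H t s)"
        unfolding H_def using q0 K0 I0 by (intro continuous_intros nq c\<kappa>) auto
    qed
    also have "integral {a..b} (\<lambda>s. D * H t s) = D * (integral {a..b} (\<lambda>s. \<kappa> (t - s)) * (n t powr q / (K * I) / q) +
        m t / (K * I) / q + (1 - 2 / q) * (n t powr q / I\<^sup>2 * I))"
    proof (rule integral_unique)
      have "((\<lambda>s. \<kappa> (t - s)) has_integral integral {a..b} (\<lambda>s. \<kappa> (t - s))) {a..b}"
        by (intro integrable_integral int c\<kappa>)
      moreover have "((\<lambda>s. \<kappa> (t - s) * n s powr q) has_integral m t) {a..b}"
        unfolding m_def by (intro integrable_integral int continuous_intros nq c\<kappa>)
      moreover have "((\<lambda>s. n s powr q) has_integral I) {a..b}"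
        unfolding I_def by (intro integrable_integral int nq)
      ultimately have "((\<lambda>s. D * (\<kappa> (t - s) * (n t powr q / (K * I) / q) + \<kappa> (t - s) * n s powr q / (K * I) / q +
          (1 - 2 / q) * (n t powr q / I\<^sup>2 * n s powr q))) has_integral D * (integral {a..b} (\<lambda>s. \<kappa> (t - s)) * (n t powr q / (K * I) / q) +
        m t / (K * I) / q + (1 - 2 / q) * (n t powr q / I\<^sup>2 * I))) {a..b}"
        by (intro has_integral_mult_right has_integral_add has_integral_mult_left has_integral_divide)
      then show "((\<lambda>s. D * H t s) has_integral D * (integral {a..b} (\<lambda>s. \<kappa> (t - s)) * (n t powr q / (K * I) / q) +
        m t / (K * I) / q + (1 - 2 / q) * (n t powr q / I\<^sup>2 * I))) {a..b}"
        by (simp add: H_def)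
    qed
    also have "\<dots> \<le> D * (K * (n t powr q / (K * I) / q) + m t / (K * I) / q + (1 - 2 / q) * (n t powr q / I\<^sup>2 * I))"
      using D0 K0 I0 q0 K[OF t] by (intro mult_left_mono add_right_mono mult_right_mono) auto
    also have "\<dots> = D * (n t powr q / I / q + m t / (K * I) / q + (1 - 2 / q) * (n t powr q / I))"
      using K0 I0 by (simp add: power2_eq_square)
    finally show ?thesis .
  qed
  have "integral {a..b} (\<lambda>t. integral {a..b}
      (\<lambda>s. \<kappa> (t - s) powr (2 / q) * (n t powr (q - 1) * n s powr (q - 1)))) \<le>
      integral {a..b} (\<lambda>t. D * (n t powr q / I / q + m t / (K * I) / q + (1 - 2 / q) * (n t powr q / I)))"
  proof (intro integral_le int inner)
    have "continuous_on ({a..b} \<times> cbox a b) (\<lambda>(t, s). \<kappa> (t - s) powr (2 / q) * (n t powr (q - 1) * n s powr (q - 1)))"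
      unfolding case_prod_beta cbox_interval using \<kappa>(2)
      by (intro continuous_intros nq2 continuous_on_powr' \<kappa>2) (auto intro: less_imp_le simp: less_imp_neq[symmetric])
    from integral_continuous_on_param[OF this]
    show "continuous_on {a..b} (\<lambda>t. integral {a..b} (\<lambda>s. \<kappa> (t - s) powr (2 / q) * (n t powr (q - 1) * n s powr (q - 1))))"
      by simp
    show "continuous_on {a..b} (\<lambda>t. D * (n t powr q / I / q + m t / (K * I) / q + (1 - 2 / q) * (n t powr q / I)))"
      using q0 K0 I0 by (intro continuous_intros nq mc) auto
  qed
  also have "\<dots> = D * (I / I / q + integral {a..b} m / (K * I) / q + (1 - 2 / q) * (I / I))"
  proof (rule integral_unique)
    have "((\<lambda>s. n s powr q) has_integral I) {a..b}"
      unfolding I_def by (intro integrable_integral int nq)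
    moreover have "(m has_integral integral {a..b} m) {a..b}"
      by (intro integrable_integral int mc)
    ultimately show "((\<lambda>t. D * (n t powr q / I / q + m t / (K * I) / q + (1 - 2 / q) * (n t powr q / I)))
        has_integral D * (I / I / q + integral {a..b} m / (K * I) / q + (1 - 2 / q) * (I / I))) {a..b}"
      by (intro has_integral_mult_right has_integral_add has_integral_divide)
  qed
  also have "\<dots> \<le> D * (1 / q + 1 / q + (1 - 2 / q))"
    using D0 I0 K0 q0 mI
    by (intro mult_left_mono add_right_mono add_mono divide_right_mono mult_left_mono) (auto simp: field_simps)
  also have "\<dots> = D" by simp
  finally show ?thesis by (simp add: D_def I_def)
qed

definition evolve :: "'k set \<Rightarrow> ('k \<Rightarrow> 'a \<Rightarrow> complex) \<Rightarrow> ('k \<Rightarrow> real) \<Rightarrow> ('k \<Rightarrow> complex) \<Rightarrow> real \<Rightarrow> 'a \<Rightarrow> complex"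
  where "evolve S e \<omega> c t m = (\<Sum>k\<in>S. c k * e k m * cis (- (\<omega> k * t)))"

text \<open>
  The adjoint of \<open>c \<mapsto> evolve S e \<omega> c t\<close> if every point of \<open>X\<close> has mass \<open>w\<close>; see
  \<open>evolve_adjoint_pairing\<close>.
\<close>

definition evolve_adjoint ::
  "'a set \<Rightarrow> real \<Rightarrow> ('k \<Rightarrow> 'a \<Rightarrow> complex) \<Rightarrow> ('k \<Rightarrow> real) \<Rightarrow> real \<Rightarrow> ('a \<Rightarrow> complex) \<Rightarrow> 'k \<Rightarrow> complex"
  where "evolve_adjoint X w e \<omega> t f k = w * (\<Sum>m\<in>X. f m * cnj (e k m) * cis (\<omega> k * t))"

lemma evolve_adjoint_pairing:
  "(\<Sum>k\<in>S. c k * cnj (evolve_adjoint X w e \<omega> t f k)) = w * (\<Sum>m\<in>X. evolve S e \<omega> c t m * cnj (f m))"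
proof -
  have "(\<Sum>k\<in>S. c k * cnj (evolve_adjoint X w e \<omega> t f k)) =
      (\<Sum>k\<in>S. \<Sum>m\<in>X. w * (c k * e k m * cis (- (\<omega> k * t)) * cnj (f m)))"
    by (simp add: evolve_adjoint_def sum_distrib_left sum_distrib_right cis_cnj algebra_simps)
  also have "\<dots> = (\<Sum>m\<in>X. \<Sum>k\<in>S. w * (c k * e k m * cis (- (\<omega> k * t)) * cnj (f m)))"
    by (rule sum.swap)
  finally show ?thesis by (simp add: evolve_def sum_distrib_left sum_distrib_right)
qed

lemma continuous_on_evolve: "continuous_on A (\<lambda>t. evolve S e \<omega> c t m)"
  unfolding evolve_def cis_conv_exp by (intro continuous_intros)

lemma continuous_on_Lp_norm:
  assumes "\<And>m. continuous_on A (\<lambda>t. f t m)" "0 \<le> w" "0 < r"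
  shows "continuous_on A (\<lambda>t. Lp_norm X w r (f t))"
  unfolding Lp_norm_def
  using assms by (intro continuous_on_powr' continuous_intros) (auto simp: sum_nonneg)

text \<open>
  The space-time norm is tested against its dual function \<open>F\<close>, which satisfies
  \<open>\<langle>u t, F t\<rangle> = \<parallel>u t\<parallel>\<^sub>r\<^sup>q\<close> and \<open>\<parallel>F t\<parallel>\<^sub>p = \<parallel>u t\<parallel>\<^sub>r\<^sup>q\<^sup>-\<^sup>1\<close> for the exponent \<open>p\<close> dual to \<open>r\<close>.
  Cauchy-Schwarz in the coefficients leaves the square of \<open>G = \<integral> (adjoint at t) (F t) dt\<close>, a double
  integral over times in which the dispersive bound and then Young's inequality are used. The
  solution does not vanish at any time, so \<open>F\<close> is continuous even if \<open>q < r\<close>.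
\<close>

lemma TT_star:
  fixes e :: "'k \<Rightarrow> 'a \<Rightarrow> complex" and \<omega> :: "'k \<Rightarrow> real" and q r w C K a b :: real
  assumes fin: "finite X" "finite S" and w: "0 < w" and ab: "a < b"
    and q: "2 \<le> q" and r: "2 < r" and C: "0 \<le> C"
    and \<kappa>: "continuous_on UNIV \<kappa>" "\<And>\<tau>. 0 < \<kappa> \<tau>" "\<And>\<tau>. \<kappa> (- \<tau>) = \<kappa> \<tau>"
    and K: "\<And>t. t \<in> {a..b} \<Longrightarrow> integral {a..b} (\<lambda>s. \<kappa> (t - s)) \<le> K"
    and dispersive: "\<And>t s f g. t \<in> {a..b} \<Longrightarrow> s \<in> {a..b} \<Longrightarrow>
      cmod (\<Sum>k\<in>S. evolve_adjoint X w e \<omega> t f k * cnj (evolve_adjoint X w e \<omega> s g k))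
      \<le> C * \<kappa> (t - s) powr (2 / q) * (Lp_norm X w (r / (r - 1)) f * Lp_norm X w (r / (r - 1)) g)"
    and nonzero: "\<And>t. t \<in> {a..b} \<Longrightarrow> \<exists>m\<in>X. evolve S e \<omega> c t m \<noteq> 0"
  shows "integral {a..b} (\<lambda>t. Lp_norm X w r (evolve S e \<omega> c t) powr q)
    \<le> (sqrt C * sqrt (\<Sum>k\<in>S. (cmod (c k))\<^sup>2)) powr q * K"
proof -
  let ?u = "evolve S e \<omega> c"
  define p where "p = r / (r - 1)"
  define n where "n t = Lp_norm X w r (?u t)" for t
  have n0: "0 < n t" if "t \<in> {a..b}" for t
    using nonzero[OF that] Lp_norm_eq_0_iff[OF fin(1) w, of r] Lp_norm_nonneg[of X w r] r
    unfolding n_def by (metis less_le not_numeral_less_zero)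
  have nc: "continuous_on {a..b} n"
    unfolding n_def using w r by (intro continuous_on_Lp_norm continuous_on_evolve) auto
  have np: "continuous_on {a..b} (\<lambda>t. n t powr z)" for z
    using n0 nc by (intro continuous_on_powr' continuous_intros) force+
  \<comment> \<open>the dual function of \<open>u\<close> in \<open>L\<^sup>q\<close> in time and \<open>L\<^sup>r\<close> in space\<close>
  define F where "F t m = n t powr (q - r) * cmod (?u t m) powr (r - 2) * ?u t m" for t m
  have Fc: "continuous_on {a..b} (\<lambda>t. F t m)" for m
    unfolding F_def using r
    by (intro continuous_intros np continuous_on_powr' continuous_on_evolve) auto
  have cF: "cmod (F t m) = n t powr (q - r) * cmod (?u t m) powr (r - 1)" for t m
  proof -
    have "cmod (?u t m) powr (r - 2) * cmod (?u t m) powr 1 = cmod (?u t m) powr (r - 1)"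
      unfolding powr_add[symmetric] by simp
    then show ?thesis by (simp add: F_def norm_mult)
  qed
  have Fp: "Lp_norm X w p (F t) = n t powr (q - 1)" if t: "t \<in> {a..b}" for t
  proof -
    have "cmod (F t m) powr p = n t powr ((q - r) * p) * cmod (?u t m) powr r" for m
      using r by (simp add: cF powr_mult powr_powr p_def)
    then have "w * (\<Sum>m\<in>X. cmod (F t m) powr p) = n t powr ((q - r) * p) * (w * (\<Sum>m\<in>X. cmod (?u t m) powr r))"
      by (simp add: sum_distrib_left mult.left_commute)
    also have "w * (\<Sum>m\<in>X. cmod (?u t m) powr r) = n t powr r"
      unfolding n_def using w r by (subst Lp_norm_powr) auto
    also have "n t powr ((q - r) * p) * n t powr r = n t powr ((q - 1) * p)"
    proof -
      have "(q - r) * p + r = (q - 1) * p" using r by (simp add: p_def field_simps)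
      then show ?thesis by (simp flip: powr_add)
    qed
    finally show ?thesis using r by (simp add: Lp_norm_def powr_powr p_def)
  qed
  define g where "g k t = evolve_adjoint X w e \<omega> t (F t) k" for k t
  have gc: "continuous_on {a..b} (g k)" for k
    unfolding g_def evolve_adjoint_def cis_conv_exp by (intro continuous_intros Fc)
  have g_int: "(g k has_integral integral {a..b} (g k)) {a..b}" for k
    by (intro integrable_integral integrable_continuous_real gc)
  define G where "G k = integral {a..b} (g k)" for k
  define I where "I = integral {a..b} (\<lambda>t. n t powr q)"
  have pair: "(\<Sum>k\<in>S. c k * cnj (g k t)) = of_real (n t powr q)" if t: "t \<in> {a..b}" for t
  proof -
    have "?u t m * cnj (F t m) = of_real (n t powr (q - r) * cmod (?u t m) powr r)" for m
    proof -
      have "?u t m * cnj (F t m) = of_real (n t powr (q - r) * cmod (?u t m) powr (r - 2)) * (?u t m * cnj (?u t m))"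
        by (simp add: F_def)
      also have "?u t m * cnj (?u t m) = of_real (cmod (?u t m) powr 2)"
        by (simp add: complex_norm_square[symmetric] powr_numeral)
      also have "of_real (n t powr (q - r) * cmod (?u t m) powr (r - 2)) * complex_of_real (cmod (?u t m) powr 2)
          = of_real (n t powr (q - r) * (cmod (?u t m) powr (r - 2) * cmod (?u t m) powr 2))"
        by simp
      also have "cmod (?u t m) powr (r - 2) * cmod (?u t m) powr 2 = cmod (?u t m) powr r"
        unfolding powr_add[symmetric] by simp
      finally show ?thesis .
    qed
    then have "(\<Sum>k\<in>S. c k * cnj (g k t)) = of_real (w * (\<Sum>m\<in>X. n t powr (q - r) * cmod (?u t m) powr r))"
      unfolding g_def evolve_adjoint_pairing by simp
    also have "w * (\<Sum>m\<in>X. n t powr (q - r) * cmod (?u t m) powr r) =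
        n t powr (q - r) * (w * (\<Sum>m\<in>X. cmod (?u t m) powr r))"
      by (simp add: sum_distrib_left mult.left_commute)
    also have "w * (\<Sum>m\<in>X. cmod (?u t m) powr r) = n t powr r"
      unfolding n_def using w r by (subst Lp_norm_powr) auto
    also have "n t powr (q - r) * n t powr r = n t powr q" unfolding powr_add[symmetric] by simp
    finally show ?thesis .
  qed
  have cG: "of_real I = (\<Sum>k\<in>S. c k * cnj (G k))"
  proof -
    have "((\<lambda>t. \<Sum>k\<in>S. c k * cnj (g k t)) has_integral (\<Sum>k\<in>S. c k * cnj (G k))) {a..b}"
    proof (intro has_integral_sum has_integral_mult_right fin)
      show "((\<lambda>t. cnj (g k t)) has_integral cnj (G k)) {a..b}" for k
        using has_integral_cnj[of "g k" "G k" "{a..b}"] g_int[of k] by (simp add: G_def o_def)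
    qed
    then have "((\<lambda>t. complex_of_real (n t powr q)) has_integral (\<Sum>k\<in>S. c k * cnj (G k))) {a..b}"
      by (rule has_integral_eq[rotated]) (use pair in auto)
    moreover have "((\<lambda>t. complex_of_real (n t powr q)) has_integral of_real I) {a..b}"
      unfolding I_def by (intro has_integral_of_real integrable_integral integrable_continuous_real np)
    ultimately show ?thesis using has_integral_unique by blast
  qed
  define E where "E = sqrt (\<Sum>k\<in>S. (cmod (c k))\<^sup>2)"
  have E0: "E \<ge> 0" by (simp add: E_def sum_nonneg)
  have I0: "I \<ge> 0" unfolding I_def by (intro integral_nonneg integrable_continuous_real np) auto
  have IE: "I \<le> E * sqrt (\<Sum>k\<in>S. (cmod (G k))\<^sup>2)"
  proof -
    have "I = cmod (\<Sum>k\<in>S. c k * cnj (G k))" unfolding cG[symmetric] using I0 by simp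
    also have "\<dots> \<le> (\<Sum>k\<in>S. \<bar>cmod (c k)\<bar> * \<bar>cmod (G k)\<bar>)"
      using norm_sum[of "\<lambda>k. c k * cnj (G k)" S] by (simp add: norm_mult)
    also have "\<dots> \<le> L2_set (\<lambda>k. cmod (c k)) S * L2_set (\<lambda>k. cmod (G k)) S"
      by (rule L2_set_mult_ineq)
    finally show ?thesis by (simp add: L2_set_def E_def)
  qed
  have G2: "(\<Sum>k\<in>S. (cmod (G k))\<^sup>2) \<le> C * (K powr (2 / q) * I powr (2 - 2 / q))"
  proof -
    let ?k = "\<lambda>t s. \<kappa> (t - s) powr (2 / q) * (n t powr (q - 1) * n s powr (q - 1))"
    have np2: "continuous_on ({a..b} \<times> {a..b}) (\<lambda>x. n (fst x) powr z)"
      "continuous_on ({a..b} \<times> {a..b}) (\<lambda>x. n (snd x) powr z)" for z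
      by (rule continuous_on_compose2[OF np[of z]]; auto intro!: continuous_intros)+
    have \<kappa>2: "continuous_on A (\<lambda>x. \<kappa> (f x))" if "continuous_on A f" for f and A :: "'z::topological_space set"
      using continuous_on_compose2[OF \<kappa>(1) that] by auto
    have kc: "continuous_on ({a..b} \<times> {a..b}) (\<lambda>(t, s). ?k t s)"
      unfolding case_prod_beta using \<kappa>(2)
      by (intro continuous_intros np2 continuous_on_powr' \<kappa>2) (auto intro: less_imp_le simp: less_imp_neq[symmetric])
    have kc1: "continuous_on {a..b} (?k t)" for t
      using \<kappa>(2)
      by (intro continuous_intros np continuous_on_powr' \<kappa>2) (auto intro: less_imp_le simp: less_imp_neq[symmetric])
    have inner: "cmod (\<Sum>k\<in>S. g k t * cnj (G k)) \<le> C * integral {a..b} (?k t)" if t: "t \<in> {a..b}" for t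
    proof -
      have "((\<lambda>s. \<Sum>k\<in>S. g k t * cnj (g k s)) has_integral (\<Sum>k\<in>S. g k t * cnj (G k))) {a..b}"
      proof (intro has_integral_sum has_integral_mult_right fin)
        show "((\<lambda>s. cnj (g k s)) has_integral cnj (G k)) {a..b}" for k
          using has_integral_cnj[of "g k" "G k" "{a..b}"] g_int[of k] by (simp add: G_def o_def)
      qed
      then have "cmod (\<Sum>k\<in>S. g k t * cnj (G k)) = cmod (integral {a..b} (\<lambda>s. \<Sum>k\<in>S. g k t * cnj (g k s)))"
        by (simp add: integral_unique)
      also have "\<dots> \<le> integral {a..b} (\<lambda>s. C * ?k t s)"
      proof (rule Henstock_Kurzweil_Integration.integral_norm_bound_integral)
        show "(\<lambda>s. \<Sum>k\<in>S. g k t * cnj (g k s)) integrable_on {a..b}"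
          by (intro integrable_continuous_real continuous_intros gc)
        show "(\<lambda>s. C * ?k t s) integrable_on {a..b}"
          by (intro integrable_continuous_real continuous_on_mult_left kc1)
        fix s assume s: "s \<in> {a..b}"
        show "cmod (\<Sum>k\<in>S. g k t * cnj (g k s)) \<le> C * ?k t s"
          using dispersive[OF t s, of "F t" "F s"] Fp[OF t] Fp[OF s] by (simp add: g_def p_def mult.assoc)
      qed
      finally show ?thesis by simp
    qed
    have int: "((\<lambda>t. \<Sum>k\<in>S. g k t * cnj (G k)) has_integral (\<Sum>k\<in>S. G k * cnj (G k))) {a..b}"
      using g_int by (intro has_integral_sum has_integral_mult_left fin) (simp add: G_def)
    have "(\<Sum>k\<in>S. (cmod (G k))\<^sup>2) = cmod (\<Sum>k\<in>S. G k * cnj (G k))"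
    proof -
      have "(\<Sum>k\<in>S. G k * cnj (G k)) = of_real (\<Sum>k\<in>S. (cmod (G k))\<^sup>2)"
        unfolding of_real_sum by (rule sum.cong) (simp_all only: complex_norm_square)
      then show ?thesis by (simp only: norm_of_real abs_of_nonneg sum_nonneg zero_le_power2)
    qed
    also have "\<dots> = cmod (integral {a..b} (\<lambda>t. \<Sum>k\<in>S. g k t * cnj (G k)))"
      using integral_unique[OF int] by simp
    also have "\<dots> \<le> integral {a..b} (\<lambda>t. C * integral {a..b} (?k t))"
    proof (rule Henstock_Kurzweil_Integration.integral_norm_bound_integral[OF _ _ inner])
      show "(\<lambda>t. \<Sum>k\<in>S. g k t * cnj (G k)) integrable_on {a..b}" using int by blast
      have "continuous_on {a..b} (\<lambda>t. integral {a..b} (?k t))"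
        using integral_continuous_on_param[of "{a..b}" a b ?k] kc by simp
      then show "(\<lambda>t. C * integral {a..b} (?k t)) integrable_on {a..b}"
        by (intro integrable_continuous_real continuous_on_mult_left)
    qed
    also have "\<dots> = C * integral {a..b} (\<lambda>t. integral {a..b} (?k t))" by simp
    also have "\<dots> \<le> C * (K powr (2 / q) * I powr (2 - 2 / q))"
      unfolding I_def using young_convolution[OF ab q nc n0 \<kappa> K] C by (intro mult_left_mono)
    finally show ?thesis .
  qed
  have K0: "0 \<le> K"
  proof -
    have "continuous_on {a..b} (\<lambda>s. \<kappa> (a - s))"
      by (rule continuous_on_compose2[OF \<kappa>(1)]) (auto intro!: continuous_intros)
    then have "0 \<le> integral {a..b} (\<lambda>s. \<kappa> (a - s))"
      using \<kappa>(2) by (intro integral_nonneg integrable_continuous_real) (auto intro: less_imp_le)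
    then show ?thesis using K[of a] ab by simp
  qed
  show ?thesis
  proof (cases "I = 0")
    case True
    then show ?thesis using K0 by (simp add: I_def n_def)
  next
    case False
    then have I0: "I > 0" using I0 by simp
    have "I \<le> E * sqrt (C * (K powr (2 / q) * I powr (2 - 2 / q)))"
      using IE G2 E0 by (meson mult_left_mono order_trans real_sqrt_le_mono)
    also have "sqrt (C * (K powr (2 / q) * I powr (2 - 2 / q))) = sqrt C * (K powr (1 / q) * I powr (1 - 1 / q))"
      by (simp add: real_sqrt_mult powr_half_sqrt[symmetric] powr_powr powr_mult diff_divide_distrib)
    finally have "I \<le> E * sqrt C * K powr (1 / q) * I powr (1 - 1 / q)" by (simp add: mult.assoc)
    also have "I powr (1 - 1 / q) = I / I powr (1 / q)" using I0 by (simp add: powr_diff)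
    finally have "I powr (1 / q) \<le> E * sqrt C * K powr (1 / q)"
      using I0 by (simp add: field_simps)
    then have "(I powr (1 / q)) powr q \<le> (E * sqrt C * K powr (1 / q)) powr q"
      using q by (intro powr_mono2) auto
    then have "I \<le> (E * sqrt C) powr q * (K powr (1 / q)) powr q"
      using q I0 by (simp add: powr_powr powr_mult)
    then show ?thesis using q K0 by (simp add: powr_powr I_def n_def E_def mult.commute)
  qed
qed

section \<open>Fourier analysis on the periodic lattice\<close>

text \<open>
  The kernel of a frequency box and the orthogonality relations both reduce to one dimension by
  this factorisation.
\<close>

lemma sum_box_prod:
  fixes f :: "'d::finite \<Rightarrow> int \<Rightarrow> complex"
  assumes "finite A"
  shows "(\<Sum>k | \<forall>j. k $ j \<in> A. \<Prod>j\<in>UNIV. f j (k $ j)) = (\<Prod>j\<in>UNIV. \<Sum>a\<in>A. f j a)"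
proof -
  have "(\<Prod>j\<in>UNIV. \<Sum>a\<in>A. f j a) = (\<Sum>g\<in>UNIV \<rightarrow>\<^sub>E A. \<Prod>j\<in>UNIV. f j (g j))"
    using assms by (intro prod_sum_PiE) auto
  also have "\<dots> = (\<Sum>k | \<forall>j. k $ j \<in> A. \<Prod>j\<in>UNIV. f j (k $ j))"
    by (rule sum.reindex_bij_witness[of _ vec_nth vec_lambda]) auto
  finally show ?thesis by simp
qed

lemma cis_sum: "cis (\<Sum>j\<in>A. f j) = (\<Prod>j\<in>A. cis (f j))"
  by (induction A rule: infinite_finite_induct) (auto simp flip: cis_mult)

definition mode :: "nat \<Rightarrow> int ^ 'd::finite \<Rightarrow> int ^ 'd \<Rightarrow> complex" where
  "mode M k m = cis (mesh M * (\<Sum>j\<in>UNIV. real_of_int (k $ j) * real_of_int (m $ j)))"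

definition laplacian_symbol :: "nat \<Rightarrow> int ^ 'd::finite \<Rightarrow> real" where
  "laplacian_symbol M k = (\<Sum>j\<in>UNIV. (2 - 2 * cos (mesh M * real_of_int (k $ j))) / (mesh M)\<^sup>2)"

lemma mode_commute: "mode M k m = mode M m k"
  by (simp add: mode_def mult.commute)

lemma exp_eq_mode: "exp (\<i> * of_real (real_vec k \<bullet> lattice_point M m)) = mode M k m"
  by (simp add: mode_def cis_conv_exp real_vec_def lattice_point_def inner_vec_def
      sum_distrib_left mult.left_commute)

lemma exp_minus_eq_cnj_mode:
  "exp (- \<i> * of_real (real_vec k \<bullet> lattice_point M m)) = cnj (mode M k m)"
  unfolding exp_eq_mode[symmetric] by (simp add: exp_cnj)

lemma mesh_pos: "M > 0 \<Longrightarrow> mesh M > 0"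
  by (simp add: mesh_def)

lemma mesh_le_pi: "M > 0 \<Longrightarrow> mesh M \<le> pi"
  by (simp add: mesh_def field_simps)

lemma mode_add: "mode M k (m + v) = mode M k m * mode M k v"
  by (simp add: mode_def cis_mult distrib_left sum.distrib)

lemma mode_axis: "mode M k (axis j a) = cis (mesh M * (real_of_int (k $ j) * real_of_int a))"
proof -
  have "(\<Sum>i\<in>UNIV. real_of_int (k $ i) * real_of_int (axis j a $ i)) =
      (\<Sum>i\<in>UNIV. if i = j then real_of_int (k $ i) * real_of_int a else 0)"
    by (rule sum.cong) (auto simp: axis_def)
  then show ?thesis by (simp add: mode_def)
qed

lemma mode_period:
  assumes "M > 0"
  shows "lattice_fun M (mode M k)"
proof -
  have "mode M k (axis j (2 * int M)) = 1" for j
  proof -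
    have "mesh M * (real_of_int (k $ j) * real_of_int (2 * int M)) = 2 * pi * real_of_int (k $ j)"
      using assms by (simp add: mesh_def)
    then show ?thesis unfolding mode_axis by (simp only: cis_multiple_2pi Ints_of_int)
  qed
  then show ?thesis by (simp add: lattice_fun_def mode_add)
qed

lemma mode_shift_period: "M > 0 \<Longrightarrow> mode M k (m + axis j (2 * int M)) = mode M k m"
  using mode_period[of M k] by (simp add: lattice_fun_def)

lemma laplacian_mode:
  assumes "M > 0"
  shows "lattice_laplacian M (mode M k) m = - of_real (laplacian_symbol M k) * mode M k m"
proof -
  have "mode M k (m + axis j 1) + mode M k (m - axis j 1) - 2 * mode M k m =
      - of_real (2 - 2 * cos (mesh M * real_of_int (k $ j))) * mode M k m" for j
  proof -
    let ?y = "mesh M * real_of_int (k $ j)"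
    have minus: "m - axis j 1 = m + axis j (- 1)" by (simp add: vec_eq_iff axis_def)
    have "mode M k (m + axis j 1) + mode M k (m - axis j 1) - 2 * mode M k m =
        (cis ?y + cis (- ?y) - 2) * mode M k m"
      unfolding minus mode_add mode_axis by (simp add: algebra_simps)
    also have "cis ?y + cis (- ?y) = of_real (2 * cos ?y)"
      by (simp add: complex_eq_iff)
    finally show ?thesis by simp
  qed
  then show ?thesis
    by (simp add: lattice_laplacian_def laplacian_symbol_def sum_distrib_right sum_negf
        of_real_sum del: of_real_diff of_real_mult)
qed

lemma lattice_laplacian_add_scaled:
  "lattice_laplacian M (\<lambda>m. a * f m + g m) m = a * lattice_laplacian M f m + lattice_laplacian M g m"
  unfolding lattice_laplacian_def sum_distrib_left sum.distrib[symmetric]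
  by (rule sum.cong) (simp_all add: algebra_simps add_divide_distrib diff_divide_distrib)

lemma lattice_laplacian_sum:
  "lattice_laplacian M (\<lambda>m. \<Sum>k\<in>R. a k * f k m) m = (\<Sum>k\<in>R. a k * lattice_laplacian M (f k) m)"
proof (induction R rule: infinite_finite_induct)
  case (insert k R)
  then show ?case by (simp add: lattice_laplacian_add_scaled)
qed (simp_all add: lattice_laplacian_def)

text \<open>
  The sum runs over a full period, so a shift by one multiplies it by \<open>cis (h n)\<close> and yet leaves it
  unchanged.
\<close>

lemma cis_int_sum:
  assumes M: "M > 0" and n: "\<bar>n\<bar> < 2 * int M"
  shows "(\<Sum>a\<in>{- int M..int M - 1}. cis (mesh M * (real_of_int n * real_of_int a))) =
    (if n = 0 then of_nat (2 * M) else 0)"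
proof (cases "n = 0")
  case False
  let ?f = "\<lambda>a. cis (mesh M * (real_of_int n * real_of_int a))"
  define z where "z = cis (mesh M * real_of_int n)"
  have step: "?f (a + 1) = z * ?f a" for a
    by (simp add: z_def cis_mult distrib_left add.commute)
  have "z \<noteq> 1"
  proof
    assume "z = 1"
    then have "cos (mesh M * real_of_int n) = 1" by (simp add: z_def complex_eq_iff)
    then obtain i :: int where "mesh M * real_of_int n = of_int i * 2 * pi"
      unfolding cos_one_2pi_int by blast
    then have "real_of_int n = real_of_int (2 * i * int M)" using M by (simp add: mesh_def field_simps)
    then have "n = 2 * int M * i" by (simp only: of_int_eq_iff) simp
    moreover from this False have "1 \<le> \<bar>i\<bar>" by auto
    then have "2 * int M * 1 \<le> 2 * int M * \<bar>i\<bar>" by (intro mult_left_mono) auto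
    ultimately show False using n by (simp add: abs_mult)
  qed
  have "z * (\<Sum>a\<in>{- int M..int M - 1}. ?f a) = (\<Sum>a\<in>{- int M..int M - 1}. ?f (a + 1))"
    unfolding step sum_distrib_left ..
  also have "\<dots> = (\<Sum>a\<in>{- int M + 1..int M}. ?f a)"
    by (rule sum.reindex_bij_witness[of _ "\<lambda>a. a - 1" "\<lambda>a. a + 1"]) auto
  also have "\<dots> = (\<Sum>a\<in>{- int M..int M - 1}. ?f a)"
  proof -
    have "{- int M + 1..int M} = insert (int M) {- int M + 1..int M - 1}"
      "{- int M..int M - 1} = insert (- int M) {- int M + 1..int M - 1}" using M by auto
    moreover have "?f (int M) = ?f (- int M)"
    proof -
      have "?f (int M) = ?f (- int M) * cis (2 * pi * of_int n)"
        using M unfolding cis_mult by (simp add: mesh_def)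
      then show ?thesis by (simp add: cis_multiple_2pi)
    qed
    ultimately show ?thesis by simp
  qed
  finally have "(z - 1) * (\<Sum>a\<in>{- int M..int M - 1}. ?f a) = 0" by (simp add: algebra_simps)
  then show ?thesis using \<open>z \<noteq> 1\<close> False by simp
qed simp

lemma mode_orthogonal:
  fixes k l :: "int ^ 'd::finite"
  assumes M: "M > 0" and k: "k \<in> representatives M" and l: "l \<in> representatives M"
  shows "(\<Sum>m\<in>representatives M. mode M k m * cnj (mode M l m)) =
    (if k = l then of_nat (2 * M) ^ CARD('d) else 0)"
proof -
  let ?n = "\<lambda>j. k $ j - l $ j"
  have n: "\<bar>?n j\<bar> < 2 * int M" for j
    using k[unfolded representatives_def, simplified, rule_format, of j]
      l[unfolded representatives_def, simplified, rule_format, of j] by linarith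
  have "mode M k m * cnj (mode M l m) =
      (\<Prod>j\<in>UNIV. cis (mesh M * (real_of_int (?n j) * real_of_int (m $ j))))" for m
  proof -
    have "mode M k m * cnj (mode M l m) = cis (mesh M * (\<Sum>j\<in>UNIV. real_of_int (k $ j) * real_of_int (m $ j)) -
        mesh M * (\<Sum>j\<in>UNIV. real_of_int (l $ j) * real_of_int (m $ j)))"
      by (simp add: mode_def cis_cnj cis_mult)
    also have "\<dots> = cis (\<Sum>j\<in>UNIV. mesh M * (real_of_int (?n j) * real_of_int (m $ j)))"
      by (simp add: sum_distrib_left sum_subtractf algebra_simps)
    finally show ?thesis by (simp only: cis_sum)
  qed
  then have "(\<Sum>m\<in>representatives M. mode M k m * cnj (mode M l m)) =
      (\<Prod>j\<in>UNIV. \<Sum>a\<in>{- int M..int M - 1}. cis (mesh M * (real_of_int (?n j) * real_of_int a)))"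
    unfolding representatives_def
    by (simp only:) (rule sum_box_prod, rule finite_atLeastAtMost_int)
  also have "\<dots> = (\<Prod>j\<in>(UNIV::'d set). if ?n j = 0 then of_nat (2 * M) else 0)"
    using cis_int_sum[OF M n] by (intro prod.cong) auto
  also have "\<dots> = (if k = l then of_nat (2 * M) ^ CARD('d) else 0)"
  proof (cases "k = l")
    case False
    then obtain j where "k $ j \<noteq> l $ j" by (auto simp: vec_eq_iff)
    then show ?thesis using False by (auto intro!: prod_zero)
  qed simp
  finally show ?thesis .
qed

lemma mode_Parseval:
  fixes a :: "int ^ 'd::finite \<Rightarrow> complex"
  assumes M: "M > 0" and S: "S \<subseteq> representatives M"
  shows "(\<Sum>m\<in>representatives M. (cmod (\<Sum>k\<in>S. a k * mode M k m))\<^sup>2) =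
    real (2 * M) ^ CARD('d) * (\<Sum>k\<in>S. (cmod (a k))\<^sup>2)"
proof -
  have fS: "finite S" using S finite_subset finite_representatives by blast
  let ?R = "representatives M :: (int ^ 'd) set"
  have "complex_of_real (\<Sum>m\<in>?R. (cmod (\<Sum>k\<in>S. a k * mode M k m))\<^sup>2) =
      (\<Sum>m\<in>?R. \<Sum>k\<in>S. \<Sum>l\<in>S. a k * cnj (a l) * (mode M k m * cnj (mode M l m)))"
    unfolding of_real_sum complex_norm_square
    by (simp add: sum_product mult.assoc mult.left_commute)
  also have "\<dots> = (\<Sum>k\<in>S. \<Sum>l\<in>S. a k * cnj (a l) * (\<Sum>m\<in>?R. mode M k m * cnj (mode M l m)))"
    by (subst sum.swap, rule sum.cong[OF refl], subst sum.swap) (simp add: sum_distrib_left)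
  also have "\<dots> = (\<Sum>k\<in>S. \<Sum>l\<in>S. if k = l then a k * cnj (a l) * of_nat (2 * M) ^ CARD('d) else 0)"
    using S by (intro sum.cong refl) (subst mode_orthogonal[OF M]; auto)
  also have "\<dots> = (\<Sum>k\<in>S. a k * cnj (a k) * of_nat (2 * M) ^ CARD('d))"
    using fS by (simp add: sum.delta)
  also have "\<dots> = complex_of_real (real (2 * M) ^ CARD('d) * (\<Sum>k\<in>S. (cmod (a k))\<^sup>2))"
    unfolding of_real_mult of_real_sum complex_norm_square
    by (simp add: sum_distrib_right mult.commute)
  finally show ?thesis unfolding of_real_eq_iff .
qed

lemma mesh_volume: 
  assumes "M > 0"
  shows "mesh M ^ d * real (2 * M) ^ d = (2 * pi) ^ d"
  unfolding power_mult_distrib[symmetric] using assms by (simp add: mesh_def)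

definition fourier_coeff :: "nat \<Rightarrow> (int ^ 'd::finite \<Rightarrow> complex) \<Rightarrow> int ^ 'd \<Rightarrow> complex" where
  "fourier_coeff M u k = lattice_dft M u k / of_real ((2 * pi) ^ CARD('d))"

lemma lattice_idft_eq:
  "lattice_idft M v m = (\<Sum>k\<in>representatives M. v k / of_real ((2 * pi) ^ CARD('d)) * mode M k m)"
  for v :: "int ^ 'd::finite \<Rightarrow> complex"
  unfolding lattice_idft_def exp_eq_mode sum_distrib_left
  by (rule sum.cong) (simp_all add: divide_inverse mult_ac)

lemma fourier_inversion:
  fixes u :: "int ^ 'd::finite \<Rightarrow> complex"
  assumes M: "M > 0" and u: "lattice_fun M u"
  shows "u m = (\<Sum>k\<in>representatives M. fourier_coeff M u k * mode M k m)"
proof -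
  let ?R = "representatives M :: (int ^ 'd) set"
  let ?v = "\<lambda>m. \<Sum>k\<in>?R. fourier_coeff M u k * mode M k m"
  have v: "lattice_fun M ?v"
    by (simp add: lattice_fun_def mode_shift_period[OF M])
  have "u m = ?v m" if m: "m \<in> ?R" for m
  proof -
    define C where "C = complex_of_real (mesh M ^ CARD('d) / (2 * pi) ^ CARD('d))"
    have "fourier_coeff M u k = C * (\<Sum>n\<in>?R. u n * cnj (mode M k n))" for k
      unfolding fourier_coeff_def lattice_dft_def exp_minus_eq_cnj_mode by (simp add: C_def)
    then have "fourier_coeff M u k * mode M k m = (\<Sum>n\<in>?R. C * u n * (mode M m k * cnj (mode M n k)))" for k
      by (simp add: sum_distrib_left sum_distrib_right mode_commute[of M k] algebra_simps)
    then have "?v m = (\<Sum>k\<in>?R. \<Sum>n\<in>?R. C * u n * (mode M m k * cnj (mode M n k)))" by simp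
    also have "\<dots> = (\<Sum>n\<in>?R. C * u n * (\<Sum>k\<in>?R. mode M m k * cnj (mode M n k)))"
      by (subst sum.swap) (simp add: sum_distrib_left)
    also have "\<dots> = (\<Sum>n\<in>?R. if m = n then C * u n * of_nat (2 * M) ^ CARD('d) else 0)"
      using m by (intro sum.cong refl) (subst mode_orthogonal[OF M]; auto)
    also have "\<dots> = of_real (mesh M ^ CARD('d) * real (2 * M) ^ CARD('d) / (2 * pi) ^ CARD('d)) * u m"
      using m by (simp add: sum.delta C_def)
    also have "\<dots> = u m" unfolding mesh_volume[OF M] by simp
    finally show ?thesis by simp
  qed
  moreover obtain m' where m': "m' \<in> ?R" "\<And>u. lattice_fun M u \<Longrightarrow> u m = u m'"
    using lattice_fun_representative[OF M] by blast
  ultimately show ?thesis using m'(2)[OF u] m'(2)[OF v] by simp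
qed

text \<open>
  Plane waves are eigenfunctions of the discrete Laplacian, so the superposition solves the
  equation; solutions are unique.
\<close>

lemma lattice_propagator_eq_evolve:
  fixes u0 :: "int ^ 'd::finite \<Rightarrow> complex"
  assumes M: "M > 0" and u0: "lattice_fun M u0"
  shows "lattice_propagator M t u0 =
    evolve (representatives M) (mode M) (laplacian_symbol M) (fourier_coeff M u0) t"
proof -
  let ?R = "representatives M :: (int ^ 'd) set"
  let ?c = "fourier_coeff M u0" and ?\<omega> = "laplacian_symbol M :: int ^ 'd \<Rightarrow> real"
  define v where "v t = evolve ?R (mode M) ?\<omega> ?c t" for t
  have "lattice_schroedinger M u0 v"
    unfolding lattice_schroedinger_def
  proof (intro conjI allI)
    show "lattice_fun M (v t)" for t
      by (simp add: lattice_fun_def v_def evolve_def mode_shift_period[OF M])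
    show "v 0 = u0"
      using fourier_inversion[OF M u0] by (simp add: v_def evolve_def fun_eq_iff)
    fix t m
    let ?D = "\<Sum>k\<in>?R. ?c k * mode M k m * (- \<i> * of_real (?\<omega> k) * cis (- (?\<omega> k * t)))"
    have "((\<lambda>s. v s m) has_vector_derivative ?D) (at t)"
      unfolding v_def evolve_def
    proof (intro has_vector_derivative_sum has_vector_derivative_mult_right)
      fix k
      have "((\<lambda>z. exp (- \<i> * of_real (?\<omega> k) * z)) has_field_derivative
          - \<i> * of_real (?\<omega> k) * exp (- \<i> * of_real (?\<omega> k) * of_real t)) (at (of_real t))"
        by (auto intro!: derivative_eq_intros)
      from has_vector_derivative_real_field[OF this]
      show "((\<lambda>s. cis (- (?\<omega> k * s))) has_vector_derivative
          - \<i> * of_real (?\<omega> k) * cis (- (?\<omega> k * t))) (at t)"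
        by (simp add: cis_conv_exp mult.assoc)
    qed
    moreover have "\<i> * ?D + lattice_laplacian M (v t) m = 0"
    proof -
      have "v t = (\<lambda>m. \<Sum>k\<in>?R. (?c k * cis (- (?\<omega> k * t))) * mode M k m)"
        by (simp add: v_def evolve_def fun_eq_iff mult_ac)
      then have "lattice_laplacian M (v t) m =
          (\<Sum>k\<in>?R. (?c k * cis (- (?\<omega> k * t))) * (- of_real (?\<omega> k) * mode M k m))"
        by (simp only: lattice_laplacian_sum laplacian_mode[OF M])
      then show ?thesis
        unfolding sum_distrib_left by (simp only: sum.distrib[symmetric]) (simp add: mult_ac)
    qed
    ultimately show "\<exists>D. ((\<lambda>s. v s m) has_vector_derivative D) (at t) \<and> \<i> * D + lattice_laplacian M (v t) m = 0"
      by blast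
  qed
  from lattice_schroedinger_unique[OF M lattice_propagator_solves[OF M u0] this]
  show ?thesis by (simp add: v_def fun_eq_iff)
qed

lemma lattice_norm_eq_Lp_norm:
  "lattice_norm M (ereal r) f = Lp_norm (representatives M) (mesh M ^ CARD('d)) r f"
  for f :: "int ^ 'd::finite \<Rightarrow> complex"
  by (simp add: lattice_norm_def Lp_norm_def)

lemma Lp_norm_2:
  assumes "0 \<le> w"
  shows "Lp_norm X w 2 f = sqrt (w * (\<Sum>x\<in>X. (cmod (f x))\<^sup>2))"
  using assms by (simp add: Lp_norm_def powr_half_sqrt sum_nonneg)

lemma Parseval:
  fixes a :: "int ^ 'd::finite \<Rightarrow> complex"
  assumes M: "M > 0" and S: "S \<subseteq> representatives M"
  shows "mesh M ^ CARD('d) * (\<Sum>m\<in>representatives M. (cmod (\<Sum>k\<in>S. a k * mode M k m))\<^sup>2) =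
    (2 * pi) ^ CARD('d) * (\<Sum>k\<in>S. (cmod (a k))\<^sup>2)"
  unfolding mode_Parseval[OF M S] mult.assoc[symmetric] mesh_volume[OF M] ..

lemma lattice_norm_2_modes:
  fixes a :: "int ^ 'd::finite \<Rightarrow> complex"
  assumes M: "M > 0"
  shows "lattice_norm M 2 (\<lambda>m. \<Sum>k\<in>representatives M. a k * mode M k m) =
    sqrt ((2 * pi) ^ CARD('d) * (\<Sum>k\<in>representatives M. (cmod (a k))\<^sup>2))"
proof -
  have w: "0 \<le> mesh M ^ CARD('d)" using mesh_pos[OF M] by simp
  have 2: "(2 :: ereal) = ereal 2" by simp
  show ?thesis
    unfolding 2 lattice_norm_eq_Lp_norm Lp_norm_2[OF w] Parseval[OF M subset_refl] ..
qed

lemma lattice_norm_2_bessel: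
  fixes u :: "int ^ 'd::finite \<Rightarrow> complex"
  assumes M: "M > 0"
  shows "lattice_norm M 2 (lattice_bessel M s u) = sqrt ((2 * pi) ^ CARD('d) *
    (\<Sum>k\<in>representatives M. (japanese_bracket (real_vec k) powr s * cmod (fourier_coeff M u k))\<^sup>2))"
proof -
  have "lattice_bessel M s u = (\<lambda>m. \<Sum>k\<in>representatives M.
      (of_real (japanese_bracket (real_vec k) powr s) * fourier_coeff M u k) * mode M k m)"
    by (simp add: lattice_bessel_def lattice_idft_eq fourier_coeff_def fun_eq_iff)
  then show ?thesis by (simp only: lattice_norm_2_modes[OF M]) (simp add: norm_mult)
qed

section \<open>Dispersion in a frequency shell\<close>

definition frequency_cube :: "nat \<Rightarrow> nat \<Rightarrow> (int ^ 'd::finite) set" where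
  "frequency_cube M n = {k \<in> representatives M. \<forall>j. \<bar>k $ j\<bar> < int n}"

text \<open>
  The dyadic shells \<open>frequency_shell M (2 ^ i)\<close> partition the dual lattice. With \<open>n div 2\<close> instead of
  \<open>2 ^ (i - 1)\<close> the first shell, which is \<open>{0}\<close>, needs no special treatment.
\<close>

definition frequency_shell :: "nat \<Rightarrow> nat \<Rightarrow> (int ^ 'd::finite) set" where
  "frequency_shell M n = frequency_cube M n - frequency_cube M (n div 2)"

lemma finite_frequency_cube [simp]: "finite (frequency_cube M n)"
  by (rule finite_subset[OF _ finite_representatives[of M]]) (auto simp: frequency_cube_def)

lemma frequency_cube_mono:
  assumes "m \<le> n"
  shows "frequency_cube M m \<subseteq> frequency_cube M n"
proof -
  have "int m \<le> int n" using assms by simp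
  then show ?thesis unfolding frequency_cube_def by (blast intro: less_le_trans)
qed

lemma frequency_shell_subset: "frequency_shell M n \<subseteq> representatives M"
  by (auto simp: frequency_shell_def frequency_cube_def)

lemma finite_frequency_shell [simp]: "finite (frequency_shell M n)"
  by (simp add: frequency_shell_def)

lemma frequency_cube_eq_box:
  "frequency_cube M n = {k. \<forall>j. k $ j \<in> {- int (min M (n - 1))..<int (min M n)}}"
proof -
  have "a \<in> {- int M..int M - 1} \<and> \<bar>a\<bar> < int n \<longleftrightarrow>
      a \<in> {- int (min M (n - 1))..<int (min M n)}" for a
    by (auto simp: min_def of_nat_diff split: if_splits)
  then show ?thesis unfolding frequency_cube_def representatives_def by blast
qed

text \<open>
  The symbol is additive over the coordinates, so the kernel of a cube is the product of
  one-dimensional exponential sums.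
\<close>

lemma cube_kernel_bound:
  fixes m m' :: "int ^ 'd::finite"
  assumes M: "M > 0" and N: "1 \<le> N" "real n \<le> N" and \<tau>: "\<bar>\<tau>\<bar> * N \<le> 1"
  shows "cmod (\<Sum>k\<in>frequency_cube M n. mode M k m * cnj (mode M k m') * cis (laplacian_symbol M k * \<tau>))
    \<le> (360 * N * (1 + N\<^sup>2 * \<bar>\<tau>\<bar>) powr (- 1 / 3)) ^ CARD('d)"
proof -
  define A where "A = {- int (min M (n - 1))..<int (min M n)}"
  define x where "x j = mesh M * real_of_int (m $ j - m' $ j)" for j
  let ?\<phi> = "\<lambda>j a. lattice_phase (mesh M) (- \<tau>) (x j) (real_of_int a)"
  have "mode M k m * cnj (mode M k m') * cis (laplacian_symbol M k * \<tau>) = (\<Prod>j\<in>UNIV. cis (?\<phi> j (k $ j)))" for k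
  proof -
    have "mode M k m * cnj (mode M k m') * cis (laplacian_symbol M k * \<tau>) =
        cis (mesh M * (\<Sum>j\<in>UNIV. real_of_int (k $ j) * real_of_int (m $ j)) -
          mesh M * (\<Sum>j\<in>UNIV. real_of_int (k $ j) * real_of_int (m' $ j)) + laplacian_symbol M k * \<tau>)"
      by (simp add: mode_def cis_cnj cis_mult)
    also have "\<dots> = cis (\<Sum>j\<in>UNIV. ?\<phi> j (k $ j))"
      unfolding laplacian_symbol_def sum_distrib_left sum_distrib_right sum_subtractf[symmetric]
        sum.distrib[symmetric]
      by (intro arg_cong[where f = cis] sum.cong refl)
        (simp add: lattice_phase_def x_def algebra_simps diff_divide_distrib)
    finally show ?thesis by (simp only: cis_sum)
  qed
  then have "(\<Sum>k\<in>frequency_cube M n. mode M k m * cnj (mode M k m') * cis (laplacian_symbol M k * \<tau>)) =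
      (\<Sum>k | \<forall>j. k $ j \<in> A. \<Prod>j\<in>UNIV. cis (?\<phi> j (k $ j)))"
    by (simp only: frequency_cube_eq_box A_def)
  also have "\<dots> = (\<Prod>j\<in>UNIV. \<Sum>a\<in>A. cis (?\<phi> j a))"
    by (rule sum_box_prod) (simp add: A_def)
  also have "cmod \<dots> = (\<Prod>j\<in>UNIV. cmod (\<Sum>a\<in>A. cis (?\<phi> j a)))" by (rule prod_norm[symmetric])
  also have "\<dots> \<le> (\<Prod>j\<in>(UNIV::'d set). 360 * N * (1 + N\<^sup>2 * \<bar>\<tau>\<bar>) powr (- 1 / 3))"
  proof (intro prod_mono conjI)
    fix j
    have "cmod (\<Sum>a\<in>A. cis (?\<phi> j a)) \<le> 360 * N * (1 + N\<^sup>2 * \<bar>- \<tau>\<bar>) powr (- 1 / 3)"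
      unfolding A_def
    proof (rule dispersive_estimate_1d[OF mesh_pos[OF M] mesh_le_pi[OF M] N(1)])
      show "\<bar>- \<tau>\<bar> * N \<le> 1" using \<tau> by simp
      fix k assume k: "k \<in> {- int (min M (n - 1))..<int (min M n)}"
      then have "\<bar>k\<bar> \<le> int M" "\<bar>k\<bar> \<le> int n" by auto
      then have kM: "real_of_int \<bar>k\<bar> \<le> real M" "real_of_int \<bar>k\<bar> \<le> real n"
        by (simp_all add: of_int_le_iff[symmetric] del: of_int_abs of_int_le_iff)
      have "mesh M * \<bar>real_of_int k\<bar> \<le> mesh M * real M"
        using kM mesh_pos[OF M] by (intro mult_left_mono) auto
      then show "mesh M * \<bar>real_of_int k\<bar> \<le> pi \<and> \<bar>real_of_int k\<bar> \<le> N"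
        using M N kM by (simp add: mesh_def)
    qed
    then show "cmod (\<Sum>a\<in>A. cis (?\<phi> j a)) \<le> 360 * N * (1 + N\<^sup>2 * \<bar>\<tau>\<bar>) powr (- 1 / 3)" by simp
  qed simp
  finally show ?thesis by simp
qed

lemma shell_kernel_bound:
  fixes m m' :: "int ^ 'd::finite"
  assumes M: "M > 0" and N: "1 \<le> N" and \<tau>: "\<bar>\<tau>\<bar> * real N \<le> 1"
  shows "cmod (\<Sum>k\<in>frequency_shell M N. mode M k m * cnj (mode M k m') * cis (laplacian_symbol M k * \<tau>))
    \<le> 2 * (360 * real N * (1 + (real N)\<^sup>2 * \<bar>\<tau>\<bar>) powr (- 1 / 3)) ^ CARD('d)"
proof -
  let ?f = "\<lambda>k. mode M k m * cnj (mode M k m') * cis (laplacian_symbol M k * \<tau>)"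
    and ?K = "(360 * real N * (1 + (real N)\<^sup>2 * \<bar>\<tau>\<bar>) powr (- 1 / 3)) ^ CARD('d)"
  have "(\<Sum>k\<in>frequency_shell M N. ?f k) = (\<Sum>k\<in>frequency_cube M N. ?f k) - (\<Sum>k\<in>frequency_cube M (N div 2). ?f k)"
    unfolding frequency_shell_def by (intro sum_diff frequency_cube_mono) auto
  then have "cmod (\<Sum>k\<in>frequency_shell M N. ?f k) \<le>
      cmod (\<Sum>k\<in>frequency_cube M N. ?f k) + cmod (\<Sum>k\<in>frequency_cube M (N div 2). ?f k)"
    by (simp add: norm_triangle_ineq4)
  moreover have "cmod (\<Sum>k\<in>frequency_cube M N. ?f k) \<le> ?K"
    by (rule cube_kernel_bound[OF M _ _ \<tau>]) (use N in auto)
  moreover have "cmod (\<Sum>k\<in>frequency_cube M (N div 2). ?f k) \<le> ?K"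
    by (rule cube_kernel_bound[OF M _ _ \<tau>]) (use N in auto)
  ultimately show ?thesis by linarith
qed

text \<open>
  The integrable majorant in time: up to constants the kernel of the shell is its power \<open>d / 3\<close>. The
  factor 2 makes it at least one for \<open>\<bar>\<tau>\<bar> \<le> 1 / N\<close>, so that its powers increase with the exponent.
\<close>

definition time_kernel :: "real \<Rightarrow> real \<Rightarrow> real" where
  "time_kernel N \<tau> = 2 * N ^ 3 / (1 + N\<^sup>2 * \<bar>\<tau>\<bar>)"

lemma time_kernel_ge_1:
  assumes "1 \<le> N" "\<bar>\<tau>\<bar> * N \<le> 1"
  shows "1 \<le> time_kernel N \<tau>"
proof -
  have "N * (\<bar>\<tau>\<bar> * N) \<le> N * 1" using assms by (intro mult_left_mono) auto
  then have "N\<^sup>2 * \<bar>\<tau>\<bar> \<le> N" by (simp add: power2_eq_square mult_ac)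
  moreover have "N \<le> N ^ 3" using power_increasing[of 1 3 N] assms(1) by simp
  ultimately have "1 + N\<^sup>2 * \<bar>\<tau>\<bar> \<le> 2 * N ^ 3" using assms(1) by linarith
  moreover have "0 < 1 + N\<^sup>2 * \<bar>\<tau>\<bar>" by (intro add_pos_nonneg) auto
  ultimately show ?thesis by (simp add: time_kernel_def le_divide_eq_1_pos)
qed

lemma evolve_adjoint_L2:
  fixes f :: "int ^ 'd::finite \<Rightarrow> complex"
  assumes M: "M > 0" and S: "S \<subseteq> representatives M"
  shows "(\<Sum>k\<in>S. (cmod (evolve_adjoint (representatives M) (mesh M ^ CARD('d)) (mode M) \<omega> t f k))\<^sup>2) \<le>
    (2 * pi) ^ CARD('d) * (mesh M ^ CARD('d) * (\<Sum>m\<in>representatives M. (cmod (f m))\<^sup>2))"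
proof -
  let ?R = "representatives M :: (int ^ 'd) set" and ?w = "mesh M ^ CARD('d)"
  have w: "?w > 0" using mesh_pos[OF M] by simp
  have "cmod (evolve_adjoint ?R ?w (mode M) \<omega> t f k) = ?w * cmod (\<Sum>m\<in>?R. cnj (f m) * mode M m k)" for k
  proof -
    have "evolve_adjoint ?R ?w (mode M) \<omega> t f k = ?w * cnj (\<Sum>m\<in>?R. cnj (f m) * mode M m k) * cis (\<omega> k * t)"
      by (simp add: evolve_adjoint_def sum_distrib_right mode_commute[of M k] mult.assoc)
    then have "cmod (evolve_adjoint ?R ?w (mode M) \<omega> t f k) = ?w * cmod (cnj (\<Sum>m\<in>?R. cnj (f m) * mode M m k))"
      using w by (simp only: norm_mult norm_cis norm_of_real abs_of_pos mult_1_right)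
    then show ?thesis by (simp only: complex_mod_cnj)
  qed
  then have "(\<Sum>k\<in>S. (cmod (evolve_adjoint ?R ?w (mode M) \<omega> t f k))\<^sup>2) =
      ?w\<^sup>2 * (\<Sum>k\<in>S. (cmod (\<Sum>m\<in>?R. cnj (f m) * mode M m k))\<^sup>2)"
    by (simp add: power_mult_distrib sum_distrib_left)
  also have "\<dots> \<le> ?w\<^sup>2 * (\<Sum>k\<in>?R. (cmod (\<Sum>m\<in>?R. cnj (f m) * mode M m k))\<^sup>2)"
    using S by (intro mult_left_mono sum_mono2) auto
  also have "\<dots> = ?w * (?w * (\<Sum>k\<in>?R. (cmod (\<Sum>m\<in>?R. cnj (f m) * mode M m k))\<^sup>2))"
    by (simp add: power2_eq_square mult.assoc)
  also have "\<dots> = (2 * pi) ^ CARD('d) * (?w * (\<Sum>m\<in>?R. (cmod (f m))\<^sup>2))"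
    unfolding Parseval[OF M subset_refl] by (simp add: mult_ac)
  finally show ?thesis .
qed

lemma evolve_mode_energy:
  fixes a :: "int ^ 'd::finite \<Rightarrow> complex"
  assumes M: "M > 0" and S: "S \<subseteq> representatives M"
  shows "mesh M ^ CARD('d) * (\<Sum>m\<in>representatives M. (cmod (evolve S (mode M) \<omega> a t m))\<^sup>2) =
    (2 * pi) ^ CARD('d) * (\<Sum>k\<in>S. (cmod (a k))\<^sup>2)"
proof -
  have "evolve S (mode M) \<omega> a t m = (\<Sum>k\<in>S. (a k * cis (- (\<omega> k * t))) * mode M k m)" for m
    by (simp add: evolve_def mult_ac)
  then show ?thesis using Parseval[OF M S, of "\<lambda>k. a k * cis (- (\<omega> k * t))"] by (simp add: norm_mult)
qed

text \<open>
  The propagator between the times \<open>s\<close> and \<open>t\<close>, restricted to the shell, is bounded from \<open>L\<^sup>1\<close> to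
  \<open>L\<^sup>\<infinity>\<close> by the kernel estimate and on \<open>L\<^sup>2\<close> by Parseval's identity. Interpolation gives the power
  \<open>1 - 2 / r\<close> of the kernel bound, and the condition on the exponents turns it into
  \<open>time_kernel\<^sup>2\<^sup>/\<^sup>q\<close>.
\<close>

lemma shell_dispersive_estimate:
  fixes f g :: "int ^ 'd::finite \<Rightarrow> complex" and q r t s :: real and M N :: nat
  defines "X \<equiv> representatives M :: (int ^ 'd) set" and "w \<equiv> mesh M ^ CARD('d)"
  assumes M: "M > 0" and N: "1 \<le> N" and ts: "\<bar>t - s\<bar> * real N \<le> 1"
    and q: "0 < q" and r: "2 < r" and qr: "real CARD('d) / 3 * (1 - 2 / r) \<le> 2 / q"
  shows "cmod (\<Sum>k\<in>frequency_shell M N. evolve_adjoint X w (mode M) (laplacian_symbol M) t f k *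
      cnj (evolve_adjoint X w (mode M) (laplacian_symbol M) s g k)) \<le>
    4 * r / (r - 2) * (2 * pi) ^ (2 * CARD('d)) * (4 * 360 ^ CARD('d)) *
    time_kernel (real N) (t - s) powr (2 / q) *
    (Lp_norm X w (r / (r - 1)) f * Lp_norm X w (r / (r - 1)) g)"
proof -
  let ?S = "frequency_shell M N :: (int ^ 'd) set" and ?\<omega> = "laplacian_symbol M :: int ^ 'd \<Rightarrow> real"
  let ?d = "CARD('d)"
  have X: "finite X" by (simp add: X_def)
  have w: "0 < w" using mesh_pos[OF M] by (simp add: w_def)
  define y where "y = 1 + (real N)\<^sup>2 * \<bar>t - s\<bar>"
  have y: "y \<ge> 1" by (simp add: y_def)
  have N0: "real N \<ge> 1" using N by simp
  define A where "A = 2 * (360 * real N * y powr (- 1 / 3)) ^ ?d"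
  have A: "0 < A" using N0 y by (simp add: A_def)
  define B where "B = (2 * pi) ^ (2 * ?d)"
  have "(1::real) \<le> 2 * pi" using pi_gt3 by simp
  then have B: "1 \<le> B" unfolding B_def by (rule one_le_power)
  \<comment> \<open>apply the adjoint at time \<open>t\<close>, then evolve to time \<open>s\<close>\<close>
  define T where "T h m = evolve ?S (mode M) ?\<omega> (evolve_adjoint X w (mode M) ?\<omega> t h) s m" for h m
  have T_kernel: "T h m = w * (\<Sum>m'\<in>X. h m' * (\<Sum>k\<in>?S. mode M k m * cnj (mode M k m') * cis (?\<omega> k * (t - s))))" for h m
  proof -
    have "T h m = (\<Sum>k\<in>?S. \<Sum>m'\<in>X. w * (h m' * (mode M k m * cnj (mode M k m') * (cis (?\<omega> k * t) * cis (- (?\<omega> k * s))))))"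
      by (simp add: T_def evolve_def evolve_adjoint_def sum_distrib_left sum_distrib_right mult_ac)
    also have "\<dots> = (\<Sum>m'\<in>X. \<Sum>k\<in>?S. w * (h m' * (mode M k m * cnj (mode M k m') * (cis (?\<omega> k * t) * cis (- (?\<omega> k * s))))))"
      by (rule sum.swap)
    finally show ?thesis by (simp add: sum_distrib_left cis_mult right_diff_distrib)
  qed
  have "Lp_norm X w r (T f) \<le> (4 * r / (r - 2) * B * (2 * A) powr (r - 2)) powr (1 / r) * Lp_norm X w (r / (r - 1)) f"
  proof (rule real_interpolation[OF X w A _ r])
    show "0 \<le> B" using B by simp
    show "T (\<lambda>x. f x + g x) m = T f m + T g m" for f g m
      unfolding T_kernel by (simp add: distrib_right distrib_left sum.distrib)
    show "cmod (T h m) \<le> A * (w * (\<Sum>x\<in>X. cmod (h x)))" if "m \<in> X" for h m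
    proof -
      have "cmod (T h m) = w * cmod (\<Sum>m'\<in>X. h m' * (\<Sum>k\<in>?S. mode M k m * cnj (mode M k m') * cis (?\<omega> k * (t - s))))"
        unfolding T_kernel using w by (simp add: norm_mult)
      also have "\<dots> \<le> w * (\<Sum>m'\<in>X. cmod (h m') * A)"
      proof (intro mult_left_mono sum_norm_le)
        fix m'
        show "cmod (h m' * (\<Sum>k\<in>?S. mode M k m * cnj (mode M k m') * cis (?\<omega> k * (t - s)))) \<le> cmod (h m') * A"
          unfolding norm_mult A_def y_def by (intro mult_left_mono shell_kernel_bound M N ts) auto
      qed (use w in auto)
      finally show ?thesis unfolding sum_distrib_right[symmetric] by (simp only: mult_ac)
    qed
    show "w * (\<Sum>m\<in>X. (cmod (T h m))\<^sup>2) \<le> B * (w * (\<Sum>x\<in>X. (cmod (h x))\<^sup>2))" for h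
    proof -
      have "w * (\<Sum>m\<in>X. (cmod (T h m))\<^sup>2) =
          (2 * pi) ^ ?d * (\<Sum>k\<in>?S. (cmod (evolve_adjoint X w (mode M) ?\<omega> t h k))\<^sup>2)"
        unfolding T_def w_def X_def by (rule evolve_mode_energy[OF M frequency_shell_subset])
      also have "\<dots> \<le> (2 * pi) ^ ?d * ((2 * pi) ^ ?d * (w * (\<Sum>x\<in>X. (cmod (h x))\<^sup>2)))"
        unfolding w_def X_def
        by (intro mult_left_mono evolve_adjoint_L2[OF M frequency_shell_subset]) simp
      also have "\<dots> = B * (w * (\<Sum>x\<in>X. (cmod (h x))\<^sup>2))"
        unfolding B_def mult_2 power_add mult.assoc ..
      finally show ?thesis .
    qed
  qed
  also have "(4 * r / (r - 2) * B * (2 * A) powr (r - 2)) powr (1 / r) \<le>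
      4 * r / (r - 2) * B * (4 * 360 ^ ?d) * time_kernel (real N) (t - s) powr (2 / q)"
  proof -
    let ?\<kappa> = "time_kernel (real N) (t - s)"
    have \<kappa>: "1 \<le> ?\<kappa>" using time_kernel_ge_1[OF N0 ts] .
    have c1: "1 \<le> 4 * r / (r - 2) * B" 
    proof -
      have "1 \<le> 4 * r / (r - 2)" using r by (simp add: field_simps)
      then show ?thesis using B mult_mono[of 1 "4 * r / (r - 2)" 1 B] by simp
    qed
    have "1 \<le> (360::real) ^ ?d" by (rule one_le_power) simp
    then have c2: "1 \<le> 4 * (360::real) ^ ?d" by linarith
    have "2 * A \<le> 4 * 360 ^ ?d * ?\<kappa> powr (?d / 3)"
    proof -
      have "(real N * y powr (- 1 / 3)) ^ ?d = (real N ^ 3 / y) powr (?d / 3)"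
      proof -
        have "real N * y powr (- 1 / 3) = (real N ^ 3 / y) powr (1 / 3)"
        proof -
          have "(real N ^ 3) powr (1 / 3) = real N"
            using N0 by (simp flip: powr_numeral add: powr_powr)
          then show ?thesis using N0 y by (simp add: powr_divide powr_minus_divide)
        qed
        then have "(real N * y powr (- 1 / 3)) ^ ?d = ((real N ^ 3 / y) powr (1 / 3)) powr real ?d"
          using N0 y by (simp add: powr_realpow)
        then show ?thesis by (simp add: powr_powr)
      qed
      also have "\<dots> \<le> ?\<kappa> powr (?d / 3)"
        using N0 y by (intro powr_mono2) (auto simp: time_kernel_def y_def[symmetric] divide_right_mono)
      finally show ?thesis by (simp add: A_def power_mult_distrib mult_ac)
    qed
    then have "(2 * A) powr ((r - 2) / r) \<le> (4 * 360 ^ ?d * ?\<kappa> powr (?d / 3)) powr ((r - 2) / r)"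
      using A r by (intro powr_mono2) auto
    also have "\<dots> = (4 * 360 ^ ?d) powr ((r - 2) / r) * ?\<kappa> powr (?d / 3 * ((r - 2) / r))"
      by (simp add: powr_mult powr_powr)
    also have "\<dots> \<le> (4 * 360 ^ ?d) powr 1 * ?\<kappa> powr (2 / q)"
      using c2 \<kappa> r qr by (intro mult_mono powr_mono) (auto simp: field_simps)
    finally have a: "(2 * A) powr ((r - 2) / r) \<le> 4 * 360 ^ ?d * ?\<kappa> powr (2 / q)" by simp
    have "(4 * r / (r - 2) * B) powr (1 / r) \<le> (4 * r / (r - 2) * B) powr 1"
      using c1 r by (intro powr_mono) auto
    also have "(4 * r / (r - 2) * B) powr 1 = 4 * r / (r - 2) * B"
      unfolding powr_one_gt_zero_iff using c1 by linarith
    finally have b: "(4 * r / (r - 2) * B) powr (1 / r) \<le> 4 * r / (r - 2) * B" .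
    have "(4 * r / (r - 2) * B * (2 * A) powr (r - 2)) powr (1 / r) =
        (4 * r / (r - 2) * B) powr (1 / r) * (2 * A) powr ((r - 2) / r)"
      unfolding powr_mult powr_powr by simp
    also have "\<dots> \<le> (4 * r / (r - 2) * B) * (4 * 360 ^ ?d * ?\<kappa> powr (2 / q))"
      using a b c1 by (intro mult_mono) auto
    finally show ?thesis by (simp add: mult.assoc)
  qed
  finally have Tf: "Lp_norm X w r (T f) \<le> 4 * r / (r - 2) * B * (4 * 360 ^ ?d) *
      time_kernel (real N) (t - s) powr (2 / q) * Lp_norm X w (r / (r - 1)) f"
    by (simp add: mult_right_mono Lp_norm_nonneg)
  have "cmod (\<Sum>k\<in>?S. evolve_adjoint X w (mode M) ?\<omega> t f k * cnj (evolve_adjoint X w (mode M) ?\<omega> s g k)) =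
      cmod (w * (\<Sum>m\<in>X. cnj (g m) * T f m))"
    unfolding evolve_adjoint_pairing T_def by (simp add: mult.commute)
  also have "\<dots> \<le> Lp_norm X w (r / (r - 1)) (\<lambda>m. cnj (g m)) * Lp_norm X w r (T f)"
    using r by (intro Holder_inequality X w) (auto simp: field_simps)
  also have "Lp_norm X w (r / (r - 1)) (\<lambda>m. cnj (g m)) = Lp_norm X w (r / (r - 1)) g"
    by (simp add: Lp_norm_def)
  also have "Lp_norm X w (r / (r - 1)) g * Lp_norm X w r (T f) \<le> Lp_norm X w (r / (r - 1)) g *
     (4 * r / (r - 2) * B * (4 * 360 ^ ?d) * time_kernel (real N) (t - s) powr (2 / q) * Lp_norm X w (r / (r - 1)) f)"
    by (intro mult_left_mono Tf Lp_norm_nonneg)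
  finally show ?thesis by (simp add: B_def mult_ac)
qed

section \<open>Strichartz estimates with a loss of derivatives\<close>

lemma time_kernel_continuous: "continuous_on UNIV (time_kernel N)"
proof -
  have "0 < 1 + N\<^sup>2 * \<bar>\<tau>\<bar>" for \<tau> :: real by (intro add_pos_nonneg) auto
  then have "1 + N\<^sup>2 * \<bar>\<tau>\<bar> \<noteq> 0" for \<tau> :: real by (metis less_irrefl)
  then show ?thesis unfolding time_kernel_def[abs_def] by (intro continuous_intros) auto
qed

lemma time_kernel_pos: "0 < N \<Longrightarrow> 0 < time_kernel N \<tau>"
  by (auto simp: time_kernel_def intro!: divide_pos_pos add_pos_nonneg mult_nonneg_nonneg)

lemma time_kernel_minus: "time_kernel N (- \<tau>) = time_kernel N \<tau>"
  by (simp add: time_kernel_def)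

text \<open>
  This logarithm is what the loss \<open>\<epsilon>\<close> pays for.
\<close>

lemma integral_time_kernel_le:
  assumes N: "1 \<le> N" and ab: "(b - a) * N \<le> 1" and t: "t \<in> {a..b}"
  shows "integral {a..b} (\<lambda>s. time_kernel N (t - s)) \<le> 4 * N * ln (1 + N)"
proof -
  have pos: "0 < 1 + N\<^sup>2 * x" if "0 \<le> x" for x using that by (intro add_pos_nonneg) auto
  have "((\<lambda>s. time_kernel N (t - s)) has_integral
      (- 2 * N * ln (1 + N\<^sup>2 * (t - t)) - (- 2 * N * ln (1 + N\<^sup>2 * (t - a))))) {a..t}"
  proof (rule fundamental_theorem_of_calculus)
    fix s assume s: "s \<in> {a..t}"
    have "((\<lambda>s. - 2 * N * ln (1 + N\<^sup>2 * (t - s))) has_real_derivative time_kernel N (t - s)) (at s within {a..t})"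
      using s pos[of "t - s"]
      by (auto intro!: derivative_eq_intros simp: time_kernel_def power2_eq_square power3_eq_cube)
    then show "((\<lambda>s. - 2 * N * ln (1 + N\<^sup>2 * (t - s))) has_vector_derivative time_kernel N (t - s)) (at s within {a..t})"
      by (simp add: has_real_derivative_iff_has_vector_derivative)
  qed (use t in simp)
  moreover have "((\<lambda>s. time_kernel N (t - s)) has_integral
      (2 * N * ln (1 + N\<^sup>2 * (b - t)) - 2 * N * ln (1 + N\<^sup>2 * (t - t)))) {t..b}"
  proof (rule fundamental_theorem_of_calculus)
    fix s assume s: "s \<in> {t..b}"
    have "((\<lambda>s. 2 * N * ln (1 + N\<^sup>2 * (s - t))) has_real_derivative time_kernel N (t - s)) (at s within {t..b})"
      using s pos[of "s - t"]
      by (auto intro!: derivative_eq_intros simp: time_kernel_def power2_eq_square power3_eq_cube)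
    then show "((\<lambda>s. 2 * N * ln (1 + N\<^sup>2 * (s - t))) has_vector_derivative time_kernel N (t - s)) (at s within {t..b})"
      by (simp add: has_real_derivative_iff_has_vector_derivative)
  qed (use t in simp)
  ultimately have "((\<lambda>s. time_kernel N (t - s)) has_integral
      (- 2 * N * ln (1 + N\<^sup>2 * (t - t)) - (- 2 * N * ln (1 + N\<^sup>2 * (t - a)))) +
      (2 * N * ln (1 + N\<^sup>2 * (b - t)) - 2 * N * ln (1 + N\<^sup>2 * (t - t)))) {a..b}"
    using t by (intro has_integral_combine[where c = t]) auto
  then have "integral {a..b} (\<lambda>s. time_kernel N (t - s)) =
      2 * N * ln (1 + N\<^sup>2 * (t - a)) + 2 * N * ln (1 + N\<^sup>2 * (b - t))"
    by (simp add: integral_unique)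
  moreover have "ln (1 + N\<^sup>2 * x) \<le> ln (1 + N)" if "0 \<le> x" "x \<le> b - a" for x
  proof -
    have "N * (x * N) \<le> N * 1"
      using that N ab by (intro mult_left_mono order_trans[OF mult_right_mono ab]) auto
    then show ?thesis using pos[OF that(1)] by (simp add: power2_eq_square mult_ac)
  qed
  then have "2 * N * ln (1 + N\<^sup>2 * (t - a)) \<le> 2 * N * ln (1 + N)" "2 * N * ln (1 + N\<^sup>2 * (b - t)) \<le> 2 * N * ln (1 + N)"
    using t N by (auto intro!: mult_left_mono)
  ultimately show ?thesis by linarith
qed

text \<open>
  The interpolation constant times the square of \<open>(2 \<pi>)\<^sup>d\<close> from Parseval's identity times the constant
  of the kernel bound; it decreases in \<open>r\<close>.
\<close>

definition dispersive_constant :: "nat \<Rightarrow> real \<Rightarrow> real" where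
  "dispersive_constant d r = 4 * r / (r - 2) * (2 * pi) ^ (2 * d) * (4 * 360 ^ d)"

lemma dispersive_constant_pos: "2 < r \<Longrightarrow> 0 < dispersive_constant d r"
  by (simp add: dispersive_constant_def)

lemma dispersive_constant_antimono:
  assumes "2 < r0" "r0 \<le> r"
  shows "dispersive_constant d r \<le> dispersive_constant d r0"
proof -
  have "4 * r / (r - 2) \<le> 4 * r0 / (r0 - 2)" using assms by (simp add: field_simps)
  then show ?thesis unfolding dispersive_constant_def by (intro mult_right_mono) auto
qed

lemma shell_strichartz_short_interval:
  fixes c :: "int ^ 'd::finite \<Rightarrow> complex" and q r :: real and M N :: nat
  defines "X \<equiv> representatives M :: (int ^ 'd) set" and "w \<equiv> mesh M ^ CARD('d)"
  assumes M: "M > 0" and N: "1 \<le> N" and ab: "a < b" "(b - a) * real N \<le> 1"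
    and q: "2 \<le> q" and r: "2 < r" and qr: "real CARD('d) / 3 * (1 - 2 / r) \<le> 2 / q"
  shows "integral {a..b} (\<lambda>t. Lp_norm X w r (evolve (frequency_shell M N) (mode M) (laplacian_symbol M) c t) powr q) \<le>
    (sqrt (dispersive_constant CARD('d) r) * sqrt (\<Sum>k\<in>frequency_shell M N. (cmod (c k))\<^sup>2)) powr q *
    (4 * real N * ln (1 + real N))"
proof -
  let ?S = "frequency_shell M N :: (int ^ 'd) set" and ?\<omega> = "laplacian_symbol M :: int ^ 'd \<Rightarrow> real"
  have w: "0 < w" using mesh_pos[OF M] by (simp add: w_def)
  have N0: "1 \<le> real N" using N by simp
  show ?thesis
  proof (cases "\<forall>k\<in>?S. c k = 0")
    case True
    then have "evolve ?S (mode M) ?\<omega> c t = (\<lambda>m. 0)" for t by (simp add: evolve_def fun_eq_iff)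
    then show ?thesis using q N0 by (simp add: Lp_norm_def)
  next
    case False
    show ?thesis
    proof (rule TT_star[where \<kappa> = "time_kernel (real N)"])
      show "finite X" by (simp add: X_def)
      show "0 \<le> dispersive_constant CARD('d) r" using dispersive_constant_pos[OF r, of "CARD('d)"] by simp
      show "continuous_on UNIV (time_kernel (real N))" by (rule time_kernel_continuous)
      show "integral {a..b} (\<lambda>s. time_kernel (real N) (t - s)) \<le> 4 * real N * ln (1 + real N)"
        if "t \<in> {a..b}" for t
        using integral_time_kernel_le[OF N0 ab(2) that] .
      show "cmod (\<Sum>k\<in>?S. evolve_adjoint X w (mode M) ?\<omega> t f k * cnj (evolve_adjoint X w (mode M) ?\<omega> s g k)) \<le>
          dispersive_constant CARD('d) r * time_kernel (real N) (t - s) powr (2 / q) *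
          (Lp_norm X w (r / (r - 1)) f * Lp_norm X w (r / (r - 1)) g)"
        if ts: "t \<in> {a..b}" "s \<in> {a..b}" for t s f g
      proof -
        have "\<bar>t - s\<bar> * real N \<le> (b - a) * real N" using ts by (intro mult_right_mono) auto
        then show ?thesis
          unfolding dispersive_constant_def X_def w_def
          using ab(2) q by (intro shell_dispersive_estimate M N r qr) linarith+
      qed
      show "\<exists>m\<in>X. evolve ?S (mode M) ?\<omega> c t m \<noteq> 0" for t
      proof (rule ccontr)
        assume "\<not> ?thesis"
        then have "(2 * pi) ^ CARD('d) * (\<Sum>k\<in>?S. (cmod (c k))\<^sup>2) = 0"
          using evolve_mode_energy[OF M frequency_shell_subset, of N ?\<omega> c t] by (simp add: X_def)
        then show False using False by (simp add: sum_nonneg_eq_0_iff)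
      qed
    qed (use w ab q r N0 in \<open>auto simp: time_kernel_pos time_kernel_minus\<close>)
  qed
qed

lemma half_le_japanese_bracket:
  assumes "k \<in> frequency_shell M (2 ^ i)"
  shows "2 ^ i / 2 \<le> japanese_bracket (real_vec k)"
proof (cases i)
  case 0
  have "1 \<le> sqrt (1 + (norm (real_vec k))\<^sup>2)" by simp
  then have "1 / 2 \<le> japanese_bracket (real_vec k)" unfolding japanese_bracket_def by linarith
  then show ?thesis by (simp add: 0)
next
  case (Suc n)
  from assms obtain j where j: "2 ^ n \<le> \<bar>k $ j\<bar>"
    by (auto simp: frequency_shell_def frequency_cube_def not_less Suc)
  then have "real_of_int (2 ^ n) \<le> real_of_int \<bar>k $ j\<bar>" unfolding of_int_le_iff .
  then have "2 ^ n \<le> \<bar>real_vec k $ j\<bar>" by (simp add: real_vec_def)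
  also have "\<dots> \<le> norm (real_vec k)" by (rule component_le_norm_cart)
  also have "\<dots> \<le> japanese_bracket (real_vec k)"
    unfolding japanese_bracket_def by (rule real_le_rsqrt) simp
  finally show ?thesis by (simp add: Suc)
qed

text \<open>
  The norm of \<open>\<langle>\<nabla>\<^sub>h\<rangle>\<^sup>s u\<close> in terms of Fourier coefficients, up to the factor \<open>(2 \<pi>)\<^sup>d\<^sup>/\<^sup>2\<close> of Parseval's
  identity.
\<close>

definition sobolev_norm :: "nat \<Rightarrow> real \<Rightarrow> (int ^ 'd::finite \<Rightarrow> complex) \<Rightarrow> real" where
  "sobolev_norm M s c =
    sqrt (\<Sum>k\<in>representatives M. (japanese_bracket (real_vec k) powr s * cmod (c k))\<^sup>2)"

lemma shell_l2_le_sobolev: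
  assumes "0 \<le> s"
  shows "sqrt (\<Sum>k\<in>frequency_shell M (2 ^ i). (cmod (c k))\<^sup>2) \<le>
    2 powr s * (2 ^ i) powr (- s) * sobolev_norm M s c"
proof -
  let ?S = "frequency_shell M (2 ^ i)" and ?v = "(2 ^ i / 2 :: real) powr s"
  have "?v * sqrt (\<Sum>k\<in>?S. (cmod (c k))\<^sup>2) = sqrt (\<Sum>k\<in>?S. (?v * cmod (c k))\<^sup>2)"
    by (simp add: power_mult_distrib real_sqrt_mult flip: sum_distrib_left)
  also have "\<dots> \<le> sqrt (\<Sum>k\<in>?S. (japanese_bracket (real_vec k) powr s * cmod (c k))\<^sup>2)"
    using assms
    by (intro real_sqrt_le_mono sum_mono power_mono mult_right_mono powr_mono2
        half_le_japanese_bracket[where i = i and M = M]) auto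
  also have "\<dots> \<le> sobolev_norm M s c"
    unfolding sobolev_norm_def
    by (intro real_sqrt_le_mono sum_mono2 finite_representatives frequency_shell_subset) auto
  finally have "sqrt (\<Sum>k\<in>?S. (cmod (c k))\<^sup>2) \<le> sobolev_norm M s c / ?v"
    by (simp add: field_simps)
  also have "\<dots> = 2 powr s * (2 ^ i) powr (- s) * sobolev_norm M s c"
    by (simp add: powr_divide powr_minus_divide field_simps)
  finally show ?thesis .
qed

lemma continuous_on_Lp_evolve:
  assumes "M > 0" "0 < r"
  shows "continuous_on A (\<lambda>t. Lp_norm X (mesh M ^ d) r (evolve S e \<omega> c t))"
  using assms mesh_pos[of M] by (intro continuous_on_Lp_norm continuous_on_evolve) auto

definition shell_constant :: "nat \<Rightarrow> real \<Rightarrow> real \<Rightarrow> real \<Rightarrow> real" where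
  "shell_constant d q r0 \<epsilon> = sqrt (dispersive_constant d r0) *
    (4 * 2 powr (q * \<epsilon> / 2) / (q * \<epsilon> / 2)) powr (1 / q) * 2 powr (2 / q + \<epsilon>)"

lemma shell_constant_pos:
  assumes "2 < r0" "2 \<le> q" "0 < \<epsilon>"
  shows "0 < shell_constant d q r0 \<epsilon>"
  using dispersive_constant_pos[OF assms(1)] assms by (simp add: shell_constant_def)

text \<open>
  Each of the \<open>N\<close> time intervals contributes \<open>O(N ln (1 + N))\<close> times the \<open>q\<close>-th power of the \<open>L\<^sup>2\<close> norm
  of the shell. That norm is \<open>O(N\<^sup>-\<^sup>2\<^sup>/\<^sup>q\<^sup>-\<^sup>\<epsilon>)\<close> times the Sobolev norm, which compensates \<open>N\<^sup>2\<close>, and half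
  of the gain \<open>N\<^sup>-\<^sup>\<epsilon>\<^sup>q\<close> is spent on the logarithm.
\<close>

lemma shell_strichartz:
  fixes c :: "int ^ 'd::finite \<Rightarrow> complex" and q r r0 \<epsilon> :: real and M i :: nat
  defines "X \<equiv> representatives M :: (int ^ 'd) set" and "w \<equiv> mesh M ^ CARD('d)"
    and "N \<equiv> 2 ^ i :: nat"
  assumes M: "M > 0" and q: "2 \<le> q" and r: "2 < r0" "r0 \<le> r" and \<epsilon>: "0 < \<epsilon>"
    and qr: "real CARD('d) / 3 * (1 - 2 / r) \<le> 2 / q"
  shows "integral {0..1} (\<lambda>t. Lp_norm X w r (evolve (frequency_shell M N) (mode M) (laplacian_symbol M) c t) powr q) \<le>
    (shell_constant CARD('d) q r0 \<epsilon> * real N powr (- \<epsilon> / 2) * sobolev_norm M (2 / q + \<epsilon>) c) powr q"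
proof -
  let ?u = "\<lambda>t. Lp_norm X w r (evolve (frequency_shell M N) (mode M) (laplacian_symbol M) c t)"
  define s where "s = 2 / q + \<epsilon>"
  define Q where "Q = sobolev_norm M s c"
  define E where "E = sqrt (\<Sum>k\<in>frequency_shell M N. (cmod (c k))\<^sup>2)"
  define C0 where "C0 = dispersive_constant CARD('d) r0"
  define \<eta> where "\<eta> = q * \<epsilon> / 2"
  have \<eta>: "\<eta> > 0" using q \<epsilon> by (simp add: \<eta>_def)
  have N: "1 \<le> N" by (simp add: N_def)
  then have N0: "1 \<le> real N" by simp
  have Q: "0 \<le> Q" by (simp add: Q_def sobolev_norm_def sum_nonneg)
  have E: "0 \<le> E" by (simp add: E_def sum_nonneg)
  have Cr: "0 < dispersive_constant CARD('d) r" using dispersive_constant_pos r by simp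
  have C0: "0 < C0" using dispersive_constant_pos[OF r(1)] by (simp add: C0_def)
  have "integral {0..1} (\<lambda>t. ?u t powr q) \<le>
      real N * ((sqrt (dispersive_constant CARD('d) r) * E) powr q * (4 * real N * ln (1 + real N)))"
  proof (rule integral_unit_interval_pieces[OF _ N])
    have "continuous_on {0..1} ?u" unfolding w_def using M r by (intro continuous_on_Lp_evolve) auto
    then show "continuous_on {0..1} (\<lambda>t. ?u t powr q)"
      using q by (intro continuous_on_powr' continuous_intros) (auto simp: Lp_norm_nonneg)
    show "integral {a..b} (\<lambda>t. ?u t powr q) \<le>
        (sqrt (dispersive_constant CARD('d) r) * E) powr q * (4 * real N * ln (1 + real N))"
      if "a < b" "(b - a) * real N \<le> 1" for a b
      unfolding X_def w_def E_def using r
      by (intro shell_strichartz_short_interval M N that q qr) linarith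
  qed
  also have "\<dots> \<le> real N * ((sqrt C0 * (2 powr s * real N powr (- s) * Q)) powr q *
      (4 * real N * ((2 * real N) powr \<eta> / \<eta>)))"
  proof (intro mult_left_mono mult_mono powr_mono2)
    show "sqrt (dispersive_constant CARD('d) r) \<le> sqrt C0"
      unfolding C0_def by (intro real_sqrt_le_mono dispersive_constant_antimono r)
    show "E \<le> 2 powr s * real N powr (- s) * Q"
      unfolding E_def Q_def N_def using shell_l2_le_sobolev[where s = s and M = M and i = i and c = c] q \<epsilon> by (simp add: s_def)
    have "ln (1 + real N) \<le> (1 + real N) powr \<eta> / \<eta>" using \<eta> by (intro ln_powr_bound) auto
    also have "\<dots> \<le> (2 * real N) powr \<eta> / \<eta>"
      using \<eta> N0 by (intro divide_right_mono powr_mono2) auto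
    finally show "ln (1 + real N) \<le> (2 * real N) powr \<eta> / \<eta>" .
  qed (use q N0 C0 Q \<eta> Cr E in auto)
  also have "\<dots> = (sqrt C0 * (4 * 2 powr \<eta> / \<eta>) powr (1 / q) * 2 powr s * real N powr (- \<epsilon> / 2) * Q) powr q"
  proof -
    have "real N * (real N * (real N powr (- (s * q)) * real N powr \<eta>)) = real N powr (1 + 1 + - (s * q) + \<eta>)"
      by (simp only: powr_add) (simp add: mult_ac)
    also have "1 + 1 + - (s * q) + \<eta> = - \<epsilon> / 2 * q" using q by (simp add: s_def \<eta>_def field_simps)
    finally have "real N * (real N * (real N powr (- (s * q)) * real N powr \<eta>)) = real N powr (- \<epsilon> / 2 * q)" .
    moreover have "((4 * 2 powr \<eta> / \<eta>) powr (1 / q)) powr q = 4 * 2 powr \<eta> / \<eta>"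
      using q \<eta> by (simp add: powr_powr)
    moreover have "real N * ((sqrt C0 * (2 powr s * real N powr (- s) * Q)) powr q * (4 * real N * ((2 * real N) powr \<eta> / \<eta>))) =
        sqrt C0 powr q * (4 * 2 powr \<eta> / \<eta>) * (2 powr s) powr q *
        (real N * (real N * (real N powr (- (s * q)) * real N powr \<eta>))) * Q powr q"
      by (simp add: powr_mult powr_powr mult_ac)
    ultimately show ?thesis by (simp add: powr_mult powr_powr)
  qed
  finally show ?thesis by (simp add: shell_constant_def C0_def \<eta>_def s_def Q_def)
qed

lemma sum_over_shells:
  fixes f :: "int ^ 'd::finite \<Rightarrow> complex"
  shows "(\<Sum>k\<in>frequency_cube M (2 ^ n). f k) = (\<Sum>i\<le>n. \<Sum>k\<in>frequency_shell M (2 ^ i). f k)"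
proof (induction n)
  case 0
  have "frequency_cube M 0 = ({} :: (int ^ 'd) set)" by (auto simp: frequency_cube_def)
  then show ?case by (simp add: frequency_shell_def)
next
  case (Suc n)
  have half: "(2::nat) ^ Suc n div 2 = 2 ^ n" by simp
  have "(\<Sum>k\<in>frequency_shell M (2 ^ Suc n). f k) =
      (\<Sum>k\<in>frequency_cube M (2 ^ Suc n). f k) - (\<Sum>k\<in>frequency_cube M (2 ^ n). f k)"
    unfolding frequency_shell_def half by (intro sum_diff frequency_cube_mono) auto
  then show ?case using Suc by simp
qed

lemma representatives_eq_cube:
  obtains n where "representatives M = (frequency_cube M (2 ^ n) :: (int ^ 'd::finite) set)"
proof
  have e: "int M < int (2 ^ M)" by (simp only: of_nat_less_iff less_exp)
  have "\<bar>k $ j\<bar> < int (2 ^ Suc M)" if "k \<in> representatives M" for k :: "int ^ 'd" and j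
  proof -
    have "- int M \<le> k $ j \<and> k $ j \<le> int M - 1" using that by (auto simp: representatives_def)
    moreover have "int (2 ^ Suc M) = 2 * int (2 ^ M)" by simp
    ultimately show ?thesis using e by linarith
  qed
  then show "representatives M = (frequency_cube M (2 ^ Suc M) :: (int ^ 'd) set)"
    unfolding frequency_cube_def by blast
qed

definition strichartz_constant :: "nat \<Rightarrow> real \<Rightarrow> real \<Rightarrow> real \<Rightarrow> real" where
  "strichartz_constant d q r0 \<epsilon> = shell_constant d q r0 \<epsilon> / (1 - 2 powr (- \<epsilon> / 2))"

lemma two_powr_neg_less_1: "0 < \<epsilon> \<Longrightarrow> 2 powr (- \<epsilon> / 2) < (1 :: real)"
  using powr_less_mono[of "- \<epsilon> / 2" 0 "2 :: real"] by simp

lemma strichartz_constant_pos: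
  assumes "2 < r0" "2 \<le> q" "0 < \<epsilon>"
  shows "0 < strichartz_constant d q r0 \<epsilon>"
  using shell_constant_pos[OF assms] two_powr_neg_less_1[OF assms(3)]
  by (simp add: strichartz_constant_def)

text \<open>
  The shells are added by Minkowski's inequality in space and in time; the bounds for the single
  shells form a geometric series. The auxiliary exponent \<open>r0\<close> makes the constant uniform over all
  \<open>r \<ge> r0\<close>, which the passage to the limit \<open>r \<rightarrow> \<infinity>\<close> requires.
\<close>

lemma strichartz_with_loss:
  fixes c :: "int ^ 'd::finite \<Rightarrow> complex" and q r r0 \<epsilon> :: real and M :: nat
  defines "X \<equiv> representatives M :: (int ^ 'd) set" and "w \<equiv> mesh M ^ CARD('d)"
  assumes M: "M > 0" and q: "2 \<le> q" and r: "2 < r0" "r0 \<le> r" and \<epsilon>: "0 < \<epsilon>"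
    and qr: "real CARD('d) / 3 * (1 - 2 / r) \<le> 2 / q"
  shows "integral {0..1} (\<lambda>t. Lp_norm X w r (evolve X (mode M) (laplacian_symbol M) c t) powr q) \<le>
    (strichartz_constant CARD('d) q r0 \<epsilon> * sobolev_norm M (2 / q + \<epsilon>) c) powr q"
proof -
  let ?\<omega> = "laplacian_symbol M :: int ^ 'd \<Rightarrow> real"
  define Q where "Q = sobolev_norm M (2 / q + \<epsilon>) c"
  define D where "D = shell_constant CARD('d) q r0 \<epsilon>"
  define \<rho> where "\<rho> = (2::real) powr (- \<epsilon> / 2)"
  have D: "0 < D" unfolding D_def by (rule shell_constant_pos[OF r(1) q \<epsilon>])
  have \<rho>: "0 < \<rho>" "\<rho> < 1" using two_powr_neg_less_1[OF \<epsilon>] by (auto simp: \<rho>_def)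
  have Q: "0 \<le> Q" by (simp add: Q_def sobolev_norm_def sum_nonneg)
  have w: "0 < w" using mesh_pos[OF M] by (simp add: w_def)
  show ?thesis
  proof (cases "Q = 0")
    case True
    have "0 < japanese_bracket (real_vec k)" for k :: "int ^ 'd"
      unfolding japanese_bracket_def by (simp add: add_pos_nonneg)
    then have "c k = 0" if "k \<in> X" for k
      using True that unfolding Q_def sobolev_norm_def X_def
      by (auto simp: sum_nonneg_eq_0_iff less_imp_neq[symmetric])
    then have "evolve X (mode M) ?\<omega> c t = (\<lambda>m. 0)" for t by (simp add: evolve_def fun_eq_iff)
    then show ?thesis using q by (simp add: Lp_norm_def)
  next
    case False
    then have Q: "0 < Q" using Q by simp
    obtain n where n: "representatives M = (frequency_cube M (2 ^ n) :: (int ^ 'd) set)"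
      by (rule representatives_eq_cube)
    define b where "b i = D * real (2 ^ i) powr (- \<epsilon> / 2) * Q" for i :: nat
    let ?g = "\<lambda>i t. Lp_norm X w r (evolve (frequency_shell M (2 ^ i)) (mode M) ?\<omega> c t)"
    have "integral {0..1} (\<lambda>t. Lp_norm X w r (evolve X (mode M) ?\<omega> c t) powr q) \<le> (\<Sum>i\<le>n. b i) powr q"
    proof (rule integral_Minkowski[where g = ?g])
      show "integral {0..1} (\<lambda>t. ?g i t powr q) \<le> b i powr q" for i
        unfolding b_def D_def Q_def X_def w_def by (rule shell_strichartz[OF M q r \<epsilon> qr])
      show "continuous_on {0..1} (?g i)" for i
        unfolding w_def using M r by (intro continuous_on_Lp_evolve) auto
      show "continuous_on {0..1} (\<lambda>t. Lp_norm X w r (evolve X (mode M) ?\<omega> c t))"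
        unfolding w_def using M r by (intro continuous_on_Lp_evolve) auto
      show "0 \<le> Lp_norm X w r (evolve X (mode M) ?\<omega> c t) \<and>
          Lp_norm X w r (evolve X (mode M) ?\<omega> c t) \<le> (\<Sum>i\<le>n. ?g i t)" for t
      proof -
        have "evolve X (mode M) ?\<omega> c t = (\<lambda>m. \<Sum>i\<le>n. evolve (frequency_shell M (2 ^ i)) (mode M) ?\<omega> c t m)"
          unfolding X_def n evolve_def sum_over_shells ..
        then show ?thesis
          using Lp_norm_sum_le[of X w r "{..n}"] w r by (simp add: Lp_norm_nonneg X_def)
      qed
    qed (use D Q q in \<open>auto simp: b_def Lp_norm_nonneg\<close>)
    also have "\<dots> \<le> (D / (1 - \<rho>) * Q) powr q"
    proof (rule powr_mono2)
      have "real (2 ^ i) powr (- \<epsilon> / 2) = \<rho> ^ i" for i :: nat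
        unfolding \<rho>_def by (simp add: powr_powr powr_realpow[symmetric] mult.commute)
      then have "(\<Sum>i\<le>n. b i) = D * Q * (\<Sum>i\<le>n. \<rho> ^ i)"
        by (simp add: b_def sum_distrib_left mult_ac)
      also have "(\<Sum>i\<le>n. \<rho> ^ i) \<le> 1 / (1 - \<rho>)"
        using \<rho> sum_le_suminf[of "\<lambda>i. \<rho> ^ i" "{..n}"] by (simp add: summable_geometric suminf_geometric)
      finally show "(\<Sum>i\<le>n. b i) \<le> D / (1 - \<rho>) * Q" using D Q by (simp add: mult_left_mono)
      show "0 \<le> (\<Sum>i\<le>n. b i)" using D Q by (simp add: b_def sum_nonneg)
    qed (use q in simp)
    finally show ?thesis by (simp add: strichartz_constant_def D_def \<rho>_def Q_def)
  qed
qed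

section \<open>The mixed norms of the propagator\<close>

text \<open>
  The majorant \<open>h\<close> is continuous, and \<open>g\<close> enters only through a comparison of integrals; in this way
  the maximum over the lattice is treated without discussing its dependence on time.
\<close>

lemma unit_interval_norm_le:
  assumes q: "1 \<le> q" and h: "continuous_on {0..1} h" and gh: "\<And>t. t \<in> {0..1} \<Longrightarrow> \<bar>g t\<bar> \<le> h t"
    and B: "0 \<le> B" "integral {0..1} (\<lambda>t. h t powr q) \<le> B powr q"
  shows "unit_interval_norm (ereal q) g \<le> ennreal B"
proof -
  have h0: "0 \<le> h t" if "t \<in> {0..1}" for t using gh[OF that] by linarith
  let ?I = "\<integral>\<^sup>+ t. ennreal (\<bar>g t\<bar> powr q) \<partial>lebesgue_on {0..1}"
  have hc: "continuous_on {0..1} (\<lambda>t. h t powr q)"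
    using h h0 q by (intro continuous_on_powr' continuous_intros) auto
  have "?I \<le> (\<integral>\<^sup>+ t. ennreal (h t powr q) \<partial>lebesgue_on {0..1})"
    using gh q by (intro nn_integral_mono ennreal_leI powr_mono2) auto
  also have "\<dots> = (\<integral>\<^sup>+ t. ennreal (h t powr q) * indicator {0..1} t \<partial>lborel)"
    by (simp add: nn_integral_restrict_space nn_integral_completion)
  also have "\<dots> = ennreal (integral {0..1} (\<lambda>t. h t powr q))"
    by (intro nn_integral_has_integral_lebesgue' integrable_integral integrable_continuous_real hc) auto
  also have "\<dots> \<le> ennreal (B powr q)" using B by (intro ennreal_leI)
  finally have I: "?I \<le> ennreal (B powr q)" .
  then have fin: "?I \<noteq> \<infinity>" by (auto simp: top_unique)
  have "enn2real ?I \<le> B powr q" using enn2real_mono[OF I] by simp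
  then have "enn2real ?I powr (1 / q) \<le> (B powr q) powr (1 / q)"
    using q by (intro powr_mono2) auto
  also have "\<dots> = B" using q B by (simp add: powr_powr)
  finally show ?thesis using fin by (simp add: unit_interval_norm_def Let_def ennreal_leI)
qed

lemma lattice_norm_infinity_le:
  fixes f :: "int ^ 'd::finite \<Rightarrow> complex"
  assumes M: "M > 0" and r: "0 < r"
  shows "\<bar>lattice_norm M \<infinity> f\<bar> \<le> (mesh M ^ CARD('d)) powr (- 1 / r) *
    Lp_norm (representatives M) (mesh M ^ CARD('d)) r f"
proof -
  let ?X = "representatives M :: (int ^ 'd) set" and ?w = "mesh M ^ CARD('d)"
  have ne: "?X \<noteq> {}"
  proof -
    have "(0 :: int ^ 'd) \<in> ?X" using M by (simp add: representatives_def)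
    then show ?thesis by blast
  qed
  have "cmod (f m) \<le> ?w powr (- 1 / r) * Lp_norm ?X ?w r f" if m: "m \<in> ?X" for m
  proof -
    have "cmod (f m) powr r \<le> (\<Sum>x\<in>?X. cmod (f x) powr r)"
      using m by (intro member_le_sum) auto
    then have "(cmod (f m) powr r) powr (1 / r) \<le> (\<Sum>x\<in>?X. cmod (f x) powr r) powr (1 / r)"
      using r by (intro powr_mono2) auto
    also have "\<dots> = ?w powr (- 1 / r) * Lp_norm ?X ?w r f"
      unfolding Lp_norm_def powr_mult using mesh_pos[OF M] by (simp add: mult.assoc[symmetric] flip: powr_add)
    finally show ?thesis using r by (simp add: powr_powr)
  qed
  then have "(SUP m\<in>?X. cmod (f m)) \<le> ?w powr (- 1 / r) * Lp_norm ?X ?w r f"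
    using ne by (intro cSUP_least)
  moreover have "0 \<le> (SUP m\<in>?X. cmod (f m))"
  proof -
    obtain m where "m \<in> ?X" using ne by blast
    then have "cmod (f m) \<le> (SUP m\<in>?X. cmod (f m))" by (intro cSUP_upper) auto
    then show ?thesis using norm_ge_zero order_trans by blast
  qed
  ultimately show ?thesis by (simp add: lattice_norm_def)
qed

lemma sobolev_norm_le_bessel:
  fixes u :: "int ^ 'd::finite \<Rightarrow> complex"
  assumes M: "M > 0"
  shows "sobolev_norm M s (fourier_coeff M u) \<le> lattice_norm M 2 (lattice_bessel M s u)"
proof -
  have "1 \<le> (2 * pi) ^ CARD('d)" using pi_gt3 by (intro one_le_power) simp
  then have "1 * x \<le> (2 * pi) ^ CARD('d) * x" if "0 \<le> x" for x
    using that by (rule mult_right_mono)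
  then show ?thesis
    unfolding sobolev_norm_def lattice_norm_2_bessel[OF M]
    by (intro real_sqrt_le_mono) (simp add: sum_nonneg)
qed

lemma lattice_norm_2_propagator:
  fixes u0 :: "int ^ 'd::finite \<Rightarrow> complex"
  assumes M: "M > 0" and u0: "lattice_fun M u0"
  shows "lattice_norm M 2 (lattice_propagator M t u0) =
    sqrt ((2 * pi) ^ CARD('d) * (\<Sum>k\<in>representatives M. (cmod (fourier_coeff M u0 k))\<^sup>2))"
proof -
  have "lattice_propagator M t u0 = (\<lambda>m. \<Sum>k\<in>representatives M.
      (fourier_coeff M u0 k * cis (- (laplacian_symbol M k * t))) * mode M k m)"
    unfolding lattice_propagator_eq_evolve[OF M u0] evolve_def by (simp add: fun_eq_iff mult_ac)
  then show ?thesis by (simp only: lattice_norm_2_modes[OF M]) (simp add: norm_mult)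
qed

lemma energy_estimate:
  fixes u0 :: "int ^ 'd::finite \<Rightarrow> complex"
  assumes M: "M > 0" and u0: "lattice_fun M u0" and s: "0 \<le> s"
  shows "lattice_norm M 2 (lattice_propagator M t u0) \<le> lattice_norm M 2 (lattice_bessel M s u0)"
  unfolding lattice_norm_2_propagator[OF M u0] lattice_norm_2_bessel[OF M]
proof (intro real_sqrt_le_mono mult_left_mono sum_mono power_mono)
  fix k :: "int ^ 'd"
  have "1 \<le> japanese_bracket (real_vec k)" by (simp add: japanese_bracket_def)
  then have "1 \<le> japanese_bracket (real_vec k) powr s" using s by (rule ge_one_powr_ge_zero)
  then show "cmod (fourier_coeff M u0 k) \<le> japanese_bracket (real_vec k) powr s * cmod (fourier_coeff M u0 k)"
    using mult_right_mono[of 1 _ "cmod (fourier_coeff M u0 k)"] by simp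
qed auto

lemma strichartz_finite_exponents:
  fixes u0 :: "int ^ 'd::finite \<Rightarrow> complex" and q r \<epsilon> :: real
  assumes q: "2 \<le> q" and r: "2 < r" and \<epsilon>: "0 < \<epsilon>" and qr: "3 / q + real CARD('d) / r = real CARD('d) / 2"
    and M: "M > 0" and u0: "lattice_fun M u0"
  shows "mixed_norm M (ereal q) (ereal r) (\<lambda>t. lattice_propagator M t u0) \<le>
    ennreal (strichartz_constant CARD('d) q r \<epsilon> * lattice_norm M 2 (lattice_bessel M (2 / q + \<epsilon>) u0))"
  unfolding mixed_norm_def lattice_norm_eq_Lp_norm lattice_propagator_eq_evolve[OF M u0]
proof (rule unit_interval_norm_le[OF _ continuous_on_Lp_evolve[OF M]])
  let ?Q = "sobolev_norm M (2 / q + \<epsilon>) (fourier_coeff M u0)"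
    and ?b = "lattice_norm M 2 (lattice_bessel M (2 / q + \<epsilon>) u0)" and ?C = "strichartz_constant CARD('d) q r \<epsilon>"
  have C: "0 < ?C" by (rule strichartz_constant_pos[OF r q \<epsilon>])
  have Q: "0 \<le> ?Q" by (simp add: sobolev_norm_def sum_nonneg)
  have le: "?C * ?Q \<le> ?C * ?b" using C sobolev_norm_le_bessel[OF M] by (intro mult_left_mono) auto
  have "0 \<le> ?C * ?Q" using C Q by simp
  then show "0 \<le> ?C * ?b" using le by linarith
  have "real CARD('d) / 3 * (1 - 2 / r) \<le> 2 / q"
    using qr q r by (simp add: field_simps)
  then have "integral {0..1} (\<lambda>t. Lp_norm (representatives M) (mesh M ^ CARD('d)) r
      (evolve (representatives M) (mode M) (laplacian_symbol M) (fourier_coeff M u0) t) powr q) \<le> (?C * ?Q) powr q"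
    by (intro strichartz_with_loss M q r \<epsilon>) auto
  also have "\<dots> \<le> (?C * ?b) powr q" using le C Q q by (intro powr_mono2) auto
  finally show "integral {0..1} (\<lambda>t. Lp_norm (representatives M) (mesh M ^ CARD('d)) r
      (evolve (representatives M) (mode M) (laplacian_symbol M) (fourier_coeff M u0) t) powr q) \<le> (?C * ?b) powr q" .
qed (use q r Lp_norm_nonneg in auto)

text \<open>
  For \<open>r \<ge> 4\<close> the estimate holds with a constant that does not depend on \<open>r\<close>, and the
  factor \<open>h\<^sup>-\<^sup>d\<^sup>/\<^sup>r\<close> that compares the maximum with the \<open>L\<^sup>r\<close> norm tends to one for fixed \<open>h\<close>.
\<close>

lemma strichartz_sup_norm:
  fixes u0 :: "int ^ 'd::finite \<Rightarrow> complex" and q \<epsilon> :: real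
  assumes q: "2 \<le> q" and \<epsilon>: "0 < \<epsilon>" and qd: "3 / q = real CARD('d) / 2"
    and M: "M > 0" and u0: "lattice_fun M u0"
  shows "mixed_norm M (ereal q) \<infinity> (\<lambda>t. lattice_propagator M t u0) \<le>
    ennreal (strichartz_constant CARD('d) q 4 \<epsilon> * lattice_norm M 2 (lattice_bessel M (2 / q + \<epsilon>) u0))"
proof -
  let ?Q = "sobolev_norm M (2 / q + \<epsilon>) (fourier_coeff M u0)"
    and ?b = "lattice_norm M 2 (lattice_bessel M (2 / q + \<epsilon>) u0)" and ?C = "strichartz_constant CARD('d) q 4 \<epsilon>"
  let ?w = "mesh M ^ CARD('d)"
  have C: "0 < ?C" by (rule strichartz_constant_pos[OF _ q \<epsilon>]) simp
  have Q: "0 \<le> ?Q" by (simp add: sobolev_norm_def sum_nonneg)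
  have bound: "mixed_norm M (ereal q) \<infinity> (\<lambda>t. lattice_propagator M t u0) \<le> ennreal (?w powr (- 1 / r) * (?C * ?Q))"
    if r: "4 \<le> r" for r
    unfolding mixed_norm_def lattice_propagator_eq_evolve[OF M u0]
  proof (rule unit_interval_norm_le)
    let ?u = "\<lambda>t. Lp_norm (representatives M) ?w r
      (evolve (representatives M) (mode M) (laplacian_symbol M) (fourier_coeff M u0) t)"
    have "continuous_on {0..1} ?u" using r by (intro continuous_on_Lp_evolve M) auto
    then show "continuous_on {0..1} (\<lambda>t. ?w powr (- 1 / r) * ?u t)" by (intro continuous_intros)
    show "\<bar>lattice_norm M \<infinity> (evolve (representatives M) (mode M) (laplacian_symbol M) (fourier_coeff M u0) t)\<bar> \<le>
        ?w powr (- 1 / r) * ?u t" for t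
      using r by (intro lattice_norm_infinity_le M) auto
    show "0 \<le> ?w powr (- 1 / r) * (?C * ?Q)" using C Q by simp
    have "real CARD('d) / 3 * (1 - 2 / r) \<le> real CARD('d) / 3 * 1"
      using r by (intro mult_left_mono) auto
    also have "\<dots> = 2 / q" using qd q by (simp add: field_simps)
    finally have i: "integral {0..1} (\<lambda>t. ?u t powr q) \<le> (?C * ?Q) powr q"
      using r by (intro strichartz_with_loss M q \<epsilon>) auto
    have "integral {0..1} (\<lambda>t. (?w powr (- 1 / r) * ?u t) powr q) = (?w powr (- 1 / r)) powr q * integral {0..1} (\<lambda>t. ?u t powr q)"
      by (simp add: powr_mult)
    also have "\<dots> \<le> (?w powr (- 1 / r)) powr q * (?C * ?Q) powr q"
      by (intro mult_left_mono i) simp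
    finally show "integral {0..1} (\<lambda>t. (?w powr (- 1 / r) * ?u t) powr q) \<le> (?w powr (- 1 / r) * (?C * ?Q)) powr q"
      unfolding powr_mult[of "?w powr (- 1 / r)" "?C * ?Q"] .
  qed (use q in simp)
  have w0: "?w powr 0 = 1" using mesh_pos[OF M] by simp
  have "(\<lambda>n. - 1 / (4 + real n)) \<longlonglongrightarrow> 0"
    by (intro tendsto_divide_0[OF tendsto_const] filterlim_at_top_imp_at_infinity
        filterlim_tendsto_add_at_top[OF tendsto_const filterlim_real_sequentially])
  then have "(\<lambda>n. ?w powr (- 1 / (4 + real n)) * (?C * ?Q)) \<longlonglongrightarrow> ?w powr 0 * (?C * ?Q)"
    using mesh_pos[OF M] by (intro tendsto_mult tendsto_powr tendsto_const) auto
  then have "(\<lambda>n. ennreal (?w powr (- 1 / (4 + real n)) * (?C * ?Q))) \<longlonglongrightarrow> ennreal (?C * ?Q)"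
    unfolding w0 by (intro tendsto_ennrealI) simp
  then have "mixed_norm M (ereal q) \<infinity> (\<lambda>t. lattice_propagator M t u0) \<le> ennreal (?C * ?Q)"
    by (rule LIMSEQ_le_const) (use bound in auto)
  also have "\<dots> \<le> ennreal (?C * ?b)"
    using C sobolev_norm_le_bessel[OF M] by (intro ennreal_leI mult_left_mono) auto
  finally show ?thesis .
qed

lemma strichartz_energy:
  fixes u0 :: "int ^ 'd::finite \<Rightarrow> complex"
  assumes M: "M > 0" and u0: "lattice_fun M u0" and s: "0 \<le> s"
  shows "mixed_norm M \<infinity> 2 (\<lambda>t. lattice_propagator M t u0) \<le> ennreal (lattice_norm M 2 (lattice_bessel M s u0))"
proof -
  define K where "K = lattice_norm M 2 (lattice_propagator M 0 u0)"
  have e: "lattice_norm M 2 (lattice_propagator M t u0) = K" for t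
    by (simp only: K_def lattice_norm_2_propagator[OF M u0])
  have "0 \<le> K" unfolding K_def lattice_norm_2_propagator[OF M u0] by (simp add: sum_nonneg)
  have "mixed_norm M \<infinity> 2 (\<lambda>t. lattice_propagator M t u0) = esssup (lebesgue_on {0..1}) (\<lambda>t::real. ennreal \<bar>K\<bar>)"
    unfolding mixed_norm_def unit_interval_norm_def e by simp
  also have "\<dots> \<le> ennreal \<bar>K\<bar>" by (rule esssup_I) auto
  also have "\<dots> \<le> ennreal (lattice_norm M 2 (lattice_bessel M s u0))"
    using energy_estimate[OF M u0 s, of 0] \<open>0 \<le> K\<close> by (simp add: K_def ennreal_leI)
  finally show ?thesis .
qed

text \<open>
  The relation between the exponents forces \<open>q = \<infinity>\<close> exactly if \<open>r = 2\<close>.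
\<close>

lemma lattice_admissible_cases:
  assumes "lattice_admissible d q r" "0 < d"
  obtains (energy) "q = \<infinity>" "r = 2"
  | (infinite_r) q' where "q = ereal q'" "r = \<infinity>" "2 \<le> q'" "3 / q' = real d / 2"
  | (finite_pair) q' r' where "q = ereal q'" "r = ereal r'" "2 \<le> q'" "2 < r'" "3 / q' + real d / r' = real d / 2"
proof -
  have a: "2 \<le> q" "2 \<le> r" "3 / q + ereal (real d) / r = ereal (real d / 2)"
    using assms(1) by (auto simp: lattice_admissible_def)
  show ?thesis
  proof (cases q)
    case PInf
    note q = this
    show ?thesis
    proof (cases r)
      case (real r')
      then have "real d / r' = real d / 2" "r' \<ge> 2" using a q by auto
      then have "r' = 2" using assms(2) by (simp add: field_simps)
      then show ?thesis using energy q real by simp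
    qed (use a q assms(2) in auto)
  next
    case (real q')
    then have q': "2 \<le> q'" using a by simp
    show ?thesis
    proof (cases r)
      case PInf
      then show ?thesis using infinite_r[OF real PInf q'] a real q' by auto
    next
      case r: (real r')
      then have r': "2 \<le> r'" "3 / q' + real d / r' = real d / 2" using a real q' by auto
      moreover have "r' \<noteq> 2"
      proof
        assume "r' = 2"
        then have "3 / q' = 0" using r' by simp
        then show False using q' by simp
      qed
      ultimately show ?thesis using finite_pair[OF real r q'] by simp
    qed (use a in simp)
  qed (use a in simp)
qed

theorem theorem1p5:
  fixes q r :: ereal and \<epsilon> :: real
  assumes "lattice_admissible CARD('d::finite) q r" and "\<epsilon> > 0"
  shows "\<exists>C>0. \<forall>(M::nat) (u0 :: int ^ 'd \<Rightarrow> complex).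
    M > 0 \<longrightarrow> mesh M \<in> {0<..1} \<longrightarrow> lattice_fun M u0 \<longrightarrow>
    mixed_norm M q r (\<lambda>t. lattice_propagator M t u0)
      \<le> ennreal (C * lattice_norm M 2 (lattice_bessel M (real_of_ereal (2 / q) + \<epsilon>) u0))"
proof -
  have "0 < CARD('d)" by simp
  from assms(1) this show ?thesis
  proof (cases rule: lattice_admissible_cases)
    case energy
    show ?thesis
    proof (intro exI[of _ 1] conjI allI impI)
      fix M :: nat and u0 :: "int ^ 'd \<Rightarrow> complex"
      assume "M > 0" "lattice_fun M u0"
      then show "mixed_norm M q r (\<lambda>t. lattice_propagator M t u0) \<le>
          ennreal (1 * lattice_norm M 2 (lattice_bessel M (real_of_ereal (2 / q) + \<epsilon>) u0))"
        unfolding energy using strichartz_energy[of M u0 \<epsilon>] assms(2) by simp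
    qed simp
  next
    case (infinite_r q')
    have "0 < strichartz_constant CARD('d) q' 4 \<epsilon>"
      using infinite_r assms(2) by (intro strichartz_constant_pos) auto
    then show ?thesis
      using strichartz_sup_norm[OF infinite_r(3) assms(2) infinite_r(4)] infinite_r by (auto intro!: exI[of _ "strichartz_constant CARD('d) q' 4 \<epsilon>"])
  next
    case (finite_pair q' r')
    have "0 < strichartz_constant CARD('d) q' r' \<epsilon>"
      using finite_pair assms(2) by (intro strichartz_constant_pos) auto
    then show ?thesis
      using strichartz_finite_exponents[OF finite_pair(3,4) assms(2) finite_pair(5)] finite_pair
      by (auto intro!: exI[of _ "strichartz_constant CARD('d) q' r' \<epsilon>"])
  qed
qed

end
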